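(* Let $\alpha,\beta\in[0,2\pi)$, $s:=\sin(\alpha+\beta)\neq0$ and $r:=\sin(\alpha-\beta)$. Let $\nu_n(j)=|(U^{2n}\psi_0)(a_j)|^2$ ($j\in\mathbb{Z}$), where $a_j$ is the self-loop at $(0,j)$ and $\psi_0=\delta_{a_0}$. (1) If $0<|r|<1$, then continuously linear spreading occurs: for any real $a<b$, $$\lim_{n\to\infty}\sum_{a\le j/n\le b}\nu_n(j)=\int_a^b g(y)\,dy,\qquad g(y)=\frac{2s^2}{r^2}\,y^2f_K(y;|r|)\times\begin{cases}\mathbf{1}_{[0,\infty)}(y)&\text{if } sr>0,\\ \mathbf{1}_{(-\infty,0]}(y)&\text{if } sr<0.\end{cases}$$ (2) If $|r|=1$, then ballistic spreading occurs: $$\lim_{n\to\infty}\sum_{-\infty\le j/n\le y}\nu_n(j)=s^2\,\mathsf{H}(y-\operatorname{sgn}(rs)),$$ which implies that the limit density is $s^2\delta(y-\operatorname{sgn}(rs))$ ($\delta$ the Dirac delta). Moreover $$\lim_{n\to\infty}\nu_n\big(\operatorname{sgn}(rs)(n-j)\big)=s^2\,\delta_0(j),$$ where $\delta_0(j)=1$ if $j=0$ and $0$ otherwise. (3) If $|r|=0$, then localization occurs: $$\lim_{n\to\infty}\nu_{2n}(j)=\begin{cases}\dfrac{s^2}{\pi^2}\dfrac{4}{(j^2-1)^2}&\text{if } j\text{ is even},\\ 0&\text{otherwise},\end{cases}\qquad \lim_{n\to\infty}\nu_{2n+1}(j)=\begin{cases}\dfrac{s^2}{4}&\text{if } j\in\{1,-1\},\\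 0&\text{otherwise}.\end{cases}$$
   Context: Quantum walk: $\mathbb{Z}_+=\{0,1,2,\dots\}$, $V=\mathbb{Z}_+\times\mathbb{Z}$, $\partial V=\{(0,j):j\in\mathbb{Z}\}$, and $A=\{(\boldsymbol{x};d):\boldsymbol{x}\in V,\ d\in\{0,1,2,3\}\}$ is the arc set: $(\boldsymbol{x};d)$ is the arc with terminus $\boldsymbol{x}$ and origin $\boldsymbol{x}+(1,0)$ if $d=0$; $\boldsymbol{x}-(1,0)$ if $d=1$, $\boldsymbol{x}\notin\partial V$; $\boldsymbol{x}$ if $d=1$, $\boldsymbol{x}\in\partial V$ (a self-loop); $\boldsymbol{x}+(0,1)$ if $d=2$; $\boldsymbol{x}-(0,1)$ if $d=3$. The inverse arc $\bar a$ of $a$ exchanges origin and terminus: $(\boldsymbol{x};0)$ and $(\boldsymbol{x}+(1,0);1)$ are mutually inverse, $(\boldsymbol{x};2)$ and $(\boldsymbol{x}+(0,1);3)$ are mutually inverse, and each self-loop is its own inverse. $\delta_a\in\ell^2(A)$ is the Kronecker delta. The coin $C$ is the unitary on $\ell^2(A)$ with, for each $\boldsymbol{x}\in V$, $C\delta_{(\boldsymbol{x};0)}=\cos\beta\,\delta_{(\boldsymbol{x};3)}+\sin\beta\,\delta_{(\boldsymbol{x};2)}$, $C\delta_{(\boldsymbol{x};1)}=-\sin\beta\,\delta_{(\boldsymbol{x};3)}+\cos\beta\,\delta_{(\boldsymbol{x};2)}$, $C\delta_{(\boldsymbol{x};2)}=\cos\alpha\,\delta_{(\boldsymbol{x};1)}+\sin\alpha\,\delta_{(\boldsymbol{x};0)}$,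 $C\delta_{(\boldsymbol{x};3)}=-\sin\alpha\,\delta_{(\boldsymbol{x};1)}+\cos\alpha\,\delta_{(\boldsymbol{x};0)}$. The shift is $(S\psi)(a)=\psi(\bar a)$, and the time evolution is $U=SC$. The self-loop at $(0,j)$ is $a_j=((0,j);1)$. $\mathsf{H}(x)=1$ for $x\ge0$ and $0$ for $x<0$. For $p\in(0,1)$ the Konno density is $$f_K(x;p)=\frac{\sqrt{1-p^2}}{\pi(1-x^2)\sqrt{p^2-x^2}}\,\mathbf{1}_{(-p,p)}(x).$$ Terminology: linear spreading occurs (at the boundary) if and only if there exists a monotonically non-decreasing function $F\ (\neq0):\mathbb{R}_{\ge0}\to[0,1]$, not given by $c_0\mathsf{H}(\cdot)$ with some non-zero constant $c_0$, such that $\lim_{n\to\infty}\sum_{|j|<ny}\nu_n(j)=F(y)$ for any $y\in\mathbb{R}_{\ge0}$; it is continuously linear spreading if $F$ is continuous on $\mathbb{R}_{\ge0}$, and ballistic spreading if $F(y)$ is described by $c_0\mathsf{H}(y-1)$. Localization occurs (at the boundary) if and only if there exists $j\in\mathbb{Z}$ such that $\limsup_{T\to\infty}\frac1T\sum_{n=0}^{T-1}\nu_n(j)>0$.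
   Formalization: In (2), ballistic spreading is taken to mean F(y)=c₀H(y−1) for all y≥0 except y=1: with the window |j|<ny the limit at y=1 is F(1)=0 (the mass sits at j=±n), so the literal equality fails there. *)

theory Defs
  imports "HOL-Analysis.Analysis"
begin

section \<open>The arcs of the half plane\<close>

datatype dir = D0 | D1 | D2 | D3

type_synonym vertex = "nat \<times> int"
type_synonym arc = "vertex \<times> dir"

fun terminus :: "arc \<Rightarrow> vertex" where
  "terminus (x, d) = x"

fun origin :: "arc \<Rightarrow> vertex" where
  "origin ((i, j), D0) = (i + 1, j)"
| "origin ((i, j), D1) = (if i = 0 then (i, j) else (i - 1, j))"
| "origin ((i, j), D2) = (i, j + 1)"
| "origin ((i, j), D3) = (i, j - 1)"

definition self_loop :: "int \<Rightarrow> arc" where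
  "self_loop j = ((0, j), D1)"

fun inv_arc :: "arc \<Rightarrow> arc" where
  "inv_arc ((i, j), D0) = ((i + 1, j), D1)"
| "inv_arc ((i, j), D1) = (if i = 0 then self_loop j else ((i - 1, j), D0))"
| "inv_arc ((i, j), D2) = ((i, j + 1), D3)"
| "inv_arc ((i, j), D3) = ((i, j - 1), D2)"

lemma inv_arc_endpoints:
  "origin (inv_arc a) = terminus a" "terminus (inv_arc a) = origin a"
  by (cases a rule: inv_arc.cases; simp add: self_loop_def)+

lemma inv_arc_inv_arc [simp]: "inv_arc (inv_arc a) = a"
  by (cases a rule: inv_arc.cases) (simp_all add: self_loop_def)

lemma inv_arc_self_loop: "inv_arc (self_loop j) = self_loop j"
  by (simp add: self_loop_def)

lemma bij_inv_arc: "bij inv_arc"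
  by (rule o_bij[of inv_arc]) (auto simp: fun_eq_iff)

lemma UNIV_dir: "(UNIV :: dir set) = {D0, D1, D2, D3}"
  using dir.exhaust by auto

instance dir :: finite
  by standard (simp add: UNIV_dir)


section \<open>The quantum walk\<close>

definition kdelta :: "arc \<Rightarrow> arc \<Rightarrow> complex" where
  "kdelta a = (\<lambda>b. if b = a then 1 else 0)"

text \<open>The coin and the shift are local, so they are defined on arbitrary amplitude functions;
  they restrict to unitaries of the Hilbert space \<open>ell2\<close> below. The rows given here are
  those of the matrix whose columns are listed in \<open>coin_kdelta\<close>.\<close>

fun coin :: "real \<Rightarrow> real \<Rightarrow> (arc \<Rightarrow> complex) \<Rightarrow> arc \<Rightarrow> complex" where
  "coin \<alpha> \<beta> \<psi> (x, D0) = of_real (sin \<alpha>) * \<psi> (x, D2) + of_real (cos \<alpha>) * \<psi> (x, D3)"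
| "coin \<alpha> \<beta> \<psi> (x, D1) = of_real (cos \<alpha>) * \<psi> (x, D2) - of_real (sin \<alpha>) * \<psi> (x, D3)"
| "coin \<alpha> \<beta> \<psi> (x, D2) = of_real (sin \<beta>) * \<psi> (x, D0) + of_real (cos \<beta>) * \<psi> (x, D1)"
| "coin \<alpha> \<beta> \<psi> (x, D3) = of_real (cos \<beta>) * \<psi> (x, D0) - of_real (sin \<beta>) * \<psi> (x, D1)"

lemma coin_kdelta:
  "coin \<alpha> \<beta> (kdelta (x, D0)) =
     (\<lambda>b. of_real (cos \<beta>) * kdelta (x, D3) b + of_real (sin \<beta>) * kdelta (x, D2) b)"
  "coin \<alpha> \<beta> (kdelta (x, D1)) =
     (\<lambda>b. - of_real (sin \<beta>) * kdelta (x, D3) b + of_real (cos \<beta>) * kdelta (x, D2) b)"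
  "coin \<alpha> \<beta> (kdelta (x, D2)) =
     (\<lambda>b. of_real (cos \<alpha>) * kdelta (x, D1) b + of_real (sin \<alpha>) * kdelta (x, D0) b)"
  "coin \<alpha> \<beta> (kdelta (x, D3)) =
     (\<lambda>b. - of_real (sin \<alpha>) * kdelta (x, D1) b + of_real (cos \<alpha>) * kdelta (x, D0) b)"
proof -
  have *: "(\<And>y d. f (y, d) = g (y, d)) \<Longrightarrow> f = g" for f g :: "arc \<Rightarrow> complex"
    by auto
  show "coin \<alpha> \<beta> (kdelta (x, D0)) =
     (\<lambda>b. of_real (cos \<beta>) * kdelta (x, D3) b + of_real (sin \<beta>) * kdelta (x, D2) b)"
    by (rule *, case_tac d) (auto simp: kdelta_def)
  show "coin \<alpha> \<beta> (kdelta (x, D1)) =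
     (\<lambda>b. - of_real (sin \<beta>) * kdelta (x, D3) b + of_real (cos \<beta>) * kdelta (x, D2) b)"
    by (rule *, case_tac d) (auto simp: kdelta_def)
  show "coin \<alpha> \<beta> (kdelta (x, D2)) =
     (\<lambda>b. of_real (cos \<alpha>) * kdelta (x, D1) b + of_real (sin \<alpha>) * kdelta (x, D0) b)"
    by (rule *, case_tac d) (auto simp: kdelta_def)
  show "coin \<alpha> \<beta> (kdelta (x, D3)) =
     (\<lambda>b. - of_real (sin \<alpha>) * kdelta (x, D1) b + of_real (cos \<alpha>) * kdelta (x, D0) b)"
    by (rule *, case_tac d) (auto simp: kdelta_def)
qed

definition shift :: "(arc \<Rightarrow> complex) \<Rightarrow> arc \<Rightarrow> complex" where
  "shift \<psi> = (\<lambda>a. \<psi> (inv_arc a))"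

definition evolution :: "real \<Rightarrow> real \<Rightarrow> (arc \<Rightarrow> complex) \<Rightarrow> arc \<Rightarrow> complex" where
  "evolution \<alpha> \<beta> \<psi> = shift (coin \<alpha> \<beta> \<psi>)"

definition boundary_prob :: "real \<Rightarrow> real \<Rightarrow> nat \<Rightarrow> int \<Rightarrow> real" where
  "boundary_prob \<alpha> \<beta> n j =
     (cmod ((evolution \<alpha> \<beta> ^^ (2 * n)) (kdelta (self_loop 0)) (self_loop j)))\<^sup>2"


subsection \<open>Unitarity on the square-summable amplitudes\<close>

definition ell2 :: "(arc \<Rightarrow> complex) set" where
  "ell2 = {\<psi>. (\<lambda>a. (cmod (\<psi> a))\<^sup>2) summable_on UNIV}"

lemma has_sum_arc_iff:
  fixes f :: "arc \<Rightarrow> real"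
  assumes "\<And>a. f a \<ge> 0"
  shows "(f has_sum t) UNIV \<longleftrightarrow> ((\<lambda>x. \<Sum>d\<in>UNIV. f (x, d)) has_sum t) UNIV"
proof
  assume "(f has_sum t) UNIV"
  then have "(f has_sum t) (Sigma UNIV (\<lambda>_. UNIV))" by simp
  then show "((\<lambda>x. \<Sum>d\<in>UNIV. f (x, d)) has_sum t) UNIV"
    by (rule has_sum_SigmaD) (auto intro!: has_sum_finite)
next
  assume h: "((\<lambda>x. \<Sum>d\<in>UNIV. f (x, d)) has_sum t) UNIV"
  have "f summable_on (Sigma UNIV (\<lambda>_. UNIV))"
    by (rule summable_on_SigmaI[where g = "\<lambda>x. \<Sum>d\<in>UNIV. f (x, d)"])
       (use h assms in \<open>auto intro!: has_sum_finite simp: summable_on_def\<close>)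
  then have "(f has_sum t) (Sigma UNIV (\<lambda>_. UNIV))"
    using h by (intro has_sum_SigmaI[where g = "\<lambda>x. \<Sum>d\<in>UNIV. f (x, d)"]) (auto intro!: has_sum_finite)
  then show "(f has_sum t) UNIV" by simp
qed

lemma rotation_norm:
  fixes u v :: complex
  shows "(cmod (of_real (sin t) * u + of_real (cos t) * v))\<^sup>2 +
         (cmod (of_real (cos t) * u - of_real (sin t) * v))\<^sup>2 = (cmod u)\<^sup>2 + (cmod v)\<^sup>2"
proof -
  have "(sin t * a + cos t * b)\<^sup>2 + (cos t * a - sin t * b)\<^sup>2 = a\<^sup>2 + b\<^sup>2" for a b :: real
  proof -
    have "(sin t * a + cos t * b)\<^sup>2 + (cos t * a - sin t * b)\<^sup>2 =
      ((sin t)\<^sup>2 + (cos t)\<^sup>2) * (a\<^sup>2 + b\<^sup>2)"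
      by algebra
    then show ?thesis by simp
  qed
  from this[of "Re u" "Re v"] this[of "Im u" "Im v"] show ?thesis
    by (simp add: cmod_power2)
qed

lemma coin_isometry:
  "((\<lambda>a. (cmod (coin \<alpha> \<beta> \<psi> a))\<^sup>2) has_sum t) UNIV \<longleftrightarrow> ((\<lambda>a. (cmod (\<psi> a))\<^sup>2) has_sum t) UNIV"
proof -
  have "(\<Sum>d\<in>UNIV. (cmod (coin \<alpha> \<beta> \<psi> (x, d)))\<^sup>2) = (\<Sum>d\<in>UNIV. (cmod (\<psi> (x, d)))\<^sup>2)" for x
    using rotation_norm[of \<alpha> "\<psi> (x, D2)" "\<psi> (x, D3)"] rotation_norm[of \<beta> "\<psi> (x, D0)" "\<psi> (x, D1)"]
    by (simp add: UNIV_dir)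
  then show ?thesis by (simp add: has_sum_arc_iff)
qed

lemma shift_isometry:
  "((\<lambda>a. (cmod (shift \<psi> a))\<^sup>2) has_sum t) UNIV \<longleftrightarrow> ((\<lambda>a. (cmod (\<psi> a))\<^sup>2) has_sum t) UNIV"
  unfolding shift_def
  by (rule has_sum_reindex_bij_betw[OF bij_inv_arc, where f = "\<lambda>a. (cmod (\<psi> a))\<^sup>2"])

lemma coin_linear:
  "coin \<alpha> \<beta> (\<lambda>a. c * \<phi> a + \<psi> a) = (\<lambda>a. c * coin \<alpha> \<beta> \<phi> a + coin \<alpha> \<beta> \<psi> a)"
proof
  fix a show "coin \<alpha> \<beta> (\<lambda>a. c * \<phi> a + \<psi> a) a = c * coin \<alpha> \<beta> \<phi> a + coin \<alpha> \<beta> \<psi> a"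
    by (cases "(\<alpha>, \<beta>, \<psi>, a)" rule: coin.cases) (auto simp: algebra_simps)
qed

lemma bij_coin: "bij (coin \<alpha> \<beta>)"
proof -
  define D :: "(arc \<Rightarrow> complex) \<Rightarrow> arc \<Rightarrow> complex" where "D \<psi> = (\<lambda>(x, d). case d of
      D0 \<Rightarrow> of_real (cos \<beta>) * \<psi> (x, D3) + of_real (sin \<beta>) * \<psi> (x, D2)
    | D1 \<Rightarrow> of_real (cos \<beta>) * \<psi> (x, D2) - of_real (sin \<beta>) * \<psi> (x, D3)
    | D2 \<Rightarrow> of_real (cos \<alpha>) * \<psi> (x, D1) + of_real (sin \<alpha>) * \<psi> (x, D0)
    | D3 \<Rightarrow> of_real (cos \<alpha>) * \<psi> (x, D0) - of_real (sin \<alpha>) * \<psi> (x, D1))" for \<psi>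
  have sc: "of_real (sin t) * (of_real (sin t) * z) + of_real (cos t) * (of_real (cos t) * z) = z"
    for t and z :: complex
  proof -
    have "of_real (sin t) * (of_real (sin t) * z) + of_real (cos t) * (of_real (cos t) * z)
        = of_real ((sin t)\<^sup>2 + (cos t)\<^sup>2) * z"
      by (simp only: of_real_add of_real_power power2_eq_square) (simp add: algebra_simps)
    then show ?thesis by simp
  qed
  have sc': "of_real (cos t) * (of_real (cos t) * z) + of_real (sin t) * (of_real (sin t) * z) = z"
    for t and z :: complex
    using sc[of t z] by (simp add: add.commute)
  have "D (coin \<alpha> \<beta> \<psi>) a = \<psi> a" for \<psi> a
    by (cases "(\<alpha>, \<beta>, \<psi>, a)" rule: coin.cases) (auto simp: D_def algebra_simps sc sc')
  moreover have "coin \<alpha> \<beta> (D \<psi>) a = \<psi> a" for \<psi> a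
    by (cases "(\<alpha>, \<beta>, \<psi>, a)" rule: coin.cases) (auto simp: D_def algebra_simps sc sc')
  ultimately show ?thesis
    by (intro o_bij[of D]) (auto simp: fun_eq_iff)
qed

lemma coin_ell2: "bij_betw (coin \<alpha> \<beta>) ell2 ell2"
proof -
  have "\<psi> \<in> ell2 \<longleftrightarrow> coin \<alpha> \<beta> \<psi> \<in> ell2" for \<psi>
    unfolding ell2_def summable_on_def mem_Collect_eq coin_isometry ..
  with bij_coin[of \<alpha> \<beta>] show ?thesis
    by (auto simp: bij_betw_def inj_on_def image_iff surj_def) metis
qed

lemma shift_ell2: "bij_betw shift ell2 ell2"
proof -
  have "\<psi> \<in> ell2 \<longleftrightarrow> shift \<psi> \<in> ell2" for \<psi>
    unfolding ell2_def summable_on_def mem_Collect_eq shift_isometry ..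
  moreover have "shift (shift \<psi>) = \<psi>" for \<psi>
    by (simp add: shift_def)
  ultimately show ?thesis
    by (intro bij_betw_byWitness[where f' = shift]) auto
qed

lemma kdelta_ell2: "kdelta a \<in> ell2"
proof -
  have "(\<lambda>b. (cmod (kdelta a b))\<^sup>2) summable_on {a}" by simp
  then show ?thesis
    unfolding ell2_def mem_Collect_eq
    by (rule summable_on_cong_neutral[THEN iffD1, rotated -1]) (auto simp: kdelta_def)
qed

lemma boundary_prob_summable: "boundary_prob \<alpha> \<beta> n summable_on J"
proof -
  define \<psi> where "\<psi> = (evolution \<alpha> \<beta> ^^ (2 * n)) (kdelta (self_loop 0))"
  have "(evolution \<alpha> \<beta> ^^ m) (kdelta (self_loop 0)) \<in> ell2" for m
    by (induction m)
       (auto simp: kdelta_ell2 evolution_def bij_betw_apply[OF coin_ell2] bij_betw_apply[OF shift_ell2])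
  then have "(\<lambda>a. (cmod (\<psi> a))\<^sup>2) summable_on UNIV" by (simp add: ell2_def \<psi>_def)
  then have "(\<lambda>a. (cmod (\<psi> a))\<^sup>2) summable_on (self_loop ` J)"
    by (rule summable_on_subset_banach) auto
  then have "((\<lambda>a. (cmod (\<psi> a))\<^sup>2) \<circ> self_loop) summable_on J"
    by (subst (asm) summable_on_reindex) (auto simp: inj_on_def self_loop_def)
  moreover have "(\<lambda>a. (cmod (\<psi> a))\<^sup>2) \<circ> self_loop = boundary_prob \<alpha> \<beta> n"
    by (auto simp: boundary_prob_def \<psi>_def)
  ultimately show ?thesis by simp
qed


section \<open>Spreading and localization\<close>

definition heaviside :: "real \<Rightarrow> real" where
  "heaviside x = (if x \<ge> 0 then 1 else 0)"

definition konno_density :: "real \<Rightarrow> real \<Rightarrow> real" where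
  "konno_density p x =
     sqrt (1 - p\<^sup>2) / (pi * (1 - x\<^sup>2) * sqrt (p\<^sup>2 - x\<^sup>2)) * indicator {-p<..<p} x"

definition spreading_limit :: "(nat \<Rightarrow> int \<Rightarrow> real) \<Rightarrow> (real \<Rightarrow> real) \<Rightarrow> bool" where
  "spreading_limit \<nu> F \<longleftrightarrow>
     F \<in> {0..} \<rightarrow> {0..1} \<and> mono_on {0..} F \<and> (\<exists>y\<ge>0. F y \<noteq> 0) \<and>
     \<not> (\<exists>c\<^sub>0. c\<^sub>0 \<noteq> 0 \<and> (\<forall>y\<ge>0. F y = c\<^sub>0 * heaviside y)) \<and>
     (\<forall>y\<ge>0. (\<lambda>n. \<Sum>j | real_of_int \<bar>j\<bar> < real n * y. \<nu> n j) \<longlonglongrightarrow> F y)"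

definition linear_spreading :: "(nat \<Rightarrow> int \<Rightarrow> real) \<Rightarrow> bool" where
  "linear_spreading \<nu> \<longleftrightarrow> (\<exists>F. spreading_limit \<nu> F)"

definition continuously_linear_spreading :: "(nat \<Rightarrow> int \<Rightarrow> real) \<Rightarrow> bool" where
  "continuously_linear_spreading \<nu> \<longleftrightarrow> (\<exists>F. spreading_limit \<nu> F \<and> continuous_on {0..} F)"

text \<open>The limit \<open>F\<close> is compared with the step function \<open>c\<^sub>0 * heaviside (y - 1)\<close>
  away from its jump. At \<open>y = 1\<close> the window \<open>\<bar>j\<bar> < n\<close> omits the two
  extreme sites \<open>j = n\<close> and \<open>j = - n\<close>, so a walk whose mass sits exactly there has
  \<open>F 1 = 0\<close> whereas \<open>heaviside 0 = 1\<close>.\<close>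

definition ballistic_spreading :: "(nat \<Rightarrow> int \<Rightarrow> real) \<Rightarrow> bool" where
  "ballistic_spreading \<nu> \<longleftrightarrow>
     (\<exists>F c\<^sub>0. spreading_limit \<nu> F \<and> (\<forall>y\<ge>0. y \<noteq> 1 \<longrightarrow> F y = c\<^sub>0 * heaviside (y - 1)))"

definition localization :: "(nat \<Rightarrow> int \<Rightarrow> real) \<Rightarrow> bool" where
  "localization \<nu> \<longleftrightarrow> (\<exists>j. limsup (\<lambda>T. ereal (1 / real T * (\<Sum>n<T. \<nu> n j))) > 0)"

definition limit_density :: "real \<Rightarrow> real \<Rightarrow> real \<Rightarrow> real" where
  "limit_density s r y =
     2 * s\<^sup>2 / r\<^sup>2 * y\<^sup>2 * konno_density \<bar>r\<bar> y * indicator (if s * r > 0 then {0..} else {..0}) y"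

end

theory Submission
  imports Defs
begin

text \<open>After a Fourier transform in the direction of the boundary, two steps of the walk become one
  step of a reflecting walk on the half line, driven by the coin with rows \<open>(a, b)\<close> and
  \<open>(cnj b, - cnj a)\<close>, where \<open>a = s cos k - \<i> r sin k\<close>. The generating function of its return
  amplitudes is algebraic: it equals \<open>N / ((X - l) (X - m))\<close> with \<open>l, m\<close> on the unit circle
  and \<open>N\<close> having absolutely summable coefficients. Hence, for almost every \<open>k\<close>, the return
  amplitude is asymptotic to the contribution of a single edge state, whose phase \<open>\<omega>\<close> obeys
  \<open>sin \<omega> = r sin k\<close>. By dominated convergence the approximation holds in \<open>L\<^sup>1\<close>, so that all
  limits can be computed for the edge state alone. Its group velocity \<open>d\<omega> / dk\<close> yields the Konno
  density; it is constant if \<open>\<bar>r\<bar> = 1\<close> and vanishes if \<open>r = 0\<close>.\<close>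

section \<open>Square roots of polynomials as absolutely summable power series\<close>

text \<open>Poles and branch points of the generating function all lie on the unit circle, so its
  coefficients cannot be read off by continuing it beyond the disc. Absolute summability is the
  substitute: it gives the numerator a value at each pole, and the division by X - l telescopes to
  that value. The branch of the square root on the arcs between the branch points makes the
  numerator vanish at exactly one of the two poles, depending on the sign of s cos k; hence one edge
  state for each k. Nothing is claimed uniformly in k: poles and branch points merge where cos k =
  0, and only convergence almost everywhere together with the bound 1 on the amplitudes is used. The
  limit laws may have mass below 1 (it is s^2 if |r| = 1), so weak convergence is not taken from a
  continuity theorem for probability laws. It comes from approximation by trigonometric polynomials
  on [-1,1], where all j / n and all velocities lie. The characteristic functions are accessible
  because translating k by \<xi> / n in Parseval's identity multiplies the mass at j by cis (\<xi> j
  / n).\<close>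

definition sqrt_coeff :: "nat \<Rightarrow> real" where
  "sqrt_coeff n = (-1) ^ n * ((1/2) gchoose n)"

lemma sqrt_coeff_0 [simp]: "sqrt_coeff 0 = 1"
  by (simp add: sqrt_coeff_def)

lemma sqrt_coeff_Suc: "real (Suc n) * sqrt_coeff (Suc n) = (real n - 1/2) * sqrt_coeff n"
proof -
  have "real (Suc n) * (1/2 gchoose Suc n) = (1/2 - real n) * ((1/2::real) gchoose n)"
    using gbinomial_mult_1[of "1/2::real" n] by (simp add: algebra_simps)
  then have "(-1) ^ n * (real (Suc n) * (1/2 gchoose Suc n)) = (-1)^n * ((1/2 - real n) * ((1/2::real) gchoose n))"
    by simp
  then show ?thesis by (simp add: sqrt_coeff_def algebra_simps)
qed

text \<open>Partial sums of the coefficients of sqrt (1 - x) are the coefficients of (1 - x)^(-1/2),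
  which again have a closed form.\<close>

lemma sum_sqrt_coeff: "(\<Sum>k\<le>m. sqrt_coeff k) = (1 - 2 * real m) * sqrt_coeff m"
proof (induction m)
  case (Suc m)
  have "(1 - 2 * real m) * sqrt_coeff m = - 2 * (real (Suc m) * sqrt_coeff (Suc m))"
    unfolding sqrt_coeff_Suc by (simp add: algebra_simps)
  with Suc show ?case by (simp add: algebra_simps)
qed simp

lemma sqrt_coeff_nonpos: "n \<ge> 1 \<Longrightarrow> sqrt_coeff n \<le> 0"
proof (induction n rule: nat_induct_at_least)
  case base
  show ?case using sqrt_coeff_Suc[of 0] by simp
next
  case (Suc n)
  have "(real n - 1/2) * sqrt_coeff n \<le> 0"
    using Suc by (intro mult_nonneg_nonpos) auto
  then have "real (Suc n) * sqrt_coeff (Suc n) \<le> 0" by (simp only: sqrt_coeff_Suc)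
  then show ?case by (simp add: mult_le_0_iff del: of_nat_Suc)
qed

text \<open>Only the constant coefficient is positive, so the absolute values add up to 2 minus the
  plain partial sum, and that sum is non-negative by its closed form.\<close>

lemma sum_abs_sqrt_coeff: "(\<Sum>k\<le>m. \<bar>sqrt_coeff k\<bar>) \<le> 2"
proof -
  have "(\<Sum>k\<le>m. \<bar>sqrt_coeff k\<bar>) = (\<Sum>k\<le>m. (if k = 0 then 2 else 0) - sqrt_coeff k)"
    by (intro sum.cong refl) (auto simp: sqrt_coeff_nonpos abs_of_nonpos)
  also have "\<dots> = 2 - (1 - 2 * real m) * sqrt_coeff m"
    by (simp add: sum_subtractf sum_sqrt_coeff)
  finally have "(\<Sum>k\<le>m. \<bar>sqrt_coeff k\<bar>) = 2 - (1 - 2 * real m) * sqrt_coeff m" .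
  moreover have "(1 - 2 * real m) * sqrt_coeff m \<ge> 0"
    using sqrt_coeff_nonpos[of m] by (cases m) (auto intro: mult_nonpos_nonpos)
  ultimately show ?thesis by simp
qed

lemma summable_sqrt_coeff: "summable (\<lambda>n. \<bar>sqrt_coeff n\<bar>)"
proof (rule bounded_imp_summable)
  show "(\<Sum>k\<le>n. \<bar>sqrt_coeff k\<bar>) \<le> 2" for n by (rule sum_abs_sqrt_coeff)
qed auto

text \<open>Without the constant term the bound drops to 1. It keeps the series within distance 1 of
  the point 1 on the whole unit circle, which later fixes the sign of the root.\<close>

lemma suminf_abs_sqrt_coeff: "(\<Sum>n. \<bar>sqrt_coeff (Suc n)\<bar>) \<le> 1"
proof -
  have "(\<Sum>n. \<bar>sqrt_coeff n\<bar>) \<le> 2"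
  proof (rule suminf_le_const[OF summable_sqrt_coeff])
    fix n show "sum (\<lambda>k. \<bar>sqrt_coeff k\<bar>) {..<n} \<le> 2"
      using sum_abs_sqrt_coeff[of "n - 1"] by (cases n) (auto simp: lessThan_Suc_atMost)
  qed
  then show ?thesis using suminf_split_head[OF summable_sqrt_coeff] by simp
qed

section \<open>Evaluation of absolutely summable power series on the unit circle\<close>

definition fps_abs_summable :: "complex fps \<Rightarrow> bool" where
  "fps_abs_summable f \<longleftrightarrow> summable (\<lambda>n. norm (fps_nth f n))"

lemma fps_abs_summable_imp:
  assumes "fps_abs_summable f" "norm w = 1"
  shows "summable (\<lambda>n. norm (fps_nth f n * w ^ n))" "summable (\<lambda>n. fps_nth f n * w ^ n)"
  using assms summable_norm_cancel[of "\<lambda>n. fps_nth f n * w ^ n"]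
  by (auto simp: fps_abs_summable_def norm_mult norm_power)

lemma fps_abs_summable_mult:
  assumes "fps_abs_summable f" "fps_abs_summable g"
  shows "fps_abs_summable (f * g)"
proof -
  have "summable (\<lambda>n. \<Sum>i\<le>n. norm (fps_nth f i) * norm (fps_nth g (n - i)))"
    using assms by (intro summable_Cauchy_product) (auto simp: fps_abs_summable_def)
  then show ?thesis unfolding fps_abs_summable_def
    by (rule summable_comparison_test')
       (auto simp: fps_mult_nth atLeast0AtMost norm_mult[symmetric] intro!: norm_sum)
qed

lemma eval_fps_mult_abs:
  assumes "fps_abs_summable f" "fps_abs_summable g" "norm w = 1"
  shows "eval_fps (f * g) w = eval_fps f w * eval_fps g w"
proof -
  have "eval_fps f w * eval_fps g w =
    (\<Sum>n. \<Sum>i\<le>n. (fps_nth f i * w ^ i) * (fps_nth g (n - i) * w ^ (n - i)))"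
    unfolding eval_fps_def
    using assms by (intro Cauchy_product fps_abs_summable_imp)
  also have "(\<lambda>n. \<Sum>i\<le>n. (fps_nth f i * w ^ i) * (fps_nth g (n - i) * w ^ (n - i))) =
     (\<lambda>n. fps_nth (f * g) n * w ^ n)"
    by (auto simp: fps_mult_nth atLeast0AtMost sum_distrib_right power_add[symmetric] fun_eq_iff
             intro!: sum.cong)
  finally show ?thesis by (simp add: eval_fps_def)
qed

lemma fps_abs_summable_add:
  "fps_abs_summable f \<Longrightarrow> fps_abs_summable g \<Longrightarrow> fps_abs_summable (f + g)"
  unfolding fps_abs_summable_def
  by (rule summable_comparison_test'[where g = "\<lambda>n. norm (fps_nth f n) + norm (fps_nth g n)"])
     (auto intro: summable_add norm_triangle_ineq)

lemma eval_fps_add_abs: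
  assumes "fps_abs_summable f" "fps_abs_summable g" "norm w = 1"
  shows "eval_fps (f + g) w = eval_fps f w + eval_fps g w"
  unfolding eval_fps_def using assms
  by (subst suminf_add) (auto simp: fps_abs_summable_imp algebra_simps)

lemma fps_abs_summable_const: "fps_abs_summable (fps_const c)"
  unfolding fps_abs_summable_def
  by (rule summable_finite[of "{0}"]) auto

lemma fps_abs_summable_X: "fps_abs_summable fps_X"
  unfolding fps_abs_summable_def
  by (rule summable_finite[of "{1}"]) auto

definition fps_sqrt1 :: "complex \<Rightarrow> complex fps" where
  "fps_sqrt1 \<mu> = Abs_fps (\<lambda>n. of_real (sqrt_coeff n) * \<mu> ^ n)"

text \<open>Vandermonde's convolution for the exponents 1/2 + 1/2 = 1 leaves a binomial series with
  two non-zero terms.\<close>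

lemma fps_sqrt1_square: "fps_sqrt1 \<mu> * fps_sqrt1 \<mu> = 1 - fps_const \<mu> * fps_X"
proof (rule fps_ext)
  fix n
  have "(\<Sum>i=0..n. sqrt_coeff i * sqrt_coeff (n - i)) = (-1) ^ n * ((1::real) gchoose n)"
  proof -
    have "(\<Sum>i=0..n. sqrt_coeff i * sqrt_coeff (n - i)) =
      (\<Sum>i=0..n. (-1) ^ n * ((1/2 gchoose i) * ((1/2) gchoose (n - i))))"
      by (intro sum.cong refl) (auto simp: sqrt_coeff_def power_add[symmetric])
    also have "\<dots> = (-1) ^ n * ((1/2 + 1/2::real) gchoose n)"
      by (simp only: gbinomial_Vandermonde[symmetric] sum_distrib_left atLeast0AtMost)
    finally show ?thesis by simp
  qed
  moreover have "fps_nth (fps_sqrt1 \<mu> * fps_sqrt1 \<mu>) n =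
      of_real (\<Sum>i=0..n. sqrt_coeff i * sqrt_coeff (n - i)) * \<mu> ^ n"
    by (auto simp: fps_mult_nth fps_sqrt1_def sum_distrib_right power_add[symmetric] intro!: sum.cong)
  ultimately have "fps_nth (fps_sqrt1 \<mu> * fps_sqrt1 \<mu>) n = of_real ((-1) ^ n * ((1::real) gchoose n)) * \<mu> ^ n"
    by simp
  also have "\<dots> = fps_nth (1 - fps_const \<mu> * fps_X) n"
  proof -
    consider "n = 0" | "n = 1" | m where "n = Suc (Suc m)"
      by (metis One_nat_def not0_implies_Suc)
    then show ?thesis
    proof cases
      case 3
      have "(1::real) gchoose n = of_nat (1 choose n)" by (simp add: binomial_gbinomial)
      also have "\<dots> = 0" using 3 by (simp add: binomial_eq_0)
      finally show ?thesis using 3 by simp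
    qed auto
  qed
  finally show "fps_nth (fps_sqrt1 \<mu> * fps_sqrt1 \<mu>) n = fps_nth (1 - fps_const \<mu> * fps_X) n" .
qed

lemma fps_abs_summable_sqrt1: "norm \<mu> = 1 \<Longrightarrow> fps_abs_summable (fps_sqrt1 \<mu>)"
  using summable_sqrt_coeff by (simp add: fps_abs_summable_def fps_sqrt1_def norm_mult norm_power)

lemma eval_fps_sqrt1:
  assumes "norm \<mu> = 1" "norm w = 1"
  shows "eval_fps (fps_sqrt1 \<mu>) w = eval_fps (fps_sqrt1 1) (\<mu> * w)"
  by (simp add: eval_fps_def fps_sqrt1_def power_mult_distrib mult_ac)

lemma eval_fps_const [simp]: "eval_fps (fps_const c) w = c"
proof -
  have "(\<lambda>n. fps_nth (fps_const c) n * w ^ n) sums (\<Sum>n\<in>{0}. fps_nth (fps_const c) n * w ^ n)"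
    by (rule sums_finite) auto
  then show ?thesis by (simp add: eval_fps_def sums_unique[symmetric])
qed

text \<open>Both sides square to 1 - cis \<phi>, whose argument is (\<phi> - pi) / 2, so they agree
  up to sign. The real part decides: it is non-negative on the left and positive on the
  right.\<close>

lemma eval_fps_sqrt1_cis:
  assumes "0 < \<phi>" "\<phi> < 2 * pi"
  shows "eval_fps (fps_sqrt1 1) (cis \<phi>) = of_real (sqrt (2 * sin (\<phi> / 2))) * cis ((\<phi> - pi) / 4)"
proof -
  define w where "w = cis \<phi>"
  define h where "h = eval_fps (fps_sqrt1 1) w"
  have w: "norm w = 1" by (simp add: w_def)
  have sm: "fps_abs_summable (fps_sqrt1 1)" by (simp add: fps_abs_summable_sqrt1)
  have "h\<^sup>2 = eval_fps (1 - fps_const 1 * fps_X) w"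
    using eval_fps_mult_abs[OF sm sm w] by (simp add: h_def fps_sqrt1_square power2_eq_square)
  also have "1 - fps_const 1 * fps_X = fps_const (1::complex) + fps_const (-1) * fps_X"
    by (simp flip: fps_const_neg)
  also have "eval_fps \<dots> w = 1 - w"
    using w fps_abs_summable_const[of 1] by (subst eval_fps_add_abs)
      (auto simp: eval_fps_mult_abs fps_abs_summable_const fps_abs_summable_X fps_abs_summable_mult
            simp del: fps_const_neg)
  finally have h2: "h\<^sup>2 = 1 - w" .
  \<comment> \<open>The tail bound gives |h - 1| \<le> 1, which puts \<open>h\<close> in the closed
    right half-plane.\<close>
  have Re_h: "Re h \<ge> 0"
  proof -
    have s1: "summable (\<lambda>n. fps_nth (fps_sqrt1 1) n * w ^ n)"
      by (rule fps_abs_summable_imp[OF sm w])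
    have "h = 1 + (\<Sum>n. of_real (sqrt_coeff (Suc n)) * w ^ Suc n)"
      using suminf_split_head[OF s1] by (simp add: h_def eval_fps_def fps_sqrt1_def)
    moreover have "norm (\<Sum>n. of_real (sqrt_coeff (Suc n)) * w ^ Suc n) \<le> (\<Sum>n. \<bar>sqrt_coeff (Suc n)\<bar>)"
    proof -
      have eq: "(\<lambda>n. norm (of_real (sqrt_coeff (Suc n)) * w ^ Suc n)) = (\<lambda>n. \<bar>sqrt_coeff (Suc n)\<bar>)"
        using w by (simp add: norm_mult norm_power)
      have "summable (\<lambda>n. \<bar>sqrt_coeff (Suc n)\<bar>)"
        using summable_Suc_iff[of "\<lambda>n. \<bar>sqrt_coeff n\<bar>"] summable_sqrt_coeff by simp
      then have "summable (\<lambda>n. norm (of_real (sqrt_coeff (Suc n)) * w ^ Suc n))"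
        by (simp only: eq)
      from summable_norm[OF this] show ?thesis by (simp only: eq)
    qed
    ultimately have "norm (h - 1) \<le> 1" using suminf_abs_sqrt_coeff by simp
    then have "\<bar>Re (h - 1)\<bar> \<le> 1" using abs_Re_le_cmod order_trans by blast
    then show ?thesis by simp
  qed
  define g where "g = of_real (sqrt (2 * sin (\<phi> / 2))) * cis ((\<phi> - pi) / 4)"
  have pos: "sin (\<phi> / 2) > 0" using assms by (intro sin_gt_zero) auto
  have g2: "g\<^sup>2 = 1 - w"
  proof -
    have "g\<^sup>2 = of_real (2 * sin (\<phi> / 2)) * cis ((\<phi> - pi) / 2)"
    proof -
      have "real 2 * ((\<phi> - pi) / 4) = (\<phi> - pi) / 2" by simp
      then have "(cis ((\<phi> - pi) / 4))\<^sup>2 = cis ((\<phi> - pi) / 2)"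
        by (simp only: Complex.DeMoivre)
      with pos show ?thesis by (simp add: g_def power_mult_distrib flip: of_real_power)
    qed
    also have "(\<phi> - pi) / 2 = \<phi> / 2 - pi / 2" by (simp add: field_simps)
    also have "cis (\<phi> / 2 - pi / 2) = Complex (sin (\<phi>/2)) (- cos (\<phi>/2))"
      by (simp add: complex_eq_iff cos_diff sin_diff)
    also have "of_real (2 * sin (\<phi> / 2)) * \<dots> = 1 - w"
      using cos_double_sin[of "\<phi>/2"] sin_double[of "\<phi>/2"]
      by (simp add: complex_eq_iff w_def power2_eq_square)
    finally show ?thesis .
  qed
  have "cos ((\<phi> - pi) / 4) > 0" using assms by (intro cos_gt_zero_pi) auto
  then have "Re g > 0" using pos by (simp add: g_def)
  moreover have "h = g \<or> h = - g" using h2 g2 by (simp flip: power2_eq_iff)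
  ultimately have "h = g" using Re_h by auto
  then show ?thesis by (simp add: h_def g_def w_def)
qed

section \<open>Poles on the unit circle\<close>

text \<open>Coefficientwise the hypothesis reads N_n = K_(n-1) - l K_n; multiplied by l^n it
  telescopes.\<close>

lemma simple_pole_coeff:
  fixes K N :: "complex fps"
  assumes K: "K * (fps_X - fps_const l) = N" and l: "l \<noteq> 0"
  shows "fps_nth K n * l ^ Suc n = - (\<Sum>m\<le>n. fps_nth N m * l ^ m)"
proof (induction n)
  case 0
  have "fps_nth N 0 = - l * fps_nth K 0" by (simp add: K[symmetric])
  then show ?case by simp
next
  case (Suc n)
  have "fps_nth N (Suc n) = fps_nth K n - l * fps_nth K (Suc n)"
    by (simp add: K[symmetric] algebra_simps)
  then have "fps_nth N (Suc n) * l ^ Suc n = fps_nth K n * l ^ Suc n - fps_nth K (Suc n) * l ^ Suc (Suc n)"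
    by (simp only:) (simp add: algebra_simps)
  with Suc show ?case by simp
qed

text \<open>The sums in the telescoped formula converge to the value of \<open>N\<close> at
  \<open>l\<close>, by absolute summability and |l| = 1.\<close>

lemma simple_pole_limit:
  assumes K: "K * (fps_X - fps_const l) = N" and l: "norm l = 1" and N: "fps_abs_summable N"
  shows "(\<lambda>n. fps_nth K n + eval_fps N l / l ^ Suc n) \<longlonglongrightarrow> 0"
proof -
  have l0: "l \<noteq> 0" using l by auto
  have "(\<lambda>n. \<Sum>m\<le>n. fps_nth N m * l ^ m) \<longlonglongrightarrow> eval_fps N l"
    unfolding eval_fps_def by (intro summable_LIMSEQ' fps_abs_summable_imp N l)
  then have "(\<lambda>n. eval_fps N l - (\<Sum>m\<le>n. fps_nth N m * l ^ m)) \<longlonglongrightarrow> 0"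
    by (intro tendsto_eq_intros) auto
  then have "(\<lambda>n. norm (eval_fps N l - (\<Sum>m\<le>n. fps_nth N m * l ^ m))) \<longlonglongrightarrow> 0"
    by (rule tendsto_norm_zero)
  moreover have "norm (fps_nth K n + eval_fps N l / l ^ Suc n) =
       norm (eval_fps N l - (\<Sum>m\<le>n. fps_nth N m * l ^ m))" for n
  proof -
    have "norm (fps_nth K n + eval_fps N l / l ^ Suc n) =
          norm ((fps_nth K n + eval_fps N l / l ^ Suc n) * l ^ Suc n)"
      using l by (simp add: norm_mult norm_power)
    also have "(fps_nth K n + eval_fps N l / l ^ Suc n) * l ^ Suc n =
       fps_nth K n * l ^ Suc n + eval_fps N l"
      using l0 by (simp add: distrib_right)
    finally show ?thesis using simple_pole_coeff[OF K l0, of n] by simp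
  qed
  ultimately have "(\<lambda>n. norm (fps_nth K n + eval_fps N l / l ^ Suc n)) \<longlonglongrightarrow> 0" by simp
  then show ?thesis by (simp only: tendsto_norm_zero_iff)
qed

text \<open>Partial fractions without dividing power series: each linear factor is cancelled
  separately, and the two resulting series differ by (l - m) G.\<close>

lemma double_pole_limit:
  assumes G: "G * ((fps_X - fps_const l) * (fps_X - fps_const m)) = N"
    and l: "norm l = 1" and m: "norm m = 1" and lm: "l \<noteq> m" and N: "fps_abs_summable N"
  shows "(\<lambda>n. fps_nth G n - (eval_fps N m / m ^ Suc n - eval_fps N l / l ^ Suc n) / (l - m)) \<longlonglongrightarrow> 0"
proof -
  define K where "K = G * (fps_X - fps_const m)"
  define L where "L = G * (fps_X - fps_const l)"
  have "(\<lambda>n. fps_nth K n + eval_fps N l / l ^ Suc n) \<longlonglongrightarrow> 0"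
    using G by (intro simple_pole_limit l N) (simp add: K_def mult_ac)
  moreover have "(\<lambda>n. fps_nth L n + eval_fps N m / m ^ Suc n) \<longlonglongrightarrow> 0"
    using G by (intro simple_pole_limit m N) (simp add: L_def mult_ac)
  ultimately have "(\<lambda>n. ((fps_nth K n + eval_fps N l / l ^ Suc n) - (fps_nth L n + eval_fps N m / m ^ Suc n)) / (l - m))
     \<longlonglongrightarrow> (0 - 0) / (l - m)"
    using lm by (intro tendsto_intros) auto
  moreover have "fps_nth K n - fps_nth L n = (l - m) * fps_nth G n" for n
  proof -
    have "K - L = fps_const (l - m) * G" by (simp add: K_def L_def algebra_simps flip: fps_const_sub)
    from arg_cong[OF this, of "\<lambda>f. fps_nth f n"] show ?thesis by simp
  qed
  then have "((fps_nth K n + eval_fps N l / l ^ Suc n) - (fps_nth L n + eval_fps N m / m ^ Suc n)) / (l - m) =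
     fps_nth G n - (eval_fps N m / m ^ Suc n - eval_fps N l / l ^ Suc n) / (l - m)" for n
    using lm by (simp add: field_simps)
  ultimately show ?thesis by simp
qed

text \<open>The root of the discriminant of the quadratic for the reflection amplitude
  \<open>R\<close> in \<open>half_walk_gf\<close>, split over the four branch points cis \<gamma>,
  cis (-\<gamma>) and their negatives. The split form shows absolute summability and lets the branch
  be computed factor by factor.\<close>

definition fps_disc_root :: "real \<Rightarrow> complex fps" where
  "fps_disc_root \<gamma> = (fps_sqrt1 (cis \<gamma>) * fps_sqrt1 (cis (- \<gamma>))) *
     (fps_sqrt1 (- cis \<gamma>) * fps_sqrt1 (- cis (- \<gamma>)))"

lemma fps_disc_root_square:
  "fps_disc_root \<gamma> * fps_disc_root \<gamma> =
     (1 - fps_X\<^sup>2)\<^sup>2 + fps_const (4 * of_real ((sin \<gamma>)\<^sup>2)) * fps_X\<^sup>2"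
proof -
  define c where "c = fps_const (cis \<gamma>)"
  define d where "d = fps_const (cis (- \<gamma>))"
  have cd: "c * d = 1" by (simp add: c_def d_def cis_mult)
  have "fps_const (4 * complex_of_real ((sin \<gamma>)\<^sup>2)) = 2 - c * c - d * d"
  proof -
    have "4 * complex_of_real ((sin \<gamma>)\<^sup>2) = 2 - cis \<gamma> * cis \<gamma> - cis (- \<gamma>) * cis (- \<gamma>)"
      using sin_cos_squared_add[of \<gamma>]
      by (simp add: complex_eq_iff power2_eq_square)
    then show ?thesis
      by (simp only: c_def d_def fps_const_mult fps_const_sub numeral_fps_const)
  qed
  moreover have "fps_disc_root \<gamma> * fps_disc_root \<gamma> =
    (fps_sqrt1 (cis \<gamma>) * fps_sqrt1 (cis \<gamma>)) * (fps_sqrt1 (cis (- \<gamma>)) * fps_sqrt1 (cis (- \<gamma>))) *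
    ((fps_sqrt1 (- cis \<gamma>) * fps_sqrt1 (- cis \<gamma>)) * (fps_sqrt1 (- cis (- \<gamma>)) * fps_sqrt1 (- cis (- \<gamma>))))"
    by (simp only: fps_disc_root_def mult_ac)
  then have "fps_disc_root \<gamma> * fps_disc_root \<gamma> =
    (1 - c * fps_X) * (1 - d * fps_X) * ((1 + c * fps_X) * (1 + d * fps_X))"
    unfolding fps_sqrt1_square c_def d_def by (simp flip: fps_const_neg)
  moreover have "(1 - c * fps_X) * (1 - d * fps_X) * ((1 + c * fps_X) * (1 + d * fps_X)) =
    (1 - fps_X\<^sup>2)\<^sup>2 + (2 - c * c - d * d) * fps_X\<^sup>2"
    using cd by algebra
  ultimately show ?thesis by simp
qed

lemma fps_abs_summable_disc_root: "fps_abs_summable (fps_disc_root \<gamma>)"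
  unfolding fps_disc_root_def by (intro fps_abs_summable_mult fps_abs_summable_sqrt1) auto

text \<open>Only the argument of each factor is kept; the modulus of the product is recovered later
  from its square.\<close>

lemma eval_fps_sqrt1_cis_arg:
  assumes "\<exists>r>0. eval_fps (fps_sqrt1 1) (cis \<phi>) = of_real r * cis x \<Longrightarrow> P"
    and "0 < \<phi>" "\<phi> < 2 * pi" "x = (\<phi> - pi) / 4"
  shows P
proof (rule assms(1))
  have "sin (\<phi> / 2) > 0" using assms by (intro sin_gt_zero) auto
  then show "\<exists>r>0. eval_fps (fps_sqrt1 1) (cis \<phi>) = of_real r * cis x"
    unfolding eval_fps_sqrt1_cis[OF assms(2,3)] unfolding assms(4)
    by (intro exI[of _ "sqrt (2 * sin (\<phi> / 2))"]) simp
qed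

text \<open>The sign is the point, since the square alone leaves it open. The arguments of the four
  factors add up to \<omega>, so the value is a positive multiple of cis \<omega>, and the square
  then determines the multiple.\<close>

lemma eval_fps_disc_root:
  assumes \<gamma>: "0 < \<gamma>" "\<gamma> \<le> pi / 2" and \<omega>: "\<bar>\<omega>\<bar> < \<gamma>"
  shows "eval_fps (fps_disc_root \<gamma>) (cis \<omega>) =
    of_real (2 * sqrt ((sin \<gamma>)\<^sup>2 - (sin \<omega>)\<^sup>2)) * cis \<omega>"
proof -
  define l where "l = cis \<omega>"
  have ev: "eval_fps (fps_disc_root \<gamma>) l =
    (eval_fps (fps_sqrt1 1) (cis \<gamma> * l) * eval_fps (fps_sqrt1 1) (cis (- \<gamma>) * l)) *
    (eval_fps (fps_sqrt1 1) (- cis \<gamma> * l) * eval_fps (fps_sqrt1 1) (- cis (- \<gamma>) * l))"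
    unfolding fps_disc_root_def
    by (simp add: eval_fps_mult_abs fps_abs_summable_mult fps_abs_summable_sqrt1 l_def)
       (simp add: eval_fps_sqrt1)
  obtain r1 where r1: "r1 > 0" "eval_fps (fps_sqrt1 1) (cis \<gamma> * l) = of_real r1 * cis ((\<gamma> + \<omega> - pi) / 4)"
    by (rule eval_fps_sqrt1_cis_arg[of "\<gamma> + \<omega>"]) (use \<gamma> \<omega> in \<open>auto simp: l_def cis_mult\<close>)
  \<comment> \<open>\<omega> - \<gamma> lies in (-pi, 0); adding 2 pi brings it into the range (0, 2
    pi) of the argument formula.\<close>
  obtain r2 where r2: "r2 > 0" "eval_fps (fps_sqrt1 1) (cis (- \<gamma>) * l) = of_real r2 * cis ((\<omega> - \<gamma> + pi) / 4)"
  proof (rule eval_fps_sqrt1_cis_arg[of "\<omega> - \<gamma> + 2 * pi"])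
    have "cis (\<omega> - \<gamma> + 2 * pi) = cis (- \<gamma>) * l"
      by (simp add: l_def cis_mult complex_eq_iff)
    then show "\<exists>r>0. eval_fps (fps_sqrt1 1) (cis (\<omega> - \<gamma> + 2 * pi)) = of_real r * cis ((\<omega> - \<gamma> + pi) / 4) \<Longrightarrow> thesis"
      using that by auto
  qed (use \<gamma> \<omega> in auto)
  obtain r3 where r3: "r3 > 0" "eval_fps (fps_sqrt1 1) (- cis \<gamma> * l) = of_real r3 * cis ((\<gamma> + \<omega>) / 4)"
  proof (rule eval_fps_sqrt1_cis_arg[of "\<gamma> + \<omega> + pi"])
    have "cis (\<gamma> + \<omega> + pi) = - cis \<gamma> * l"
      by (simp add: l_def cis_mult complex_eq_iff)
    then show "\<exists>r>0. eval_fps (fps_sqrt1 1) (cis (\<gamma> + \<omega> + pi)) = of_real r * cis ((\<gamma> + \<omega>) / 4) \<Longrightarrow> thesis"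
      using that by auto
  qed (use \<gamma> \<omega> in auto)
  obtain r4 where r4: "r4 > 0" "eval_fps (fps_sqrt1 1) (- cis (- \<gamma>) * l) = of_real r4 * cis ((\<omega> - \<gamma>) / 4)"
  proof (rule eval_fps_sqrt1_cis_arg[of "\<omega> - \<gamma> + pi"])
    have "cis (\<omega> - \<gamma> + pi) = - cis (- \<gamma>) * l"
      by (simp add: l_def cis_mult complex_eq_iff)
    then show "\<exists>r>0. eval_fps (fps_sqrt1 1) (cis (\<omega> - \<gamma> + pi)) = of_real r * cis ((\<omega> - \<gamma>) / 4) \<Longrightarrow> thesis"
      using that by auto
  qed (use \<gamma> \<omega> in auto)
  define r where "r = r1 * r2 * r3 * r4"
  have r: "r > 0" using r1 r2 r3 r4 by (simp add: r_def)
  have S: "eval_fps (fps_disc_root \<gamma>) l = of_real r * l"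
  proof -
    have "eval_fps (fps_disc_root \<gamma>) l = of_real r *
      (cis ((\<gamma> + \<omega> - pi) / 4) * cis ((\<omega> - \<gamma> + pi) / 4) * (cis ((\<gamma> + \<omega>) / 4) * cis ((\<omega> - \<gamma>) / 4)))"
      unfolding ev r1 r2 r3 r4 r_def by (simp add: mult_ac)
    also have "cis ((\<gamma> + \<omega> - pi) / 4) * cis ((\<omega> - \<gamma> + pi) / 4) * (cis ((\<gamma> + \<omega>) / 4) * cis ((\<omega> - \<gamma>) / 4)) = l"
      unfolding cis_mult l_def by (rule arg_cong[of _ _ cis]) (simp add: field_simps)
    finally show ?thesis .
  qed
  have nl: "norm l = 1" by (simp add: l_def)
  have "eval_fps (fps_disc_root \<gamma> * fps_disc_root \<gamma>) l = (of_real r * l)\<^sup>2"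
    using eval_fps_mult_abs[OF fps_abs_summable_disc_root fps_abs_summable_disc_root nl] S
    by (simp add: power2_eq_square)
  moreover have "eval_fps (fps_disc_root \<gamma> * fps_disc_root \<gamma>) l =
     (1 - l\<^sup>2)\<^sup>2 + 4 * of_real ((sin \<gamma>)\<^sup>2) * l\<^sup>2"
  proof -
    have "fps_disc_root \<gamma> * fps_disc_root \<gamma> =
      (fps_const 1 + fps_const (-1) * (fps_X * fps_X)) * (fps_const 1 + fps_const (-1) * (fps_X * fps_X)) +
      fps_const (4 * of_real ((sin \<gamma>)\<^sup>2)) * (fps_X * fps_X)"
      unfolding fps_disc_root_square by (simp add: power2_eq_square flip: fps_const_neg)
    then show ?thesis
      using nl by (simp only: eval_fps_add_abs eval_fps_mult_abs fps_abs_summable_add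
         fps_abs_summable_const fps_abs_summable_X fps_abs_summable_mult eval_fps_const eval_fps_X)
        (simp add: power2_eq_square)
  qed
  ultimately have "(of_real r * l)\<^sup>2 = (1 - l\<^sup>2)\<^sup>2 + 4 * of_real ((sin \<gamma>)\<^sup>2) * l\<^sup>2" by simp
  \<comment> \<open>From |l| = 1: 1 - l^2 = l (cnj l - l). Its square contributes - 4 sin^2 \<omega>
    times l^2.\<close>
  moreover have "1 - l\<^sup>2 = - 2 * \<i> * of_real (sin \<omega>) * l"
  proof -
    have "l * (cnj l - l) = 1 - l\<^sup>2" using nl complex_norm_square[of l] by (simp add: right_diff_distrib power2_eq_square)
    moreover have "cnj l - l = - 2 * \<i> * of_real (sin \<omega>)" by (simp add: l_def complex_eq_iff)
    ultimately show ?thesis by (metis mult.commute)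
  qed
  ultimately have "of_real (r\<^sup>2) * l\<^sup>2 = of_real (4 * ((sin \<gamma>)\<^sup>2 - (sin \<omega>)\<^sup>2)) * l\<^sup>2"
    by (simp add: power_mult_distrib algebra_simps)
  moreover have "l\<^sup>2 \<noteq> 0" using nl by auto
  ultimately have "complex_of_real (r\<^sup>2) = of_real (4 * ((sin \<gamma>)\<^sup>2 - (sin \<omega>)\<^sup>2))" by simp
  then have "r\<^sup>2 = 4 * ((sin \<gamma>)\<^sup>2 - (sin \<omega>)\<^sup>2)" by (simp only: of_real_eq_iff)
  then have "r = sqrt (4 * ((sin \<gamma>)\<^sup>2 - (sin \<omega>)\<^sup>2))" using r by (simp add: real_sqrt_unique)
  then have "r = 2 * sqrt ((sin \<gamma>)\<^sup>2 - (sin \<omega>)\<^sup>2)" by (simp only: real_sqrt_mult real_sqrt_four)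
  with S show ?thesis by (simp add: l_def)
qed

text \<open>Negation exchanges each factor with the one for the opposite branch point. This reaches
  the pole on the opposite arc.\<close>

lemma eval_fps_disc_root_uminus:
  assumes "norm w = 1"
  shows "eval_fps (fps_disc_root \<gamma>) (- w) = eval_fps (fps_disc_root \<gamma>) w"
proof -
  have "eval_fps (fps_disc_root \<gamma>) z =
    (eval_fps (fps_sqrt1 1) (cis \<gamma> * z) * eval_fps (fps_sqrt1 1) (cis (- \<gamma>) * z)) *
    (eval_fps (fps_sqrt1 1) (- cis \<gamma> * z) * eval_fps (fps_sqrt1 1) (- cis (- \<gamma>) * z))"
    if "norm z = 1" for z
    using that unfolding fps_disc_root_def
    by (simp add: eval_fps_mult_abs fps_abs_summable_mult fps_abs_summable_sqrt1)
       (simp add: eval_fps_sqrt1)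
  from this[of w] this[of "- w"] assms show ?thesis by (simp add: mult_ac)
qed

section \<open>The reflecting walk on the half line\<close>

text \<open>The components of \<open>half_walk a b n x\<close> are the amplitudes of the arcs of direction \<open>D0\<close> and
  \<open>D1\<close> at distance \<open>x\<close> from the boundary, at time \<open>2 n\<close>.\<close>

primrec half_walk :: "complex \<Rightarrow> complex \<Rightarrow> nat \<Rightarrow> nat \<Rightarrow> complex \<times> complex" where
  "half_walk a b 0 = (\<lambda>x. (0, if x = 0 then 1 else 0))"
| "half_walk a b (Suc n) = (\<lambda>x.
     (cnj b * fst (half_walk a b n (x + 1)) - cnj a * snd (half_walk a b n (x + 1)),
      if x = 0 then cnj b * fst (half_walk a b n 0) - cnj a * snd (half_walk a b n 0)
      else a * fst (half_walk a b n (x - 1)) + b * snd (half_walk a b n (x - 1))))"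

text \<open>This is a X (1 - R'), where R' is the second root of the quadratic for the reflection
  amplitude \<open>R\<close> in \<open>half_walk_gf\<close>. Multiplying numerator and denominator
  of 1 / (1 - R) by it turns the denominator into the quadratic evaluated at 1, a polynomial in
  X.\<close>

definition half_walk_num :: "complex \<Rightarrow> real \<Rightarrow> complex fps" where
  "half_walk_num a \<gamma> = fps_const a * fps_X - fps_const (1/2) * (1 - fps_X\<^sup>2) -
     fps_const (1/2) * fps_disc_root \<gamma>"

text \<open>\<open>R\<close> generates the amplitudes of a first return to the boundary; by homogeneity it is also the
  reflection amplitude of every shifted half line, which yields its quadratic equation.\<close>

lemma half_walk_gf:
  assumes ab: "(norm a)\<^sup>2 + (norm b)\<^sup>2 = 1" and a0: "a \<noteq> 0" and \<gamma>: "sin \<gamma> = norm a"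
  defines "G \<equiv> Abs_fps (\<lambda>n. snd (half_walk a b n 0))"
  shows "G * (fps_X\<^sup>2 - 1 + fps_X * fps_const (a - cnj a)) = half_walk_num a \<gamma>"
proof -
  define S where "S = fps_disc_root \<gamma>"
  define A where "A = fps_const a"
  define A' where "A' = fps_const (cnj a)"
  define B where "B = fps_const b"
  define B' where "B' = fps_const (cnj b)"
  have AB: "A * A' + B * B' = 1"
  proof -
    have "a * cnj a + b * cnj b = of_real ((norm a)\<^sup>2 + (norm b)\<^sup>2)"
      by (simp only: of_real_add complex_norm_square)
    then show ?thesis using ab by (simp add: A_def A'_def B_def B'_def)
  qed
  have S2: "S * S = (1 - fps_X\<^sup>2)\<^sup>2 + 4 * A * A' * fps_X\<^sup>2"
  proof -
    have "fps_const (4 * complex_of_real ((sin \<gamma>)\<^sup>2)) = 4 * A * A'"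
      unfolding \<gamma> complex_norm_square by (simp add: A_def A'_def numeral_fps_const mult.assoc)
    then show ?thesis by (simp only: S_def fps_disc_root_square)
  qed
  have S0: "fps_nth S 0 = 1"
    by (simp add: S_def fps_disc_root_def fps_sqrt1_def)
  have S1: "fps_nth S 1 = 0"
  proof -
    have "fps_nth (S * S) 1 = 0"
      unfolding S2 by (simp add: A_def A'_def numeral_fps_const power2_eq_square fps_mult_nth)
    then show ?thesis using S0 by (simp add: fps_mult_nth)
  qed
  \<comment> \<open>The root of the quadratic that is a power series. The shift divides by X, which
    is exact since \<open>S\<close> has constant term 1; the vanishing linear term of
    \<open>S\<close> makes the constant term of \<open>R\<close> vanish, so that 1 - R is
    invertible.\<close>
  define R where "R = fps_const (1 / (2 * a)) * fps_shift 1 (1 - fps_X\<^sup>2 - S)"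
  have R: "2 * A * (fps_X * R) = 1 - fps_X\<^sup>2 - S"
  proof -
    have "fps_X * fps_shift 1 (1 - fps_X\<^sup>2 - S) = 1 - fps_X\<^sup>2 - S"
      by (rule fps_ext) (use S0 in \<open>auto simp: power2_eq_square\<close>)
    moreover have "2 * A * (fps_X * R) = (2 * A * fps_const (1 / (2 * a))) * (fps_X * fps_shift 1 (1 - fps_X\<^sup>2 - S))"
      by (simp add: R_def mult_ac)
    moreover have "2 * A * fps_const (1 / (2 * a)) = 1"
      using a0 by (simp add: A_def numeral_fps_const)
    ultimately show ?thesis by simp
  qed
  have R0: "fps_nth R 0 = 0"
    using S1 by (simp add: R_def power2_eq_square)
  \<comment> \<open>Completing the square: after multiplication by 4 A X the equation becomes the
    formula for \<open>S * S\<close>.\<close>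
  have RQ: "fps_X * A * R * R - (1 - fps_X\<^sup>2) * R = A' * fps_X"
  proof -
    have "4 * A * fps_X * (fps_X * A * R * R - (1 - fps_X\<^sup>2) * R) = 4 * A * fps_X * (A' * fps_X)"
      using R S2 by algebra
    moreover have "4 * A * fps_X \<noteq> 0"
      using a0 by (auto simp: A_def numeral_fps_const)
    ultimately show ?thesis by simp
  qed
  \<comment> \<open>\<open>T\<close> transfers the outgoing amplitude from one site to the next: a
    passage with coefficient b, followed by any number of reflections between the half line beyond
    (\<open>R\<close>) and the site (\<open>A\<close>), which form a geometric series.\<close>
  define T where "T = fps_X * B * inverse (1 - A * fps_X * R)"
  have T: "T * (1 - A * fps_X * R) = fps_X * B"
    by (simp add: T_def mult.assoc inverse_mult_eq_1)
  define H where "H = inverse (1 - R)"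
  have H: "H * (1 - R) = 1"
    using R0 by (simp add: H_def inverse_mult_eq_1)
  have nz: "1 - A * fps_X * R \<noteq> 0"
  proof
    assume "1 - A * fps_X * R = 0"
    then have "fps_nth (1 - A * fps_X * R) 0 = 0" by simp
    then show False by simp
  qed
  have RT: "R = fps_X * (B' * R * T) - fps_X * A'"
  proof -
    have "R * (1 - A * fps_X * R) = (fps_X * (B' * R * T) - fps_X * A') * (1 - A * fps_X * R)"
      using RQ T AB by algebra
    then show ?thesis using nz by simp
  qed
  \<comment> \<open>Ansatz: the outgoing part gains a factor \<open>T\<close> per site, and the
    incoming \<open>U x\<close> is \<open>R\<close> times the outgoing \<open>V (Suc x)\<close>.
    Recursion and initial value determine the walk, so it suffices to verify them for
    \<open>U\<close> and \<open>V\<close>.\<close>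
  define U where "U x = R * H * T ^ Suc x" for x
  define V where "V x = H * T ^ x" for x
  have U: "U x = fps_X * (B' * U (Suc x) - A' * V (Suc x))" for x
  proof -
    have "fps_X * (B' * U (Suc x) - A' * V (Suc x)) = (fps_X * (B' * R * T) - fps_X * A') * (H * T ^ Suc x)"
      by (simp add: U_def V_def algebra_simps)
    also have "\<dots> = U x" using RT by (simp add: U_def mult_ac)
    finally show ?thesis ..
  qed
  have V: "V (Suc x) = fps_X * (A * U x + B * V x)" for x
  proof -
    have "T = fps_X * (A * R * T + B)" using T by (simp add: algebra_simps)
    then have "V (Suc x) = H * T ^ x * (fps_X * (A * R * T + B))" by (simp add: V_def mult_ac)
    then show ?thesis by (simp add: U_def V_def algebra_simps)
  qed
  have V0: "V 0 = 1 + fps_X * (B' * U 0 - A' * V 0)"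
  proof -
    have "fps_X * (B' * U 0 - A' * V 0) = (fps_X * (B' * R * T) - fps_X * A') * H"
      by (simp add: U_def V_def algebra_simps)
    also have "\<dots> = R * H" using RT by simp
    finally show ?thesis using H by (simp add: V_def algebra_simps)
  qed
  have "half_walk a b n = (\<lambda>x. (fps_nth (U x) n, fps_nth (V x) n))" for n
  proof (induction n)
    case 0
    have "fps_nth (U x) 0 = 0" for x by (subst U) simp
    moreover have "fps_nth (V x) 0 = (if x = 0 then 1 else 0)" for x
    proof (cases x)
      case 0 then show ?thesis by (subst 0, subst V0) simp
    next
      case (Suc y) then show ?thesis by (subst Suc, subst V) simp
    qed
    ultimately show ?case by simp
  next
    case (Suc n)
    have "fps_nth (U x) (Suc n) = cnj b * fps_nth (U (Suc x)) n - cnj a * fps_nth (V (Suc x)) n" for x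
      by (subst U) (simp add: B'_def A'_def)
    moreover have "fps_nth (V x) (Suc n) = (if x = 0 then cnj b * fps_nth (U 0) n - cnj a * fps_nth (V 0) n
       else a * fps_nth (U (x - 1)) n + b * fps_nth (V (x - 1)) n)" for x
    proof (cases x)
      case 0 then show ?thesis by (subst 0, subst V0) (simp add: B'_def A'_def)
    next
      case (Suc y) then show ?thesis by (subst Suc, subst V) (simp add: A_def B_def)
    qed
    ultimately show ?case by (simp add: Suc cong: if_cong)
  qed
  then have G: "G = H" by (simp add: G_def V_def fps_eq_iff)
  have N: "half_walk_num a \<gamma> = A * fps_X - A * fps_X * R - (1 - fps_X\<^sup>2) + A * fps_X * (2 * R)"
  proof -
    have half: "2 * fps_const (1/2) = (1 :: complex fps)" by (simp add: numeral_fps_const)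
    have "2 * half_walk_num a \<gamma> = 2 * (A * fps_X) - (2 * fps_const (1/2)) * (1 - fps_X\<^sup>2) - (2 * fps_const (1/2)) * S"
      by (simp add: half_walk_num_def A_def S_def algebra_simps)
    also have "\<dots> = 2 * (A * fps_X - A * fps_X * R - (1 - fps_X\<^sup>2) + A * fps_X * (2 * R))"
      unfolding half using R by algebra
    finally show ?thesis
      by (simp only: mult_cancel_left) (auto simp: numeral_fps_const)
  qed
  have "fps_X\<^sup>2 - 1 + fps_X * fps_const (a - cnj a) = fps_X\<^sup>2 - 1 + fps_X * (A - A')"
    by (simp add: A_def A'_def)
  \<comment> \<open>Both sides are the quadratic for \<open>R\<close> evaluated at 1: on the left
    because H (1 - R) = 1, on the right as the product of its two root factors.\<close>
  moreover have "(1 - R) * (H * (fps_X\<^sup>2 - 1 + fps_X * (A - A'))) = (1 - R) * half_walk_num a \<gamma>"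
    using N H RQ by algebra
  moreover have "1 - R \<noteq> 0" using H by auto
  ultimately show ?thesis using G by simp
qed

text \<open>The poles are l = cis \<omega> and m = - cis (-\<omega>) with sin \<omega> = - Im a.
  Because Re a \<noteq> 0 they lie strictly between branch points, where the numerator takes the
  values (Re a - |Re a|) l and (Re a + |Re a|) m. One of them is 0, and the sign of Re a selects the
  surviving oscillation.\<close>

lemma half_walk_asymptotics:
  assumes ab: "(norm a)\<^sup>2 + (norm b)\<^sup>2 = 1" and a: "Re a \<noteq> 0"
  defines "w \<equiv> Complex (sqrt (1 - (Im a)\<^sup>2)) (- Im a)"
  shows "(\<lambda>n. snd (half_walk a b n 0) - of_real (\<bar>Re a\<bar> / sqrt (1 - (Im a)\<^sup>2)) *
     (if Re a < 0 then cnj w else - w) ^ n) \<longlonglongrightarrow> 0"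
proof -
  have na: "(norm a)\<^sup>2 = (Re a)\<^sup>2 + (Im a)\<^sup>2" by (simp add: cmod_power2)
  have na1: "(norm a)\<^sup>2 \<le> 1" using ab zero_le_power2[of "norm b"] by linarith
  then have na1: "norm a \<le> 1" by (simp add: abs_square_le_1)
  have a0: "a \<noteq> 0" using a by auto
  have "(Re a)\<^sup>2 > 0" using a by simp
  then have "(Im a)\<^sup>2 < (norm a)\<^sup>2" using na by simp
  then have Im_a: "\<bar>Im a\<bar> < norm a" using power2_less_imp_less[of "\<bar>Im a\<bar>" "norm a"] by simp
  define \<gamma> where "\<gamma> = arcsin (norm a)"
  define \<omega> where "\<omega> = arcsin (- Im a)"
  have sg: "sin \<gamma> = norm a" unfolding \<gamma>_def using na1 by (intro sin_arcsin) (auto intro: order_trans[of _ 0])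
  have so: "sin \<omega> = - Im a" unfolding \<omega>_def using Im_a na1 by (intro sin_arcsin) auto
  have co: "cos \<omega> = sqrt (1 - (Im a)\<^sup>2)" unfolding \<omega>_def using Im_a na1 by (subst cos_arcsin) auto
  have "\<omega> < \<gamma>" unfolding \<omega>_def \<gamma>_def using Im_a na1 by (intro arcsin_less_mono[THEN iffD2]) auto
  moreover have "arcsin (- norm a) < \<omega>" unfolding \<omega>_def using Im_a na1 by (intro arcsin_less_mono[THEN iffD2]) auto
  then have "- \<gamma> < \<omega>" using na1 arcsin_minus[of "norm a"] by (simp add: \<gamma>_def order_trans[of _ 0])
  ultimately have og: "\<bar>\<omega>\<bar> < \<gamma>" by simp
  have g: "0 < \<gamma>" "\<gamma> \<le> pi / 2" using og arcsin_bounded[OF _ na1] norm_ge_zero[of a] by (auto simp: \<gamma>_def)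
  have cpos: "cos \<omega> > 0" using og g by (intro cos_gt_zero_pi) auto
  define l where "l = cis \<omega>"
  define m where "m = - cis (- \<omega>)"
  have w: "w = l" by (simp add: w_def l_def complex_eq_iff so co)
  have nl: "norm l = 1" and nm: "norm m = 1" by (auto simp: l_def m_def)
  have lm: "l - m = of_real (2 * cos \<omega>)" by (simp add: l_def m_def complex_eq_iff)
  then have "l \<noteq> m" using cpos by auto
  have prod: "(fps_X - fps_const l) * (fps_X - fps_const m) = fps_X\<^sup>2 - 1 + fps_X * fps_const (a - cnj a)"
  proof -
    have "l * m = -1" by (simp add: l_def m_def cis_mult)
    moreover have "l + m = - (a - cnj a)"
      by (simp add: l_def m_def complex_eq_iff so)
    moreover have "(fps_X - fps_const l) * (fps_X - fps_const m) = fps_X\<^sup>2 - fps_X * fps_const (l + m) + fps_const (l * m)"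
      by (simp add: algebra_simps power2_eq_square flip: fps_const_add)
    ultimately show ?thesis by (simp flip: fps_const_neg)
  qed
  define N where "N = half_walk_num a \<gamma>"
  have Neq: "N = fps_const a * fps_X + (fps_const (-1/2) + fps_const (1/2) * (fps_X * fps_X)) +
      fps_const (-1/2) * fps_disc_root \<gamma>"
  proof -
    have "fps_const (-1/2) = - fps_const (1/2 :: complex)" by simp
    then show ?thesis unfolding N_def half_walk_num_def
      by (simp only: right_diff_distrib power2_eq_square mult_1_right) (simp only: mult_minus_left diff_conv_add_uminus minus_add_distrib minus_minus add_ac)
  qed
  have sN: "fps_abs_summable N" unfolding Neq
    by (intro fps_abs_summable_add fps_abs_summable_const fps_abs_summable_X fps_abs_summable_mult
        fps_abs_summable_disc_root)
  have eN: "eval_fps N z = a * z - (1 - z\<^sup>2) / 2 - eval_fps (fps_disc_root \<gamma>) z / 2" if "norm z = 1" for z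
    unfolding Neq using that
    by (simp only: eval_fps_add_abs eval_fps_mult_abs fps_abs_summable_add fps_abs_summable_disc_root
         fps_abs_summable_const fps_abs_summable_X fps_abs_summable_mult eval_fps_const eval_fps_X)
       (simp add: power2_eq_square field_simps)
  define \<tau> where "\<tau> = \<bar>Re a\<bar>"
  have \<tau>: "sqrt ((sin \<gamma>)\<^sup>2 - (sin \<omega>)\<^sup>2) = \<tau>" by (simp add: sg so na \<tau>_def)
  have Sl: "eval_fps (fps_disc_root \<gamma>) l = 2 * of_real \<tau> * l"
    using eval_fps_disc_root[OF g og] by (simp add: \<tau> l_def)
  \<comment> \<open>The root is even on the circle, so its value at \<open>m\<close> is the one at -
    m = cis (-\<omega>), which lies on the arc covered by \<open>eval_fps_disc_root\<close>.\<close>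
  have Sm: "eval_fps (fps_disc_root \<gamma>) m = - 2 * of_real \<tau> * m"
    using eval_fps_disc_root[OF g, of "- \<omega>"] og
    by (simp add: \<tau> m_def eval_fps_disc_root_uminus)
  have aim: "a - \<i> * of_real (Im a) = of_real (Re a)" by (simp add: complex_eq_iff)
  have q: "(1 - z\<^sup>2) / 2 = \<i> * of_real (Im a) * z" if "norm z = 1" "Im z = - Im a" for z
  proof -
    have "z * (cnj z - z) = 1 - z\<^sup>2"
      using that complex_norm_square[of z] by (simp add: right_diff_distrib power2_eq_square)
    moreover have "cnj z - z = 2 * \<i> * of_real (Im a)" using that by (simp add: complex_eq_iff)
    ultimately show ?thesis by (simp add: field_simps)
  qed
  have Iml: "Im l = - Im a" and Imm: "Im m = - Im a" by (simp_all add: l_def m_def so)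
  have Nl: "eval_fps N l = of_real (Re a - \<tau>) * l"
    unfolding eN[OF nl] Sl q[OF nl Iml] of_real_diff aim[symmetric] by (simp add: algebra_simps)
  have Nm: "eval_fps N m = of_real (Re a + \<tau>) * m"
    unfolding eN[OF nm] Sm q[OF nm Imm] of_real_add aim[symmetric] by (simp add: algebra_simps)
  have l0: "l \<noteq> 0" and m0: "m \<noteq> 0" using nl nm by auto
  have li: "inverse l = cnj w" by (simp add: w l_def cis_inverse cis_cnj)
  have mi: "inverse m = - w" by (simp add: w l_def m_def)
  have lim: "(\<lambda>n. fps_nth (Abs_fps (\<lambda>n. snd (half_walk a b n 0))) n -
     (eval_fps N m / m ^ Suc n - eval_fps N l / l ^ Suc n) / (l - m)) \<longlonglongrightarrow> 0"
    by (rule double_pole_limit[OF _ nl nm \<open>l \<noteq> m\<close> sN])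
       (simp only: prod half_walk_gf[OF ab a0 sg] N_def)
  have "(eval_fps N m / m ^ Suc n - eval_fps N l / l ^ Suc n) / (l - m) =
     of_real (\<bar>Re a\<bar> / sqrt (1 - (Im a)\<^sup>2)) * (if Re a < 0 then cnj w else - w) ^ n" for n
  proof -
    have "eval_fps N m / m ^ Suc n = of_real (Re a + \<tau>) * (- w) ^ n"
      unfolding Nm mi[symmetric] using m0 by (simp add: field_simps)
    moreover have "eval_fps N l / l ^ Suc n = of_real (Re a - \<tau>) * (cnj w) ^ n"
      unfolding Nl li[symmetric] using l0 by (simp add: field_simps)
    ultimately show ?thesis unfolding lm co[symmetric] using cpos
      by (auto simp: \<tau>_def)
  qed
  with lim show ?thesis by simp
qed

text \<open>Each step is a unitary at every site followed by a move by one site, so the mass of the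
  first M sites comes from the first M + 1 sites one step earlier. Initial segments keep all sums
  finite.\<close>

lemma half_walk_norm:
  assumes ab: "(norm a)\<^sup>2 + (norm b)\<^sup>2 = 1"
  shows "(\<Sum>x<M. (norm (fst (half_walk a b n x)))\<^sup>2 + (norm (snd (half_walk a b n x)))\<^sup>2) \<le> 1"
proof (induction n arbitrary: M)
  case 0
  have "(\<Sum>x<M. (norm (fst (half_walk a b 0 x)))\<^sup>2 + (norm (snd (half_walk a b 0 x)))\<^sup>2) =
    (\<Sum>x<M. if x = 0 then 1 else (0::real))"
    by (intro sum.cong) auto
  then show ?case by simp
next
  case (Suc n)
  define u where "u = (\<lambda>x. fst (half_walk a b n x))"
  define v where "v = (\<lambda>x. snd (half_walk a b n x))"
  define p where "p x = cnj b * u x - cnj a * v x" for x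
  define q where "q x = a * u x + b * v x" for x
  have rot: "(norm (p x))\<^sup>2 + (norm (q x))\<^sup>2 = (norm (u x))\<^sup>2 + (norm (v x))\<^sup>2" for x
  proof -
    have 1: "cnj a * a + cnj b * b = 1"
      using ab by (metis complex_norm_square mult.commute of_real_1 of_real_add)
    have "p x * cnj (p x) + q x * cnj (q x) = u x * cnj (u x) + v x * cnj (v x)"
      unfolding p_def q_def complex_cnj_add complex_cnj_diff complex_cnj_mult complex_cnj_cnj
      using 1 by algebra
    then have "complex_of_real ((norm (p x))\<^sup>2 + (norm (q x))\<^sup>2) = of_real ((norm (u x))\<^sup>2 + (norm (v x))\<^sup>2)"
      by (simp only: of_real_add complex_norm_square)
    then show ?thesis by (simp only: of_real_eq_iff)
  qed
  have eq: "half_walk a b (Suc n) x = (p (Suc x), if x = 0 then p 0 else q (x - 1))" for x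
    by (simp add: p_def q_def u_def v_def)
  have "(\<Sum>x<M. (norm (fst (half_walk a b (Suc n) x)))\<^sup>2 + (norm (snd (half_walk a b (Suc n) x)))\<^sup>2) =
    (\<Sum>x<M. (norm (p (Suc x)))\<^sup>2) + (\<Sum>x<M. (norm (if x = 0 then p 0 else q (x - 1)))\<^sup>2)"
    unfolding eq by (simp add: sum.distrib)
  also have "\<dots> \<le> (\<Sum>x<Suc M. (norm (p x))\<^sup>2 + (norm (q x))\<^sup>2)"
  proof (cases M)
    case (Suc K)
    have "(\<Sum>x<Suc K. (norm (if x = 0 then p 0 else q (x - 1)))\<^sup>2) = (norm (p 0))\<^sup>2 + (\<Sum>x<K. (norm (q x))\<^sup>2)"
      by (subst sum.lessThan_Suc_shift) simp
    moreover have "(\<Sum>x<Suc (Suc K). (norm (p x))\<^sup>2) = (norm (p 0))\<^sup>2 + (\<Sum>x<Suc K. (norm (p (Suc x)))\<^sup>2)"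
      by (subst sum.lessThan_Suc_shift) simp
    moreover have "(\<Sum>x<K. (norm (q x))\<^sup>2) \<le> (\<Sum>x<Suc (Suc K). (norm (q x))\<^sup>2)"
      by (intro sum_mono2) auto
    ultimately show ?thesis using Suc by (simp only: sum.distrib)
  qed (simp add: sum_nonneg)
  also have "\<dots> = (\<Sum>x<Suc M. (norm (u x))\<^sup>2 + (norm (v x))\<^sup>2)" by (simp only: rot)
  also have "\<dots> \<le> 1" unfolding u_def v_def by (rule Suc.IH)
  finally show ?case .
qed

lemma half_walk_norm_le:
  assumes "(norm a)\<^sup>2 + (norm b)\<^sup>2 = 1"
  shows "norm (snd (half_walk a b n 0)) \<le> 1"
proof (rule power2_le_imp_le)
  have "(norm (fst (half_walk a b n 0)))\<^sup>2 + (norm (snd (half_walk a b n 0)))\<^sup>2 \<le> 1"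
    using half_walk_norm[OF assms, where M = 1 and n = n] by simp
  then show "(norm (snd (half_walk a b n 0)))\<^sup>2 \<le> 1\<^sup>2"
    using zero_le_power2[of "norm (fst (half_walk a b n 0))"] unfolding one_power2 by linarith
qed simp

section \<open>The Fourier transform of the walk\<close>

abbreviation walk :: "real \<Rightarrow> real \<Rightarrow> nat \<Rightarrow> arc \<Rightarrow> complex" where
  "walk \<alpha> \<beta> n \<equiv> (evolution \<alpha> \<beta> ^^ (2 * n)) (kdelta (self_loop 0))"

lemma walk_0: "walk \<alpha> \<beta> 0 ((x, j), D0) = 0"
  "walk \<alpha> \<beta> 0 ((x, j), D1) = (if x = 0 \<and> j = 0 then 1 else 0)"
  by (auto simp: kdelta_def self_loop_def)

text \<open>One step exchanges the direction pairs \<open>D0\<close>, \<open>D1\<close> and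
  \<open>D2\<close>, \<open>D3\<close>; two steps therefore give a closed recursion for the first
  pair.\<close>

lemma walk_Suc:
  fixes \<alpha> \<beta> :: real and n :: nat
  defines "u \<equiv> \<lambda>x j. walk \<alpha> \<beta> n ((x, j), D0)" and "v \<equiv> \<lambda>x j. walk \<alpha> \<beta> n ((x, j), D1)"
  shows "walk \<alpha> \<beta> (Suc n) ((x, j), D0) =
      of_real (cos \<alpha>) * (of_real (cos \<beta>) * u (x + 1) (j + 1) - of_real (sin \<beta>) * v (x + 1) (j + 1)) -
      of_real (sin \<alpha>) * (of_real (sin \<beta>) * u (x + 1) (j - 1) + of_real (cos \<beta>) * v (x + 1) (j - 1))"
    and "walk \<alpha> \<beta> (Suc n) ((x, j), D1) =
     (if x = 0 then
      of_real (cos \<alpha>) * (of_real (cos \<beta>) * u 0 (j + 1) - of_real (sin \<beta>) * v 0 (j + 1)) -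
      of_real (sin \<alpha>) * (of_real (sin \<beta>) * u 0 (j - 1) + of_real (cos \<beta>) * v 0 (j - 1))
     else
      of_real (sin \<alpha>) * (of_real (cos \<beta>) * u (x - 1) (j + 1) - of_real (sin \<beta>) * v (x - 1) (j + 1)) +
      of_real (cos \<alpha>) * (of_real (sin \<beta>) * u (x - 1) (j - 1) + of_real (cos \<beta>) * v (x - 1) (j - 1)))"
  unfolding u_def v_def by (auto simp: evolution_def shift_def self_loop_def)

lemma walk_support:
  "int n < \<bar>j\<bar> \<Longrightarrow> walk \<alpha> \<beta> n ((x, j), D0) = 0 \<and> walk \<alpha> \<beta> n ((x, j), D1) = 0"
proof (induction n arbitrary: x j)
  case 0
  then show ?case by (simp only: walk_0) auto
next
  case (Suc n)
  then have "int n < \<bar>j + 1\<bar>" "int n < \<bar>j - 1\<bar>" by auto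
  from Suc.IH[OF this(1)] Suc.IH[OF this(2)] show ?case by (simp only: walk_Suc) simp
qed

text \<open>At a fixed time the amplitudes have bounded support, so a large finite window already
  gives the full Fourier series.\<close>

definition fourier_sum :: "nat \<Rightarrow> (int \<Rightarrow> complex) \<Rightarrow> real \<Rightarrow> complex" where
  "fourier_sum M f k = (\<Sum>j\<in>{- int M..int M}. f j * cis (k * of_int j))"

lemma fourier_sum_linear:
  "fourier_sum M (\<lambda>j. f j + g j) k = fourier_sum M f k + fourier_sum M g k"
  "fourier_sum M (\<lambda>j. f j - g j) k = fourier_sum M f k - fourier_sum M g k"
  "fourier_sum M (\<lambda>j. c * f j) k = c * fourier_sum M f k"
  by (simp_all add: fourier_sum_def sum.distrib sum_subtractf sum_distrib_left algebra_simps)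

text \<open>The window is strictly wider than the support, so a shift by one site pushes nothing out
  of it.\<close>

lemma fourier_sum_shift:
  assumes supp: "\<And>j. int n < \<bar>j\<bar> \<Longrightarrow> f j = 0" and d: "\<bar>d\<bar> \<le> 1" and M: "n < M"
  shows "fourier_sum M (\<lambda>j. f (j + d)) k = cis (- k * of_int d) * fourier_sum M f k"
proof -
  have "fourier_sum M (\<lambda>j. f (j + d)) k =
      (\<Sum>j\<in>{- int M + d..int M + d}. f j * cis (k * of_int (j - d)))"
    unfolding fourier_sum_def
    by (rule sum.reindex_bij_witness[where i = "\<lambda>j. j - d" and j = "\<lambda>j. j + d"]) auto
  also have "\<dots> = (\<Sum>j\<in>{- int n..int n}. f j * cis (k * of_int (j - d)))"
    using d M by (intro sum.mono_neutral_right) (auto intro!: supp)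
  also have "\<dots> = (\<Sum>j\<in>{- int n..int n}. cis (- k * of_int d) * (f j * cis (k * of_int j)))"
    by (intro sum.cong refl) (simp add: cis_mult algebra_simps)
  also have "\<dots> = (\<Sum>j\<in>{- int M..int M}. cis (- k * of_int d) * (f j * cis (k * of_int j)))"
    using M by (intro sum.mono_neutral_left) (auto simp: supp)
  finally show ?thesis by (simp add: fourier_sum_def sum_distrib_left)
qed

locale boundary_walk =
  fixes \<alpha> \<beta> s r :: real
  assumes s: "s = sin (\<alpha> + \<beta>)" and r: "r = sin (\<alpha> - \<beta>)" and s0: "s \<noteq> 0"
begin

text \<open>The symbol sin \<alpha> cos \<beta> cis (-k) + cos \<alpha> sin \<beta> cis k in real
  and imaginary part. The real part carries the sign that selects the edge state.\<close>

definition coin_a :: "real \<Rightarrow> complex" where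
  "coin_a k = Complex (s * cos k) (- r * sin k)"

definition coin_b :: "real \<Rightarrow> complex" where
  "coin_b k = Complex (cos (\<alpha> + \<beta>) * cos k) (cos (\<alpha> - \<beta>) * sin k)"

lemma coin_ab: "(norm (coin_a k))\<^sup>2 + (norm (coin_b k))\<^sup>2 = 1"
proof -
  have "s\<^sup>2 + (cos (\<alpha> + \<beta>))\<^sup>2 = 1" "r\<^sup>2 + (cos (\<alpha> - \<beta>))\<^sup>2 = 1" "(sin k)\<^sup>2 + (cos k)\<^sup>2 = 1"
    unfolding s r by (simp_all only: sin_cos_squared_add)
  then show ?thesis unfolding coin_a_def coin_b_def cmod_power2 complex.sel by algebra
qed

lemma fourier_walk:
  assumes "n \<le> M"
  shows "half_walk (coin_a k) (coin_b k) n x =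
    (fourier_sum M (\<lambda>j. walk \<alpha> \<beta> n ((x, j), D0)) k, fourier_sum M (\<lambda>j. walk \<alpha> \<beta> n ((x, j), D1)) k)"
  using assms
proof (induction n arbitrary: x M)
  case 0
  have "fourier_sum M (\<lambda>j. if x = 0 \<and> j = 0 then 1 else 0) k = (if x = 0 then 1 else 0)"
  proof -
    have "fourier_sum M (\<lambda>j. if x = 0 \<and> j = 0 then 1 else 0) k =
       (\<Sum>j\<in>{- int M..int M}. if j = 0 then (if x = 0 then 1 else 0) else 0)"
      unfolding fourier_sum_def by (intro sum.cong) auto
    then show ?thesis by simp
  qed
  then show ?case unfolding walk_0 by (simp add: fourier_sum_def)
next
  case (Suc n)
  define u where "u x j = walk \<alpha> \<beta> n ((x, j), D0)" for x j
  define v where "v x j = walk \<alpha> \<beta> n ((x, j), D1)" for x j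
  define \<u> where "\<u> x = fourier_sum M (u x) k" for x
  define \<v> where "\<v> x = fourier_sum M (v x) k" for x
  have IH: "half_walk (coin_a k) (coin_b k) n x = (\<u> x, \<v> x)" for x
    unfolding \<u>_def \<v>_def u_def v_def using Suc by auto
  have sh: "fourier_sum M (\<lambda>j. u x (j + 1)) k = cis (- k) * \<u> x"
    "fourier_sum M (\<lambda>j. u x (j - 1)) k = cis k * \<u> x"
    "fourier_sum M (\<lambda>j. v x (j + 1)) k = cis (- k) * \<v> x"
    "fourier_sum M (\<lambda>j. v x (j - 1)) k = cis k * \<v> x" for x
    unfolding \<u>_def \<v>_def
    using fourier_sum_shift[where n = n and f = "u x" and d = 1 and M = M and k = k]
      fourier_sum_shift[where n = n and f = "u x" and d = "-1" and M = M and k = k]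
      fourier_sum_shift[where n = n and f = "v x" and d = 1 and M = M and k = k]
      fourier_sum_shift[where n = n and f = "v x" and d = "-1" and M = M and k = k]
      walk_support[of n _ \<alpha> \<beta> x] Suc.prems
    by (auto simp: u_def v_def)
  have a: "coin_a k = of_real (sin \<alpha> * cos \<beta>) * cis (- k) + of_real (cos \<alpha> * sin \<beta>) * cis k"
    unfolding coin_a_def unfolding s r by (simp add: complex_eq_iff sin_add sin_diff algebra_simps)
  have b: "coin_b k = of_real (- sin \<alpha> * sin \<beta>) * cis (- k) + of_real (cos \<alpha> * cos \<beta>) * cis k"
    unfolding coin_b_def by (simp add: complex_eq_iff cos_add cos_diff algebra_simps)
  have a': "cnj (coin_a k) = of_real (sin \<alpha> * cos \<beta>) * cis k + of_real (cos \<alpha> * sin \<beta>) * cis (- k)"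
    unfolding a by (simp add: cis_cnj)
  have b': "cnj (coin_b k) = of_real (- sin \<alpha> * sin \<beta>) * cis k + of_real (cos \<alpha> * cos \<beta>) * cis (- k)"
    unfolding b by (simp add: cis_cnj)
  have D0: "fourier_sum M (\<lambda>j. walk \<alpha> \<beta> (Suc n) ((x, j), D0)) k =
    cnj (coin_b k) * \<u> (x + 1) - cnj (coin_a k) * \<v> (x + 1)" for x
    unfolding walk_Suc u_def[symmetric] v_def[symmetric] fourier_sum_linear sh a' b'
    by (simp add: algebra_simps)
  have D1: "fourier_sum M (\<lambda>j. walk \<alpha> \<beta> (Suc n) ((x, j), D1)) k =
    (if x = 0 then cnj (coin_b k) * \<u> 0 - cnj (coin_a k) * \<v> 0
     else coin_a k * \<u> (x - 1) + coin_b k * \<v> (x - 1))"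
  proof (cases "x = 0")
    case True
    then show ?thesis
      unfolding walk_Suc u_def[symmetric] v_def[symmetric] if_P[OF True] fourier_sum_linear sh a' b'
      by (simp add: algebra_simps)
  next
    case False
    then show ?thesis
      unfolding walk_Suc u_def[symmetric] v_def[symmetric] if_not_P[OF False] fourier_sum_linear sh a b
      by (simp add: algebra_simps)
  qed
  show ?case by (simp only: half_walk.simps IH fst_conv snd_conv D0 D1)
qed

end

section \<open>Fourier coefficients\<close>

text \<open>A measure on the whole line, so that integrands and their translates in k need no
  restriction to a period.\<close>

definition circle_measure :: "real measure" where
  "circle_measure = density lborel (\<lambda>k. ennreal (indicator {0..2 * pi} k / (2 * pi)))"

lemma sets_circle_measure [measurable_cong, simp]: "sets circle_measure = sets borel"
  by (simp add: circle_measure_def)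

lemma space_circle_measure [simp]: "space circle_measure = UNIV"
  by (simp add: circle_measure_def)

lemma finite_measure_circle_measure: "finite_measure circle_measure"
proof
  have "emeasure circle_measure (space circle_measure) =
     (\<integral>\<^sup>+k. ennreal (1 / (2 * pi)) * indicator {0..2 * pi} k \<partial>lborel)"
    unfolding circle_measure_def
    by (simp add: emeasure_density) (auto intro!: nn_integral_cong split: split_indicator)
  also have "\<dots> < \<infinity>" by (simp add: nn_integral_cmult_indicator ennreal_mult_less_top)
  finally show "emeasure circle_measure (space circle_measure) \<noteq> \<infinity>" by simp
qed

lemma AE_circle_measure: "(AE k in lborel. Q k) \<Longrightarrow> AE k in circle_measure. Q k"
  unfolding circle_measure_def by (subst AE_density) auto

lemma integral_circle_measure:
  fixes f :: "real \<Rightarrow> 'a :: {banach, second_countable_topology}"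
  assumes [measurable]: "f \<in> borel_measurable borel"
  shows "integral\<^sup>L circle_measure f = (1 / (2 * pi)) *\<^sub>R (LINT k:{0..2 * pi}|lborel. f k)"
proof -
  have "integral\<^sup>L circle_measure f = (LINT k|lborel. (indicator {0..2 * pi} k / (2 * pi)) *\<^sub>R f k)"
    unfolding circle_measure_def by (subst integral_density) auto
  also have "\<dots> = (LINT k|lborel. (1 / (2 * pi)) *\<^sub>R (indicator {0..2 * pi} k *\<^sub>R f k))"
    by (intro Bochner_Integration.integral_cong refl) (auto split: split_indicator)
  finally show ?thesis by (simp only: set_lebesgue_integral_def integral_scaleR_right)
qed

lemma integrable_circle_measure:
  fixes f :: "real \<Rightarrow> 'a :: {banach, second_countable_topology}"
  assumes "f \<in> borel_measurable borel" "\<And>k. norm (f k) \<le> B"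
  shows "integrable circle_measure f"
  using assms by (intro finite_measure.integrable_const_bound[OF finite_measure_circle_measure]) auto

lemma circle_bounded_convergence:
  fixes f :: "nat \<Rightarrow> real \<Rightarrow> 'a :: {banach, second_countable_topology}"
  assumes [measurable]: "\<And>n. f n \<in> borel_measurable borel" "g \<in> borel_measurable borel"
    and "AE k in lborel. (\<lambda>n. f n k) \<longlonglongrightarrow> g k" and "\<And>n k. norm (f n k) \<le> B"
  shows "(\<lambda>n. integral\<^sup>L circle_measure (f n)) \<longlonglongrightarrow> integral\<^sup>L circle_measure g"
proof (rule integral_dominated_convergence[where w = "\<lambda>_. B"])
  show "integrable circle_measure (\<lambda>_. B)"
    by (rule integrable_circle_measure[where B = "\<bar>B\<bar>"]) auto
qed (use assms AE_circle_measure in auto)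

text \<open>Level sets of cos are countable. The value 0 gives the momenta excluded from the
  asymptotics; other values arise from level sets of the velocity.\<close>

lemma AE_cos_neq: "AE k in lborel. cos k \<noteq> (c :: real)"
proof -
  have "{k. cos k = c} \<in> null_sets lborel"
  proof (rule countable_imp_null_set_lborel, cases "\<exists>x. cos x = c")
    case True
    then obtain x where x: "c = cos x" by auto
    have "{k. cos k = c} \<subseteq> (\<lambda>n. x + 2 * n * pi) ` \<int> \<union> (\<lambda>n. - x + 2 * n * pi) ` \<int>"
      unfolding x by (auto simp: cos_eq)
    moreover have "countable ((\<lambda>n. x + 2 * n * pi) ` \<int> \<union> (\<lambda>n. - x + 2 * n * pi) ` \<int>)"
      by (auto simp: Ints_def)
    ultimately show "countable {k. cos k = c}" by (rule countable_subset)
  qed auto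
  from AE_not_in[OF this] show ?thesis by simp
qed

lemma integral_circle_cis:
  "integral\<^sup>L circle_measure (\<lambda>k. cis (k * of_int m)) = (if m = 0 then 1 else 0)"
proof -
  have cont: "continuous_on {0..2 * pi} (\<lambda>k. cis (k * of_int m))"
    by (intro continuous_intros)
  have "((\<lambda>k. cis (k * of_int m)) has_integral (if m = 0 then 2 * pi else 0)) {0..2 * pi}"
  proof (cases "m = 0")
    case True
    have "((\<lambda>k. 1 :: complex) has_integral (2 * pi) *\<^sub>R 1) {0..2 * pi}"
      using has_integral_const_real[of "1::complex" 0 "2 * pi"] by simp
    then show ?thesis using True by (simp add: scaleR_conv_of_real)
  next
    case False
    define F where "F k = cis (k * of_int m) / (\<i> * of_int m)" for k
    have "((\<lambda>k. cis (k * of_int m)) has_integral (F (2 * pi) - F 0)) {0..2 * pi}"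
    proof (rule fundamental_theorem_of_calculus)
      fix k show "(F has_vector_derivative cis (k * of_int m)) (at k within {0..2 * pi})"
        unfolding F_def cis_conv_exp using False
        by (auto intro!: derivative_eq_intros has_vector_derivative_real_field simp: field_simps)
    qed simp
    moreover have "F (2 * pi) = F 0"
      using cis_multiple_2pi[of "of_int m"] by (simp add: F_def)
    ultimately show ?thesis using False by simp
  qed
  moreover have "(LINT k:{0..2 * pi}|lborel. cis (k * of_int m)) = integral {0..2 * pi} (\<lambda>k. cis (k * of_int m))"
    using cont by (intro set_borel_integral_eq_integral borel_integrable_atLeastAtMost')
  moreover have "(\<lambda>k. cis (k * of_int m)) \<in> borel_measurable borel"
    by (intro borel_measurable_continuous_onI continuous_intros)
  ultimately show ?thesis
    by (subst integral_circle_measure) (auto simp: integral_unique scaleR_conv_of_real)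
qed

lemma continuous_fourier_sum [continuous_intros]: "continuous_on A (fourier_sum M f)"
  unfolding fourier_sum_def by (intro continuous_intros)

lemma borel_measurable_fourier_sum [measurable]: "fourier_sum M f \<in> borel_measurable borel"
  by (intro borel_measurable_continuous_onI continuous_intros)

lemma borel_measurable_cis' [measurable]:
  "f \<in> borel_measurable M \<Longrightarrow> (\<lambda>x. cis (f x)) \<in> borel_measurable M"
  by (rule measurable_compose[of f M borel cis])
     (auto intro!: borel_measurable_continuous_onI continuous_intros)

lemma borel_measurable_cnj' [measurable]:
  "f \<in> borel_measurable M \<Longrightarrow> (\<lambda>x. cnj (f x)) \<in> borel_measurable M"
  by (rule measurable_compose[of f M borel cnj])
     (auto intro!: borel_measurable_continuous_onI continuous_intros)

lemma fourier_sum_coeff: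
  assumes "\<bar>j\<bar> > int M \<Longrightarrow> f j = 0"
  shows "integral\<^sup>L circle_measure (\<lambda>k. fourier_sum M f k * cis (- k * of_int j)) = f j"
proof -
  have "integral\<^sup>L circle_measure (\<lambda>k. fourier_sum M f k * cis (- k * of_int j)) =
    integral\<^sup>L circle_measure (\<lambda>k. \<Sum>i\<in>{- int M..int M}. f i * cis (k * of_int (i - j)))"
    unfolding fourier_sum_def sum_distrib_right
    by (intro Bochner_Integration.integral_cong sum.cong refl)
       (simp add: mult.assoc cis_mult right_diff_distrib)
  also have "\<dots> = (\<Sum>i\<in>{- int M..int M}. integral\<^sup>L circle_measure (\<lambda>k. f i * cis (k * of_int (i - j))))"
    by (intro Bochner_Integration.integral_sum integrable_circle_measure[where B = "cmod (f _)"])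
       (auto simp: norm_mult)
  also have "\<dots> = (\<Sum>i\<in>{- int M..int M}. if i = j then f i else 0)"
    by (intro sum.cong refl) (use integral_circle_cis in \<open>auto simp del: of_int_diff\<close>)
  also have "\<dots> = f j" using assms by (auto simp: abs_le_iff)
  finally show ?thesis .
qed

text \<open>Parseval's identity for a function and its translate. For h = \<xi> / n the right side
  is the characteristic function of j / n under the masses |f j|^2.\<close>

lemma fourier_sum_char:
  assumes p: "\<And>k. norm (fourier_sum M f k) \<le> B"
  shows "integral\<^sup>L circle_measure (\<lambda>k. cnj (fourier_sum M f k) * fourier_sum M f (k + h)) =
     (\<Sum>j\<in>{- int M..int M}. of_real ((norm (f j))\<^sup>2) * cis (h * of_int j))"
proof -
  define P where "P = fourier_sum M f"
  have [measurable]: "P \<in> borel_measurable borel" by (simp add: P_def)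
  have "cnj (P k) * P (k + h) = (\<Sum>j\<in>{- int M..int M}. (f j * cis (h * of_int j)) * cnj (P k * cis (- k * of_int j)))" for k
  proof -
    have "cis ((k + h) * of_int j) = cis (k * of_int j) * cis (h * of_int j)" for j :: int
      by (simp add: cis_mult distrib_right)
    then have Pkh: "P (k + h) = (\<Sum>j\<in>{- int M..int M}. f j * (cis (k * of_int j) * cis (h * of_int j)))"
      by (simp add: P_def fourier_sum_def)
    show ?thesis
      unfolding Pkh sum_distrib_left
      by (intro sum.cong refl) (simp only: complex_cnj_mult cis_cnj mult_minus_left minus_minus mult_ac)
  qed
  then have "integral\<^sup>L circle_measure (\<lambda>k. cnj (P k) * P (k + h)) =
    integral\<^sup>L circle_measure (\<lambda>k. \<Sum>j\<in>{- int M..int M}. (f j * cis (h * of_int j)) *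
       cnj (P k * cis (- k * of_int j)))"
    by (simp only:)
  also have "\<dots> = (\<Sum>j\<in>{- int M..int M}. integral\<^sup>L circle_measure (\<lambda>k. (f j * cis (h * of_int j)) *
       cnj (P k * cis (- k * of_int j))))"
  proof (rule Bochner_Integration.integral_sum)
    fix j
    show "integrable circle_measure (\<lambda>k. (f j * cis (h * of_int j)) * cnj (P k * cis (- k * of_int j)))"
    proof (rule integrable_circle_measure)
      show "norm ((f j * cis (h * of_int j)) * cnj (P k * cis (- k * of_int j))) \<le> cmod (f j) * B" for k
        using mult_left_mono[OF p[of k], of "cmod (f j)"] by (simp add: norm_mult P_def)
    qed measurable
  qed
  also have "\<dots> = (\<Sum>j\<in>{- int M..int M}. (f j * cis (h * of_int j)) * cnj (f j))"
  proof (rule sum.cong[OF refl])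
    fix j assume "j \<in> {- int M..int M}"
    then have "integral\<^sup>L circle_measure (\<lambda>k. P k * cis (- k * of_int j)) = f j"
      unfolding P_def by (intro fourier_sum_coeff) auto
    then show "integral\<^sup>L circle_measure (\<lambda>k. (f j * cis (h * of_int j)) * cnj (P k * cis (- k * of_int j)))
       = (f j * cis (h * of_int j)) * cnj (f j)"
      by (simp only: integral_mult_right_zero Bochner_Integration.integral_cnj)
  qed
  also have "\<dots> = (\<Sum>j\<in>{- int M..int M}. of_real ((norm (f j))\<^sup>2) * cis (h * of_int j))"
    unfolding complex_norm_square by (simp add: mult_ac)
  finally show ?thesis by (simp add: P_def)
qed

section \<open>The edge state and its approximation in the mean\<close>

context boundary_walk
begin

definition amp :: "nat \<Rightarrow> int \<Rightarrow> complex" where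
  "amp n j = walk \<alpha> \<beta> n (self_loop j)"

definition phat :: "nat \<Rightarrow> real \<Rightarrow> complex" where
  "phat n = fourier_sum n (amp n)"

definition edge_weight :: "real \<Rightarrow> real" where
  "edge_weight k = \<bar>s * cos k\<bar> / sqrt (1 - (r * sin k)\<^sup>2)"

text \<open>The surviving oscillation of \<open>half_walk_asymptotics\<close> for
  \<open>coin_a k\<close>: \<open>cnj w\<close> if the real part s cos k is negative,
  \<open>- w\<close> otherwise.\<close>

definition edge_phase :: "real \<Rightarrow> complex" where
  "edge_phase k = (if s * cos k < 0 then of_real (sqrt (1 - (r * sin k)\<^sup>2)) - \<i> * of_real (r * sin k)
     else - of_real (sqrt (1 - (r * sin k)\<^sup>2)) - \<i> * of_real (r * sin k))"

text \<open>The derivative in k of the argument of \<open>edge_phase\<close>, which is sgn (s cos k)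
  arcsin (r sin k) up to a constant; the two signs of cos k combine into |cos k|.\<close>

definition edge_velocity :: "real \<Rightarrow> real" where
  "edge_velocity k = sgn s * r * \<bar>cos k\<bar> / sqrt (1 - (r * sin k)\<^sup>2)"

definition edge_part :: "nat \<Rightarrow> real \<Rightarrow> complex" where
  "edge_part n k = of_real (edge_weight k) * edge_phase k ^ n"

lemma boundary_prob_amp: "boundary_prob \<alpha> \<beta> n j = (cmod (amp n j))\<^sup>2"
  by (simp add: boundary_prob_def amp_def)

lemma amp_support: "int n < \<bar>j\<bar> \<Longrightarrow> amp n j = 0"
  using walk_support[of n j \<alpha> \<beta> 0] by (simp add: amp_def self_loop_def)

lemma phat_half_walk: "phat n k = snd (half_walk (coin_a k) (coin_b k) n 0)"
  using fourier_walk[of n n k 0] by (simp add: phat_def amp_def[abs_def] self_loop_def)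

lemma phat_le_1: "norm (phat n k) \<le> 1"
  unfolding phat_half_walk by (rule half_walk_norm_le[OF coin_ab])

lemma rs_le_1: "\<bar>r\<bar> \<le> 1" "\<bar>s\<bar> \<le> 1"
  by (auto simp: r s)

lemma r_sin_le: "(r * sin k)\<^sup>2 \<le> (sin k)\<^sup>2" "(r * sin k)\<^sup>2 \<le> 1"
proof -
  have "r\<^sup>2 \<le> 1" using rs_le_1 by (simp add: abs_square_le_1)
  then show 1: "(r * sin k)\<^sup>2 \<le> (sin k)\<^sup>2"
    by (simp add: power_mult_distrib mult_left_le_one_le)
  also have "(sin k)\<^sup>2 \<le> 1" by (simp add: abs_square_le_1)
  finally show "(r * sin k)\<^sup>2 \<le> 1" .
qed

lemma abs_cos_le: "\<bar>cos k\<bar> \<le> sqrt (1 - (r * sin k)\<^sup>2)"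
  by (rule real_le_rsqrt) (use r_sin_le(1)[of k] in \<open>simp add: cos_squared_eq\<close>)

lemma r_sin_less: "cos k \<noteq> 0 \<Longrightarrow> (r * sin k)\<^sup>2 < 1"
proof -
  assume "cos k \<noteq> 0"
  then have "sqrt (1 - (r * sin k)\<^sup>2) > 0" using abs_cos_le[of k] by linarith
  then show ?thesis by simp
qed

lemma edge_weight_bound: "0 \<le> edge_weight k" "edge_weight k \<le> 1"
proof -
  show "0 \<le> edge_weight k" using r_sin_le(2)[of k] by (simp add: edge_weight_def)
  have "\<bar>s * cos k\<bar> \<le> 1 * sqrt (1 - (r * sin k)\<^sup>2)"
    unfolding abs_mult using rs_le_1 abs_cos_le by (intro mult_mono) auto
  then show "edge_weight k \<le> 1"
    unfolding edge_weight_def using r_sin_le(2)[of k] by (intro divide_le_eq_1[THEN iffD2]) auto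
qed

lemma edge_velocity_bound: "\<bar>edge_velocity k\<bar> \<le> 1"
proof -
  have "\<bar>sgn s * r * \<bar>cos k\<bar>\<bar> \<le> 1 * sqrt (1 - (r * sin k)\<^sup>2)"
    unfolding abs_mult using rs_le_1 abs_cos_le s0 by (intro mult_mono) (auto simp: abs_sgn_eq)
  then show ?thesis
    unfolding edge_velocity_def abs_divide using r_sin_le(2)[of k]
    by (intro divide_le_eq_1[THEN iffD2]) auto
qed

lemma norm_edge_phase: "norm (edge_phase k) = 1"
proof -
  have "(norm (edge_phase k))\<^sup>2 = 1" using r_sin_le(2)[of k]
    by (simp add: edge_phase_def cmod_power2)
  from real_sqrt_unique[OF this] show ?thesis by simp
qed

lemma norm_edge_part: "norm (edge_part n k) \<le> 1"
  using edge_weight_bound[of k] by (simp add: edge_part_def norm_mult norm_power norm_edge_phase)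

lemma edge_measurable [measurable]:
  "edge_weight \<in> borel_measurable borel" "edge_velocity \<in> borel_measurable borel"
  "edge_phase \<in> borel_measurable borel" "edge_part n \<in> borel_measurable borel"
  "phat n \<in> borel_measurable borel"
proof -
  show 1: "edge_weight \<in> borel_measurable borel" unfolding edge_weight_def[abs_def] by measurable
  show "edge_velocity \<in> borel_measurable borel" unfolding edge_velocity_def[abs_def] by measurable
  show 2: "edge_phase \<in> borel_measurable borel" unfolding edge_phase_def[abs_def] by measurable
  show "edge_part n \<in> borel_measurable borel" unfolding edge_part_def[abs_def] using 1 2 by measurable
  show "phat n \<in> borel_measurable borel" unfolding phat_def by measurable
qed

lemma phat_asymptotics:
  assumes "cos k \<noteq> 0"
  shows "(\<lambda>n. phat n k - edge_part n k) \<longlonglongrightarrow> 0"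
proof -
  have ne: "Re (coin_a k) \<noteq> 0" using assms s0 by (simp add: coin_a_def)
  have "edge_part n k = of_real (\<bar>Re (coin_a k)\<bar> / sqrt (1 - (Im (coin_a k))\<^sup>2)) *
     (if Re (coin_a k) < 0 then cnj (Complex (sqrt (1 - (Im (coin_a k))\<^sup>2)) (- Im (coin_a k)))
      else - Complex (sqrt (1 - (Im (coin_a k))\<^sup>2)) (- Im (coin_a k))) ^ n" for n
    unfolding edge_part_def edge_weight_def
    by (intro arg_cong2[where f = "(*)"] arg_cong2[where f = power] refl)
       (simp_all add: coin_a_def edge_phase_def complex_eq_iff)
  then show ?thesis using half_walk_asymptotics[OF coin_ab ne] by (simp add: phat_half_walk)
qed

lemma phat_L1:
  "(\<lambda>n. LINT k:{c..d}|lborel. norm (phat n k - edge_part n k)) \<longlonglongrightarrow> 0"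
proof -
  have "(\<lambda>n. LINT k:{c..d}|lborel. norm (phat n k - edge_part n k)) \<longlonglongrightarrow> (LINT k:{c..d}|lborel. 0)"
    unfolding set_lebesgue_integral_def
  proof (rule integral_dominated_convergence[where w = "\<lambda>k. 2 * indicator {c..d} k"])
    show "AE k in lborel. (\<lambda>n. indicator {c..d} k *\<^sub>R norm (phat n k - edge_part n k)) \<longlonglongrightarrow> indicator {c..d} k *\<^sub>R 0"
      using AE_cos_neq[of 0]
      by eventually_elim (intro tendsto_intros tendsto_norm_zero phat_asymptotics)
    show "AE k in lborel. norm (indicator {c..d} k *\<^sub>R norm (phat n k - edge_part n k)) \<le> 2 * indicator {c..d} k" for n
    proof (rule AE_I2)
      fix k
      have "norm (phat n k - edge_part n k) \<le> 2"
        using norm_triangle_ineq4[of "phat n k" "edge_part n k"] phat_le_1[of n k] norm_edge_part[of n k] by simp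
      then show "norm (indicator {c..d} k *\<^sub>R norm (phat n k - edge_part n k)) \<le> 2 * indicator {c..d} k"
        by (auto split: split_indicator)
    qed
  qed (auto simp: emeasure_lborel_Icc_eq intro!: integrable_real_indicator)
  then show ?thesis by simp
qed

text \<open>All translates of the period by \<open>h n\<close> stay inside one fixed interval, on
  which \<open>phat_L1\<close> applies.\<close>

lemma phat_L1_circle:
  assumes "\<And>n. \<bar>h n\<bar> \<le> H"
  shows "(\<lambda>n. integral\<^sup>L circle_measure (\<lambda>k. norm (phat n (k + h n) - edge_part n (k + h n)))) \<longlonglongrightarrow> 0"
proof (rule tendsto_sandwich[OF _ _ tendsto_const])
  define e where "e n k = norm (phat n k - edge_part n k)" for n k
  have [measurable]: "e n \<in> borel_measurable borel" for n unfolding e_def[abs_def] by measurable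
  have e2: "e n k \<le> 2" for n k
    using norm_triangle_ineq4[of "phat n k" "edge_part n k"] phat_le_1[of n k] norm_edge_part[of n k]
    by (simp add: e_def)
  show "\<forall>\<^sub>F n in sequentially. 0 \<le> integral\<^sup>L circle_measure (\<lambda>k. norm (phat n (k + h n) - edge_part n (k + h n)))"
    by (intro always_eventually allI integral_nonneg_AE) auto
  have "integral\<^sup>L circle_measure (\<lambda>k. e n (k + h n)) \<le> (LINT k:{-H..2*pi+H}|lborel. e n k) / (2 * pi)" for n
  proof -
    have i: "integrable lborel (\<lambda>k. indicator {a..b} k *\<^sub>R e n (k + t))" for a b t
      by (rule Bochner_Integration.integrable_bound[where f = "\<lambda>k. 2 * indicator {a..b} k :: real"])
         (use e2 in \<open>auto simp: e_def emeasure_lborel_Icc_eq intro!: integrable_real_indicator split: split_indicator\<close>)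
    have "(LINT k:{0..2*pi}|lborel. e n (k + h n)) \<le> (LINT k:{-H - h n..2*pi+H-h n}|lborel. e n (k + h n))"
      unfolding set_lebesgue_integral_def
      using assms[of n] by (intro integral_mono i) (auto simp: e_def split: split_indicator)
    also have "\<dots> = (LINT k:{-H..2*pi+H}|lborel. e n k)"
      unfolding set_lebesgue_integral_def
      by (subst lborel_integral_real_affine[where c = 1 and t = "h n" and f = "\<lambda>k. indicator {-H..2*pi+H} k *\<^sub>R e n k"])
         (auto intro!: Bochner_Integration.integral_cong simp: add.commute split: split_indicator)
    finally show ?thesis
      by (subst integral_circle_measure) (auto simp: divide_simps)
  qed
  then show "\<forall>\<^sub>F n in sequentially. integral\<^sup>L circle_measure (\<lambda>k. norm (phat n (k + h n) - edge_part n (k + h n)))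
     \<le> (LINT k:{-H..2*pi+H}|lborel. norm (phat n k - edge_part n k)) / (2 * pi)"
    by (simp add: e_def)
  show "(\<lambda>n. (LINT k:{-H..2*pi+H}|lborel. norm (phat n k - edge_part n k)) / (2 * pi)) \<longlonglongrightarrow> 0"
    using phat_L1[of "-H" "2*pi+H"] by (auto intro: tendsto_eq_intros)
qed

lemma amp_coeff: "amp n j = integral\<^sup>L circle_measure (\<lambda>k. phat n k * cis (- k * of_int j))"
  unfolding phat_def by (subst fourier_sum_coeff) (simp_all add: amp_support)

text \<open>The bound is independent of j, so in \<open>amp_edge_limit\<close> the site may move
  with n, as the ballistic case requires.\<close>

lemma amp_edge_bound:
  "norm (amp n j - integral\<^sup>L circle_measure (\<lambda>k. edge_part n k * cis (- k * of_int j)))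
     \<le> integral\<^sup>L circle_measure (\<lambda>k. norm (phat n k - edge_part n k))"
proof -
  have i1: "integrable circle_measure (\<lambda>k. phat n k * cis (- k * of_int j))"
  proof (rule integrable_circle_measure)
    show "norm (phat n k * cis (- k * of_int j)) \<le> 1" for k
      by (simp only: norm_mult norm_cis mult_1_right phat_le_1)
  qed measurable
  have i2: "integrable circle_measure (\<lambda>k. edge_part n k * cis (- k * of_int j))"
  proof (rule integrable_circle_measure)
    show "norm (edge_part n k * cis (- k * of_int j)) \<le> 1" for k
      by (simp only: norm_mult norm_cis mult_1_right norm_edge_part)
  qed measurable
  have eq: "amp n j - integral\<^sup>L circle_measure (\<lambda>k. edge_part n k * cis (- k * of_int j)) =
    integral\<^sup>L circle_measure (\<lambda>k. phat n k * cis (- k * of_int j) - edge_part n k * cis (- k * of_int j))"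
    unfolding amp_coeff by (rule Bochner_Integration.integral_diff[symmetric, OF i1 i2])
  have "norm (amp n j - integral\<^sup>L circle_measure (\<lambda>k. edge_part n k * cis (- k * of_int j)))
     \<le> integral\<^sup>L circle_measure (\<lambda>k. norm (phat n k * cis (- k * of_int j) - edge_part n k * cis (- k * of_int j)))"
    unfolding eq by (rule integral_norm_bound)
  also have "\<dots> = integral\<^sup>L circle_measure (\<lambda>k. norm (phat n k - edge_part n k))"
    by (simp only: left_diff_distrib[symmetric] norm_mult norm_cis mult_1_right)
  finally show ?thesis .
qed

lemma amp_edge_limit:
  "(\<lambda>n. amp n (J n) - integral\<^sup>L circle_measure (\<lambda>k. edge_part n k * cis (- k * of_int (J n)))) \<longlonglongrightarrow> 0"
proof (rule Lim_null_comparison)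
  show "(\<lambda>n. integral\<^sup>L circle_measure (\<lambda>k. norm (phat n k - edge_part n k))) \<longlonglongrightarrow> 0"
    using phat_L1_circle[of "\<lambda>_. 0" 0] by simp
qed (intro always_eventually allI amp_edge_bound)

end

section \<open>Convergence of the characteristic functions\<close>

lemma has_real_derivative_imp_LIMSEQ:
  fixes f :: "real \<Rightarrow> real"
  assumes "(f has_real_derivative D) (at x)"
  shows "(\<lambda>n. real n * (f (x + h / real n) - f x)) \<longlonglongrightarrow> h * D"
proof (cases "h = 0")
  case False
  have "filterlim (\<lambda>n. h / real n) (at 0) sequentially"
  proof (rule filterlim_atI)
    show "(\<lambda>n. h / real n) \<longlonglongrightarrow> 0" by (rule lim_const_over_n)
    show "\<forall>\<^sub>F n in sequentially. h / real n \<noteq> 0"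
      using eventually_gt_at_top[of 0] by eventually_elim (use False in auto)
  qed
  moreover have "((\<lambda>t. (f (x + t) - f x) / t) \<longlongrightarrow> D) (at 0)"
    using assms by (simp add: DERIV_def)
  ultimately have "(\<lambda>n. (f (x + h / real n) - f x) / (h / real n)) \<longlonglongrightarrow> D"
    by (rule filterlim_compose[rotated])
  then have "(\<lambda>n. h * ((f (x + h / real n) - f x) / (h / real n))) \<longlonglongrightarrow> h * D"
    by (intro tendsto_intros)
  moreover have "\<forall>\<^sub>F n in sequentially. h * ((f (x + h / real n) - f x) / (h / real n)) = real n * (f (x + h / real n) - f x)"
    using eventually_gt_at_top[of 0] by eventually_elim (use False in \<open>simp add: field_simps\<close>)
  ultimately show ?thesis by (rule Lim_transform_eventually)
qed simp

context boundary_walk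
begin

text \<open>The limit law as a functional: momentum k carries the mass \<open>edge_weight k\<close>
  squared and travels with \<open>edge_velocity k\<close>.\<close>

definition edge_mean :: "(real \<Rightarrow> real) \<Rightarrow> real" where
  "edge_mean f = integral\<^sup>L circle_measure (\<lambda>k. (edge_weight k)\<^sup>2 * f (edge_velocity k))"

definition walk_mean :: "nat \<Rightarrow> (real \<Rightarrow> real) \<Rightarrow> real" where
  "walk_mean n f = (\<Sum>j\<in>{- int n..int n}. (cmod (amp n j))\<^sup>2 * f (of_int j / real n))"

lemma edge_phase_cis:
  assumes "s * cos k \<noteq> 0"
  shows "edge_phase k = - of_real (sgn (s * cos k)) * cis (sgn (s * cos k) * arcsin (r * sin k))"
proof -
  have "\<bar>r * sin k\<bar> \<le> 1" using r_sin_le(2)[of k] by (simp add: abs_square_le_1)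
  then show ?thesis using assms
    by (cases "s * cos k < 0") (auto simp: edge_phase_def complex_eq_iff cos_arcsin sgn_if)
qed

text \<open>The n-th powers combine to cis of n times the increment of the argument over \<xi> / n,
  which tends to \<xi> times the group velocity.\<close>

lemma edge_part_shift_limit:
  assumes c: "cos k \<noteq> 0"
  shows "(\<lambda>n. cnj (edge_part n k) * edge_part n (k + \<xi> / real n)) \<longlonglongrightarrow>
    of_real ((edge_weight k)\<^sup>2) * cis (\<xi> * edge_velocity k)"
proof -
  define \<omega> where "\<omega> k = arcsin (r * sin k)" for k
  define \<tau> where "\<tau> = sgn (s * cos k)"
  have h: "(\<lambda>n. k + \<xi> / real n) \<longlonglongrightarrow> k"
    using lim_const_over_n[of \<xi>] by (auto intro: tendsto_eq_intros)
  have sc: "s * cos k \<noteq> 0" using c s0 by simp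
  have lt: "(r * sin k)\<^sup>2 < 1" using r_sin_less[OF c] .
  then have lt': "- 1 < r * sin k" "r * sin k < 1" by (auto simp: abs_square_less_1 abs_less_iff)
  have "(\<omega> has_real_derivative (r * cos k / sqrt (1 - (r * sin k)\<^sup>2))) (at k)"
    unfolding \<omega>_def[abs_def]
    by (rule derivative_eq_intros lt' refl | simp)+ (simp add: field_simps)
  note dl = has_real_derivative_imp_LIMSEQ[OF this, of \<xi>]
  have "(\<lambda>n. cis (\<tau> * (real n * (\<omega> (k + \<xi> / real n) - \<omega> k)))) \<longlonglongrightarrow>
     cis (\<tau> * (\<xi> * (r * cos k / sqrt (1 - (r * sin k)\<^sup>2))))"
    by (intro tendsto_cis tendsto_mult[OF tendsto_const dl])
  moreover have "\<tau> * (\<xi> * (r * cos k / sqrt (1 - (r * sin k)\<^sup>2))) = \<xi> * edge_velocity k"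
    by (auto simp: \<tau>_def edge_velocity_def sgn_mult abs_sgn[of "cos k"])
  moreover have "(\<lambda>n. edge_weight (k + \<xi> / real n)) \<longlonglongrightarrow> edge_weight k"
    unfolding edge_weight_def using lt by (intro tendsto_intros h) auto
  ultimately have "(\<lambda>n. of_real (edge_weight k) * (of_real (edge_weight (k + \<xi> / real n)) *
      cis (\<tau> * (real n * (\<omega> (k + \<xi> / real n) - \<omega> k))))) \<longlonglongrightarrow>
     of_real (edge_weight k) * (of_real (edge_weight k) * cis (\<xi> * edge_velocity k))"
    by (intro tendsto_mult tendsto_const tendsto_of_real) auto
  moreover have "\<forall>\<^sub>F n in sequentially. of_real (edge_weight k) * (of_real (edge_weight (k + \<xi> / real n)) *
      cis (\<tau> * (real n * (\<omega> (k + \<xi> / real n) - \<omega> k)))) = cnj (edge_part n k) * edge_part n (k + \<xi> / real n)"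
  proof -
    \<comment> \<open>Eventually k and its translate give s cos the same sign, so both phases belong
      to the same branch and their sign factors cancel.\<close>
    have "(\<lambda>n. (s * cos (k + \<xi> / real n)) * (s * cos k)) \<longlonglongrightarrow> (s * cos k) * (s * cos k)"
      by (intro tendsto_intros h)
    moreover have "(s * cos k) * (s * cos k) > 0" using sc by (metis not_real_square_gt_zero)
    ultimately have "\<forall>\<^sub>F n in sequentially. (s * cos (k + \<xi> / real n)) * (s * cos k) > 0"
      by (rule order_tendstoD)
    then show ?thesis
    proof eventually_elim
      case (elim n)
      define k' where "k' = k + \<xi> / real n"
      have sc': "s * cos k' \<noteq> 0" and sg: "sgn (s * cos k') = \<tau>"
        using elim sc by (auto simp: k'_def \<tau>_def zero_less_mult_iff)
      have e: "\<tau> * \<tau> = 1" using sc by (auto simp: \<tau>_def sgn_if)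
      have "cnj (edge_phase k ^ n) * edge_phase k' ^ n =
        (of_real (\<tau> * \<tau>) * (cis (- (\<tau> * \<omega> k)) * cis (\<tau> * \<omega> k'))) ^ n"
        unfolding edge_phase_cis[OF sc] edge_phase_cis[OF sc'] sg \<tau>_def[symmetric] \<omega>_def
        by (simp add: cis_cnj flip: power_mult_distrib) (simp add: mult_ac)
      also have "\<dots> = cis (\<tau> * (real n * (\<omega> k' - \<omega> k)))"
        unfolding e cis_mult by (simp add: Complex.DeMoivre) (simp add: algebra_simps)
      finally show ?case
        unfolding edge_part_def k'_def[symmetric] complex_cnj_mult complex_cnj_complex_of_real
        by (simp only: mult_ac)
    qed
  qed
  ultimately have "(\<lambda>n. cnj (edge_part n k) * edge_part n (k + \<xi> / real n)) \<longlonglongrightarrow>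
     of_real (edge_weight k) * (of_real (edge_weight k) * cis (\<xi> * edge_velocity k))"
    by (rule Lim_transform_eventually)
  then show ?thesis by (simp add: power2_eq_square mult.assoc)
qed

text \<open>By \<open>fourier_sum_char\<close> the sum is the integral of a product of two factors
  bounded by 1. Replacing them one after the other by edge parts costs only the two mean errors; the
  new integrand converges almost everywhere.\<close>

lemma char_limit:
  "(\<lambda>n. \<Sum>j\<in>{- int n..int n}. of_real ((cmod (amp n j))\<^sup>2) * cis (\<xi> * (of_int j / real n))) \<longlonglongrightarrow>
     integral\<^sup>L circle_measure (\<lambda>k. of_real ((edge_weight k)\<^sup>2) * cis (\<xi> * edge_velocity k))"
proof -
  define h where "h n = \<xi> / real n" for n
  have hb: "\<bar>h n\<bar> \<le> \<bar>\<xi>\<bar>" for n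
  proof (cases n)
    case (Suc m)
    then show ?thesis by (simp add: h_def abs_divide divide_le_eq mult_le_cancel_left1)
  qed (simp add: h_def)
  define P where "P n k = cnj (phat n k) * phat n (k + h n)" for n k
  define Q where "Q n k = cnj (edge_part n k) * edge_part n (k + h n)" for n k
  have [measurable]: "P n \<in> borel_measurable borel" "Q n \<in> borel_measurable borel" for n
    unfolding P_def[abs_def] Q_def[abs_def] by measurable
  have nP: "norm (P n k) \<le> 1" for n k
    unfolding P_def norm_mult complex_mod_cnj by (intro mult_le_one phat_le_1) auto
  have nQ: "norm (Q n k) \<le> 1" for n k
    unfolding Q_def norm_mult complex_mod_cnj by (intro mult_le_one norm_edge_part) auto
  have sum: "(\<Sum>j\<in>{- int n..int n}. of_real ((cmod (amp n j))\<^sup>2) * cis (\<xi> * (of_int j / real n))) =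
      integral\<^sup>L circle_measure (P n)" for n
  proof -
    have "integral\<^sup>L circle_measure (\<lambda>k. cnj (fourier_sum n (amp n) k) * fourier_sum n (amp n) (k + h n)) =
     (\<Sum>j\<in>{- int n..int n}. of_real ((norm (amp n j))\<^sup>2) * cis (h n * of_int j))"
      by (rule fourier_sum_char[where B = 1]) (use phat_le_1 in \<open>simp add: phat_def\<close>)
    then show ?thesis unfolding P_def[abs_def] phat_def h_def by simp
  qed
  have Qlim: "(\<lambda>n. integral\<^sup>L circle_measure (Q n)) \<longlonglongrightarrow>
     integral\<^sup>L circle_measure (\<lambda>k. of_real ((edge_weight k)\<^sup>2) * cis (\<xi> * edge_velocity k))"
  proof (rule circle_bounded_convergence[where B = 1])
    show "AE k in lborel. (\<lambda>n. Q n k) \<longlonglongrightarrow> of_real ((edge_weight k)\<^sup>2) * cis (\<xi> * edge_velocity k)"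
      using AE_cos_neq[of 0] unfolding Q_def h_def by eventually_elim (rule edge_part_shift_limit)
  qed (use nQ in \<open>simp_all, measurable\<close>)
  define e where "e n k = norm (phat n k - edge_part n k)" for n k
  have [measurable]: "e n \<in> borel_measurable borel" for n unfolding e_def[abs_def] by measurable
  have e2: "norm (e n k) \<le> 2" for n k
    using norm_triangle_ineq4[of "phat n k" "edge_part n k"] phat_le_1[of n k] norm_edge_part[of n k]
    by (simp add: e_def)
  have "(\<lambda>n. integral\<^sup>L circle_measure (P n) - integral\<^sup>L circle_measure (Q n)) \<longlonglongrightarrow> 0"
  proof (rule Lim_null_comparison)
    have "norm (integral\<^sup>L circle_measure (P n) - integral\<^sup>L circle_measure (Q n)) \<le>
      integral\<^sup>L circle_measure (\<lambda>k. e n k) + integral\<^sup>L circle_measure (\<lambda>k. e n (k + h n))" for n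
    proof -
      have iP: "integrable circle_measure (P n)" by (rule integrable_circle_measure[OF _ nP]) measurable
      have iQ: "integrable circle_measure (Q n)" by (rule integrable_circle_measure[OF _ nQ]) measurable
      have ie: "integrable circle_measure (e n)" by (rule integrable_circle_measure[OF _ e2]) measurable
      have ie': "integrable circle_measure (\<lambda>k. e n (k + h n))" by (rule integrable_circle_measure[OF _ e2]) measurable
      have le: "norm (P n k - Q n k) \<le> e n k + e n (k + h n)" for k
      proof -
        have "P n k - Q n k = cnj (phat n k) * (phat n (k + h n) - edge_part n (k + h n)) +
           cnj (phat n k - edge_part n k) * edge_part n (k + h n)"
          by (simp add: P_def Q_def algebra_simps)
        also have "norm \<dots> \<le> norm (phat n k) * e n (k + h n) + e n k * norm (edge_part n (k + h n))"
          unfolding e_def by (rule norm_triangle_le) (simp only: norm_mult complex_mod_cnj)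
        also have "\<dots> \<le> 1 * e n (k + h n) + e n k * 1"
          by (intro add_mono mult_mono phat_le_1 norm_edge_part) (auto simp: e_def)
        finally show ?thesis by simp
      qed
      have "norm (integral\<^sup>L circle_measure (P n) - integral\<^sup>L circle_measure (Q n)) =
        norm (integral\<^sup>L circle_measure (\<lambda>k. P n k - Q n k))"
        by (simp only: Bochner_Integration.integral_diff[OF iP iQ])
      also have "\<dots> \<le> integral\<^sup>L circle_measure (\<lambda>k. norm (P n k - Q n k))"
        by (rule integral_norm_bound)
      also have "\<dots> \<le> integral\<^sup>L circle_measure (\<lambda>k. e n k + e n (k + h n))"
        using iP iQ ie ie' le by (intro integral_mono) auto
      also have "\<dots> = integral\<^sup>L circle_measure (\<lambda>k. e n k) + integral\<^sup>L circle_measure (\<lambda>k. e n (k + h n))"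
        by (rule Bochner_Integration.integral_add[OF ie ie'])
      finally show ?thesis .
    qed
    then show "\<forall>\<^sub>F n in sequentially. norm (integral\<^sup>L circle_measure (P n) - integral\<^sup>L circle_measure (Q n)) \<le>
      integral\<^sup>L circle_measure (\<lambda>k. e n k) + integral\<^sup>L circle_measure (\<lambda>k. e n (k + h n))"
      by (intro always_eventually allI)
    have "(\<lambda>n. integral\<^sup>L circle_measure (\<lambda>k. e n k)) \<longlonglongrightarrow> 0"
      using phat_L1_circle[of "\<lambda>_. 0" 0] by (simp add: e_def)
    moreover have "(\<lambda>n. integral\<^sup>L circle_measure (\<lambda>k. e n (k + h n))) \<longlonglongrightarrow> 0"
      unfolding e_def by (rule phat_L1_circle[OF hb])
    ultimately show "(\<lambda>n. integral\<^sup>L circle_measure (\<lambda>k. e n k) + integral\<^sup>L circle_measure (\<lambda>k. e n (k + h n))) \<longlonglongrightarrow> 0"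
      using tendsto_add by fastforce
  qed
  from tendsto_add[OF this Qlim] show ?thesis unfolding sum by simp
qed

end

section \<open>Weak convergence\<close>

text \<open>Real parts of characters with arbitrary real frequencies. Products stay in the class,
  and \<open>char_limit\<close> gives the limits of their means.\<close>

inductive trig_poly :: "(real \<Rightarrow> real) \<Rightarrow> bool" where
  trig_poly_cis: "trig_poly (\<lambda>x. Re (c * cis (\<xi> * x)))"
| trig_poly_add: "trig_poly f \<Longrightarrow> trig_poly g \<Longrightarrow> trig_poly (\<lambda>x. f x + g x)"

lemma trig_poly_continuous: "trig_poly f \<Longrightarrow> continuous_on A f"
  by (induction rule: trig_poly.induct) (intro continuous_intros | assumption)+

text \<open>The product formula 2 Re u Re v = Re (u v) + Re (u cnj v).\<close>

lemma trig_poly_mult_cis: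
  "trig_poly g \<Longrightarrow> trig_poly (\<lambda>x. Re (c * cis (\<xi> * x)) * g x)"
proof (induction rule: trig_poly.induct)
  case (trig_poly_cis d \<eta>)
  have "Re (c * cis (\<xi> * x)) * Re (d * cis (\<eta> * x)) =
    Re (c * d / 2 * cis ((\<xi> + \<eta>) * x)) + Re (c * cnj d / 2 * cis ((\<xi> - \<eta>) * x))" for x
  proof -
    have "Re u * Re v = Re (u * v / 2) + Re (u * cnj v / 2)" for u v :: complex
      by (simp add: field_simps)
    moreover have "c * cis (\<xi> * x) * (d * cis (\<eta> * x)) / 2 = c * d / 2 * cis ((\<xi> + \<eta>) * x)"
    proof -
      have "cis ((\<xi> + \<eta>) * x) = cis (\<xi> * x) * cis (\<eta> * x)" by (simp only: cis_mult distrib_right)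
      then show ?thesis by simp
    qed
    moreover have "c * cis (\<xi> * x) * cnj (d * cis (\<eta> * x)) / 2 = c * cnj d / 2 * cis ((\<xi> - \<eta>) * x)"
    proof -
      have "cis ((\<xi> - \<eta>) * x) = cis (\<xi> * x) * cis (- (\<eta> * x))" by (simp only: cis_mult left_diff_distrib) simp
      then show ?thesis by (simp add: cis_cnj)
    qed
    ultimately show ?thesis by (simp only:)
  qed
  then show ?case by (simp only:) (intro trig_poly.intros)
next
  case (trig_poly_add f g)
  then show ?case by (simp only: distrib_left) (rule trig_poly.trig_poly_add)
qed

lemma trig_poly_mult: "trig_poly f \<Longrightarrow> trig_poly g \<Longrightarrow> trig_poly (\<lambda>x. f x * g x)"
proof (induction rule: trig_poly.induct)
  case (trig_poly_add f1 f2)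
  then show ?case by (simp only: distrib_right) (rule trig_poly.trig_poly_add; simp)
qed (rule trig_poly_mult_cis)

text \<open>The function sin alone separates the points, because [-1,1] is contained in
  [-pi/2, pi/2].\<close>

lemma trig_poly_dense:
  fixes f :: "real \<Rightarrow> real"
  assumes f: "continuous_on {-1..1} f" and e: "e > 0"
  shows "\<exists>g. trig_poly g \<and> (\<forall>x\<in>{-1..1}. \<bar>f x - g x\<bar> < e)"
proof (rule Stone_Weierstrass_HOL)
  show "trig_poly (\<lambda>x. c)" for c
    using trig_poly_cis[of "of_real c" 0] by simp
  show "\<exists>f. trig_poly f \<and> f x \<noteq> f y" if xy: "x \<in> {-1..1} \<and> y \<in> {-1..1} \<and> x \<noteq> y" for x y :: real
  proof (intro exI conjI)
    show "trig_poly sin" using trig_poly_cis[of "- \<i>" 1] by simp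
    have "\<bar>x\<bar> \<le> pi / 2" "\<bar>y\<bar> \<le> pi / 2" using xy pi_ge_two by auto
    with xy show "sin x \<noteq> sin y" using sin_inj_pi by (auto simp: abs_le_iff)
  qed
qed (use assms in \<open>auto intro: trig_poly_continuous trig_poly_add trig_poly_mult\<close>)

context boundary_walk
begin

lemma edge_mean_integrable:
  assumes [measurable]: "f \<in> borel_measurable borel" and B: "\<And>x. x \<in> {-1..1} \<Longrightarrow> \<bar>f x\<bar> \<le> B"
  shows "integrable circle_measure (\<lambda>k. (edge_weight k)\<^sup>2 * f (edge_velocity k))"
proof (rule integrable_circle_measure)
  fix k
  have "edge_velocity k \<in> {-1..1}" using edge_velocity_bound[of k] by (simp add: abs_le_iff)
  then have "\<bar>f (edge_velocity k)\<bar> \<le> B" by (rule B)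
  moreover have "(edge_weight k)\<^sup>2 \<le> 1" using edge_weight_bound[of k] by (simp add: power_le_one)
  ultimately have "(edge_weight k)\<^sup>2 * \<bar>f (edge_velocity k)\<bar> \<le> 1 * B"
    by (intro mult_mono) auto
  then show "norm ((edge_weight k)\<^sup>2 * f (edge_velocity k)) \<le> B" by (simp add: abs_mult)
qed measurable

lemma edge_mean_integrable_continuous:
  assumes f: "continuous_on UNIV f"
  shows "integrable circle_measure (\<lambda>k. (edge_weight k)\<^sup>2 * f (edge_velocity k))"
proof -
  have "compact (f ` {-1..1})"
    by (intro compact_continuous_image continuous_on_subset[OF f]) auto
  then obtain B where "\<forall>y\<in>f ` {-1..1}. norm y \<le> B"
    using compact_imp_bounded bounded_iff by blast
  then have "\<And>x. x \<in> {-1..1} \<Longrightarrow> \<bar>f x\<bar> \<le> B" by auto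
  then show ?thesis
    by (intro edge_mean_integrable borel_measurable_continuous_onI f)
qed

lemma walk_mean_1: "walk_mean n (\<lambda>_. 1) \<le> 1"
proof -
  have "complex_of_real (walk_mean n (\<lambda>_. 1)) = integral\<^sup>L circle_measure (\<lambda>k. cnj (phat n k) * phat n (k + 0))"
    unfolding phat_def
    by (subst fourier_sum_char[where B = 1]) (use phat_le_1 in \<open>auto simp: phat_def walk_mean_def\<close>)
  also have "\<dots> = integral\<^sup>L circle_measure (\<lambda>k. complex_of_real ((norm (phat n k))\<^sup>2))"
    unfolding complex_norm_square by (simp only: add_0_right mult.commute)
  also have "\<dots> = of_real (integral\<^sup>L circle_measure (\<lambda>k. (norm (phat n k))\<^sup>2))"
    by (rule integral_complex_of_real)
  finally have "walk_mean n (\<lambda>_. 1) = integral\<^sup>L circle_measure (\<lambda>k. (norm (phat n k))\<^sup>2)"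
    by (simp only: of_real_eq_iff)
  also have "\<dots> \<le> integral\<^sup>L circle_measure (\<lambda>k. 1)"
  proof (rule integral_mono)
    show "integrable circle_measure (\<lambda>k. (norm (phat n k))\<^sup>2)"
      by (rule integrable_circle_measure[where B = 1]) (measurable, simp add: phat_le_1 power_le_one)
    show "integrable circle_measure (\<lambda>k. 1 :: real)"
      by (rule integrable_circle_measure[where B = 1]) auto
  qed (simp add: phat_le_1 power_le_one)
  also have "\<dots> = 1"
    by (subst integral_circle_measure) (simp_all add: set_lebesgue_integral_def)
  finally show ?thesis .
qed

lemma walk_mean_mono:
  "(\<And>j. \<bar>j\<bar> \<le> int n \<Longrightarrow> f (of_int j / real n) \<le> g (of_int j / real n)) \<Longrightarrow> walk_mean n f \<le> walk_mean n g"
  unfolding walk_mean_def by (intro sum_mono mult_left_mono) auto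

lemma walk_mean_add: "walk_mean n (\<lambda>x. f x + g x) = walk_mean n f + walk_mean n g"
  by (simp add: walk_mean_def distrib_left sum.distrib)

lemma edge_mean_mono:
  assumes "integrable circle_measure (\<lambda>k. (edge_weight k)\<^sup>2 * f (edge_velocity k))"
    and "integrable circle_measure (\<lambda>k. (edge_weight k)\<^sup>2 * g (edge_velocity k))"
    and "\<And>x. x \<in> {-1..1} \<Longrightarrow> f x \<le> g x"
  shows "edge_mean f \<le> edge_mean g"
  unfolding edge_mean_def
proof (rule integral_mono[OF assms(1,2)])
  fix k
  have "edge_velocity k \<in> {-1..1}" using edge_velocity_bound[of k] by (simp add: abs_le_iff)
  then show "(edge_weight k)\<^sup>2 * f (edge_velocity k) \<le> (edge_weight k)\<^sup>2 * g (edge_velocity k)"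
    by (intro mult_left_mono assms(3)) auto
qed

lemma walk_mean_trig_poly: "trig_poly f \<Longrightarrow> (\<lambda>n. walk_mean n f) \<longlonglongrightarrow> edge_mean f"
proof (induction rule: trig_poly.induct)
  case (trig_poly_cis c \<xi>)
  have re: "Re (of_real t * z) = t * Re z" for t z by simp
  have "(\<lambda>n. Re (c * (\<Sum>j\<in>{- int n..int n}. of_real ((cmod (amp n j))\<^sup>2) * cis (\<xi> * (of_int j / real n))))) \<longlonglongrightarrow>
     Re (c * integral\<^sup>L circle_measure (\<lambda>k. of_real ((edge_weight k)\<^sup>2) * cis (\<xi> * edge_velocity k)))"
    by (intro tendsto_Re tendsto_mult tendsto_const char_limit)
  moreover have "Re (c * (\<Sum>j\<in>{- int n..int n}. of_real ((cmod (amp n j))\<^sup>2) * cis (\<xi> * (of_int j / real n)))) =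
    walk_mean n (\<lambda>x. Re (c * cis (\<xi> * x)))" for n
    unfolding sum_distrib_left Re_sum walk_mean_def
    by (intro sum.cong refl) (simp only: mult.left_commute[of c] re)
  moreover have "Re (c * integral\<^sup>L circle_measure (\<lambda>k. of_real ((edge_weight k)\<^sup>2) * cis (\<xi> * edge_velocity k))) =
    edge_mean (\<lambda>x. Re (c * cis (\<xi> * x)))"
  proof -
    have i: "integrable circle_measure (\<lambda>k. c * (of_real ((edge_weight k)\<^sup>2) * cis (\<xi> * edge_velocity k)))"
    proof (rule integrable_circle_measure)
      show "norm (c * (of_real ((edge_weight k)\<^sup>2) * cis (\<xi> * edge_velocity k))) \<le> norm c" for k
        using edge_weight_bound[of k] by (simp add: norm_mult norm_power mult_left_le power_le_one)
    qed measurable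
    have "Re (c * integral\<^sup>L circle_measure (\<lambda>k. of_real ((edge_weight k)\<^sup>2) * cis (\<xi> * edge_velocity k))) =
      Re (integral\<^sup>L circle_measure (\<lambda>k. c * (of_real ((edge_weight k)\<^sup>2) * cis (\<xi> * edge_velocity k))))"
      by (simp only: integral_mult_right_zero)
    also have "\<dots> = integral\<^sup>L circle_measure (\<lambda>k. Re (c * (of_real ((edge_weight k)\<^sup>2) * cis (\<xi> * edge_velocity k))))"
      by (rule integral_Re[OF i, symmetric])
    also have "\<dots> = edge_mean (\<lambda>x. Re (c * cis (\<xi> * x)))"
      unfolding edge_mean_def by (simp only: mult.left_commute[of c] re)
    finally show ?thesis .
  qed
  ultimately show ?case by simp
next
  case (trig_poly_add f g)
  have "edge_mean (\<lambda>x. f x + g x) = edge_mean f + edge_mean g"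
    unfolding edge_mean_def distrib_left using trig_poly_add.hyps
    by (intro Bochner_Integration.integral_add edge_mean_integrable_continuous trig_poly_continuous)
  then show ?case using tendsto_add[OF trig_poly_add.IH] by (simp add: walk_mean_add)
qed

lemma edge_mean_1: "edge_mean (\<lambda>_. 1) \<le> 1"
proof (rule LIMSEQ_le_const2)
  show "(\<lambda>n. walk_mean n (\<lambda>_. 1)) \<longlonglongrightarrow> edge_mean (\<lambda>_. 1)"
    using walk_mean_trig_poly[OF trig_poly_cis[of 1 0]] by simp
qed (use walk_mean_1 in auto)

text \<open>Neither the walk nor the limit law has mass above 1, so a uniform approximation on
  [-1,1] up to e / 3 changes each mean by at most e / 3.\<close>

lemma walk_mean_continuous:
  assumes f: "continuous_on UNIV f"
  shows "(\<lambda>n. walk_mean n f) \<longlonglongrightarrow> edge_mean f"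
proof (rule LIMSEQ_I)
  fix e :: real assume "e > 0"
  then have e3: "e / 3 > 0" by simp
  obtain g where g: "trig_poly g" and fg: "\<And>x. x \<in> {-1..1} \<Longrightarrow> \<bar>f x - g x\<bar> < e / 3"
    using trig_poly_dense[OF continuous_on_subset[OF f] e3] by auto
  obtain N where N: "\<And>n. n \<ge> N \<Longrightarrow> norm (walk_mean n g - edge_mean g) < e / 3"
    using LIMSEQ_D[OF walk_mean_trig_poly[OF g] e3] by auto
  have gc: "continuous_on UNIV g" by (rule trig_poly_continuous[OF g])
  have 1: "\<bar>walk_mean n f - walk_mean n g\<bar> \<le> e / 3" for n
  proof -
    have "\<bar>walk_mean n f - walk_mean n g\<bar> = \<bar>\<Sum>j\<in>{- int n..int n}. (cmod (amp n j))\<^sup>2 * (f (of_int j / real n) - g (of_int j / real n))\<bar>"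
      by (simp add: walk_mean_def right_diff_distrib sum_subtractf)
    also have "\<dots> \<le> (\<Sum>j\<in>{- int n..int n}. (cmod (amp n j))\<^sup>2 * (e / 3))"
    proof (rule order_trans[OF sum_abs sum_mono])
      fix j assume "j \<in> {- int n..int n}"
      \<comment> \<open>For n = 0 the quotient is 0 by convention and still lies in the
        interval.\<close>
      then have "real_of_int j / real n \<in> {-1..1}" by (cases "n = 0") (auto simp: field_simps)
      then have "\<bar>f (of_int j / real n) - g (of_int j / real n)\<bar> \<le> e / 3" using fg by (simp add: less_imp_le)
      then show "\<bar>(cmod (amp n j))\<^sup>2 * (f (of_int j / real n) - g (of_int j / real n))\<bar> \<le> (cmod (amp n j))\<^sup>2 * (e / 3)"
        unfolding abs_mult by (intro mult_mono) auto
    qed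
    also have "\<dots> = walk_mean n (\<lambda>_. 1) * (e / 3)" unfolding walk_mean_def sum_distrib_right by simp
    also have "\<dots> \<le> 1 * (e / 3)" using walk_mean_1[of n] e3 by (intro mult_right_mono) auto
    finally show ?thesis by simp
  qed
  have 2: "\<bar>edge_mean f - edge_mean g\<bar> \<le> e / 3"
  proof -
    note i = edge_mean_integrable_continuous
    have i1: "integrable circle_measure (\<lambda>k. (edge_weight k)\<^sup>2 * (g (edge_velocity k) + e / 3))"
      by (rule i[of "\<lambda>x. g x + e / 3"]) (intro continuous_intros gc)
    have i2: "integrable circle_measure (\<lambda>k. (edge_weight k)\<^sup>2 * (f (edge_velocity k) + e / 3))"
      by (rule i[of "\<lambda>x. f x + e / 3"]) (intro continuous_intros f)
    have shift: "edge_mean (\<lambda>x. h x + e / 3) \<le> edge_mean h + e / 3" if "continuous_on UNIV h" for h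
    proof -
      have "edge_mean (\<lambda>x. h x + e / 3) = edge_mean h + edge_mean (\<lambda>x. e / 3)"
        unfolding edge_mean_def distrib_left using that
        by (intro Bochner_Integration.integral_add i) auto
      also have "edge_mean (\<lambda>x. e / 3) = edge_mean (\<lambda>_. 1) * (e / 3)"
        unfolding edge_mean_def by simp
      also have "edge_mean (\<lambda>_. 1) * (e / 3) \<le> 1 * (e / 3)"
        using edge_mean_1 e3 by (intro mult_right_mono) auto
      finally show ?thesis by simp
    qed
    have "edge_mean f \<le> edge_mean (\<lambda>x. g x + e / 3)"
      by (rule edge_mean_mono[OF i[OF f] i1]) (drule fg, arith)
    moreover have "edge_mean g \<le> edge_mean (\<lambda>x. f x + e / 3)"
      by (rule edge_mean_mono[OF i[OF gc] i2]) (drule fg, arith)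
    ultimately show ?thesis using shift[OF f] shift[OF gc] by arith
  qed
  show "\<exists>N. \<forall>n\<ge>N. norm (walk_mean n f - edge_mean f) < e"
  proof (intro exI allI impI)
    fix n assume "N \<le> n"
    from N[OF this] 1[of n] 2 show "norm (walk_mean n f - edge_mean f) < e" unfolding real_norm_def by arith
  qed
qed

text \<open>Continuous trapezoids squeeze the indicator of \<open>S\<close>. Their limits under
  \<open>edge_mean\<close> coincide because the velocity almost never equals a or b, so it does not
  matter which endpoints \<open>S\<close> contains.\<close>

lemma walk_mean_interval:
  assumes ab: "AE k in lborel. edge_velocity k \<noteq> a \<and> edge_velocity k \<noteq> b"
    and S: "{a<..<b} \<subseteq> S" "S \<subseteq> {a..b}"
  shows "(\<lambda>n. walk_mean n (indicator S)) \<longlonglongrightarrow> edge_mean (indicator {a..b})"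
proof (rule LIMSEQ_I)
  fix e :: real assume e: "e > 0"
  define low where "low m x = max 0 (min 1 (real m * min (x - a) (b - x)))" for m x
  define upp where "upp m x = max 0 (min 1 (1 - real m * max (a - x) (x - b)))" for m x
  have lowc: "continuous_on UNIV (low m)" and uppc: "continuous_on UNIV (upp m)" for m
    unfolding low_def upp_def by (intro continuous_intros)+
  have [measurable]: "low m \<in> borel_measurable borel" "upp m \<in> borel_measurable borel" for m
    by (intro borel_measurable_continuous_onI lowc uppc)+
  have low01: "0 \<le> low m x" "low m x \<le> 1" and upp01: "0 \<le> upp m x" "upp m x \<le> 1" for m x
    by (auto simp: low_def upp_def)
  have low_le: "low m x \<le> indicator S x" for m x
  proof (cases "x \<in> {a<..<b}")
    case True then show ?thesis using S low01 by (auto simp: indicator_def)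
  next
    case False
    then have "min (x - a) (b - x) \<le> 0" by auto
    then have "real m * min (x - a) (b - x) \<le> 0" by (intro mult_nonneg_nonpos) auto
    then show ?thesis by (auto simp: low_def)
  qed
  have upp_ge: "indicator S x \<le> upp m x" for m x
  proof (cases "x \<in> S")
    case True
    then have "max (a - x) (x - b) \<le> 0" using S by auto
    then have "real m * max (a - x) (x - b) \<le> 0" by (intro mult_nonneg_nonpos) auto
    then show ?thesis by (auto simp: upp_def indicator_def)
  qed (use upp01 in auto)
  have big: "\<forall>\<^sub>F m in sequentially. real m * t \<ge> 1" if "t > 0" for t
  proof -
    have "filterlim (\<lambda>m. t * real m) at_top sequentially"
      using that by (intro filterlim_tendsto_pos_mult_at_top[OF tendsto_const] filterlim_real_sequentially)
    then show ?thesis by (auto simp: filterlim_at_top mult.commute)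
  qed
  \<comment> \<open>The lower trapezoids vanish at a and b themselves; only for them must the
    endpoints be avoided.\<close>
  have lim_low: "(\<lambda>m. low m x) \<longlonglongrightarrow> indicator {a..b} x" if "x \<noteq> a" "x \<noteq> b" for x
  proof (cases "x \<in> {a<..<b}")
    case True
    then have "min (x - a) (b - x) > 0" by auto
    from big[OF this] have "\<forall>\<^sub>F m in sequentially. low m x = 1"
      by eventually_elim (auto simp: low_def)
    then show ?thesis using True by (intro tendsto_eventually) (auto elim!: eventually_mono)
  next
    case False
    then have "indicator {a..b} x = (0::real)" using that by auto
    moreover have "low m x = 0" for m
    proof -
      have "min (x - a) (b - x) \<le> 0" using False by auto
      then have "real m * min (x - a) (b - x) \<le> 0" by (intro mult_nonneg_nonpos) auto
      then show ?thesis by (auto simp: low_def)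
    qed
    ultimately show ?thesis by simp
  qed
  have lim_upp: "(\<lambda>m. upp m x) \<longlonglongrightarrow> indicator {a..b} x" for x
  proof (cases "x \<in> {a..b}")
    case False
    then have "max (a - x) (x - b) > 0" by auto
    from big[OF this] have "\<forall>\<^sub>F m in sequentially. upp m x = 0"
      by eventually_elim (auto simp: upp_def)
    then show ?thesis using False by (intro tendsto_eventually) (auto elim!: eventually_mono)
  next
    case True
    have "upp m x = 1" for m
    proof -
      have "max (a - x) (x - b) \<le> 0" using True by auto
      then have "real m * max (a - x) (x - b) \<le> 0" by (intro mult_nonneg_nonpos) auto
      then show ?thesis by (auto simp: upp_def)
    qed
    then show ?thesis using True by simp
  qed
  have dom: "norm ((edge_weight k)\<^sup>2 * t) \<le> 1" if "0 \<le> t" "t \<le> 1" for k t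
    using edge_weight_bound[of k] that by (auto simp: abs_mult intro!: mult_le_one power_le_one)
  have "(\<lambda>m. edge_mean (low m)) \<longlonglongrightarrow> edge_mean (indicator {a..b})"
    unfolding edge_mean_def
  proof (rule circle_bounded_convergence[where B = 1])
    show "AE k in lborel. (\<lambda>m. (edge_weight k)\<^sup>2 * low m (edge_velocity k)) \<longlonglongrightarrow>
       (edge_weight k)\<^sup>2 * indicator {a..b} (edge_velocity k)"
      using ab by eventually_elim (intro tendsto_intros lim_low; simp)
  qed (measurable, intro dom low01)
  moreover have "(\<lambda>m. edge_mean (upp m)) \<longlonglongrightarrow> edge_mean (indicator {a..b})"
    unfolding edge_mean_def
  proof (rule circle_bounded_convergence[where B = 1])
    show "AE k in lborel. (\<lambda>m. (edge_weight k)\<^sup>2 * upp m (edge_velocity k)) \<longlonglongrightarrow>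
       (edge_weight k)\<^sup>2 * indicator {a..b} (edge_velocity k)"
      by (intro AE_I2 tendsto_intros lim_upp)
  qed (measurable, intro dom upp01)
  ultimately have "\<forall>\<^sub>F m in sequentially. edge_mean (low m) > edge_mean (indicator {a..b}) - e \<and>
      edge_mean (upp m) < edge_mean (indicator {a..b}) + e"
    using e by (intro eventually_conj order_tendstoD) auto
  then obtain m where m: "edge_mean (low m) > edge_mean (indicator {a..b}) - e"
      "edge_mean (upp m) < edge_mean (indicator {a..b}) + e"
    by (auto simp: eventually_sequentially)
  have "\<forall>\<^sub>F n in sequentially. walk_mean n (low m) > edge_mean (indicator {a..b}) - e \<and>
      walk_mean n (upp m) < edge_mean (indicator {a..b}) + e"
    using m by (intro eventually_conj order_tendstoD[OF walk_mean_continuous] lowc uppc)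
  then have "\<forall>\<^sub>F n in sequentially. norm (walk_mean n (indicator S) - edge_mean (indicator {a..b})) < e"
  proof eventually_elim
    case (elim n)
    moreover have "walk_mean n (low m) \<le> walk_mean n (indicator S)" "walk_mean n (indicator S) \<le> walk_mean n (upp m)"
      by (intro walk_mean_mono low_le upp_ge)+
    ultimately show ?case by (simp add: abs_less_iff)
  qed
  then show "\<exists>N. \<forall>n\<ge>N. norm (walk_mean n (indicator S) - edge_mean (indicator {a..b})) < e"
    by (simp add: eventually_sequentially)
qed

end

section \<open>The limit density\<close>

text \<open>An even function of period pi is symmetric about every multiple of pi / 2. The quarter
  is parametrised by t = pi / 2 - k, in which the speed will be increasing.\<close>

lemma nn_integral_quarter:
  fixes H :: "real \<Rightarrow> ennreal"
  assumes [measurable]: "H \<in> borel_measurable borel"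
    and even: "\<And>k. H (- k) = H k" and per: "\<And>k. H (k + pi) = H k"
  shows "(\<integral>\<^sup>+k. H k * indicator {0..2 * pi} k \<partial>lborel) =
    4 * (\<integral>\<^sup>+t. H (pi / 2 - t) * indicator {0..pi / 2} t \<partial>lborel)"
proof -
  define J where "J = (\<integral>\<^sup>+t. H (pi / 2 - t) * indicator {0..pi / 2} t \<partial>lborel)"
  have H1: "H (pi / 2 + t) = H (pi / 2 - t)" for t
  proof -
    have "- (pi / 2 + t) + pi = pi / 2 - t" by simp
    then show ?thesis using per[of "- (pi / 2 + t)"] even[of "pi / 2 + t"] by simp
  qed
  have H2: "H (3 * pi / 2 - t) = H (pi / 2 - t)" for t
    using per[of "pi / 2 - t"] by (simp add: algebra_simps)
  have H3: "H (3 * pi / 2 + t) = H (pi / 2 - t)" for t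
    using per[of "pi / 2 + t"] H1[of t] by (simp add: algebra_simps)
  have piece: "(\<integral>\<^sup>+k. H k * indicator A k \<partial>lborel) = J"
    if [measurable]: "A \<in> sets borel" and c: "\<bar>c\<bar> = 1"
      and "\<And>t. H (x + c * t) = H (pi / 2 - t)" and "\<And>t. x + c * t \<in> A \<longleftrightarrow> t \<in> {0..pi / 2}" for A c x
  proof -
    have "c \<noteq> 0" using c by auto
    then have "(\<integral>\<^sup>+k. H k * indicator A k \<partial>lborel) = \<bar>c\<bar> * (\<integral>\<^sup>+t. H (x + c * t) * indicator A (x + c * t) \<partial>lborel)"
      by (intro nn_integral_real_affine) auto
    also have "\<dots> = J" unfolding c J_def using that by (simp add: indicator_def)
    finally show ?thesis .
  qed
  have "AE k in lborel. k \<noteq> pi / 2 \<and> k \<noteq> pi \<and> k \<noteq> 3 * pi / 2"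
    using AE_lborel_singleton[of "pi / 2"] AE_lborel_singleton[of pi] AE_lborel_singleton[of "3 * pi / 2"]
    by eventually_elim auto
  then have "(\<integral>\<^sup>+k. H k * indicator {0..2 * pi} k \<partial>lborel) = (\<integral>\<^sup>+k. H k * indicator {0..pi / 2} k +
      (H k * indicator {pi / 2..pi} k + (H k * indicator {pi..3 * pi / 2} k + H k * indicator {3 * pi / 2..2 * pi} k)) \<partial>lborel)"
  proof (intro nn_integral_cong_AE, eventually_elim)
    case (elim k)
    then show ?case using pi_gt_zero by (auto split: split_indicator)
  qed
  also have "\<dots> = (\<integral>\<^sup>+k. H k * indicator {0..pi / 2} k \<partial>lborel) + ((\<integral>\<^sup>+k. H k * indicator {pi / 2..pi} k \<partial>lborel) +
     ((\<integral>\<^sup>+k. H k * indicator {pi..3 * pi / 2} k \<partial>lborel) + (\<integral>\<^sup>+k. H k * indicator {3 * pi / 2..2 * pi} k \<partial>lborel)))"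
    by (simp add: nn_integral_add)
  also have "(\<integral>\<^sup>+k. H k * indicator {0..pi / 2} k \<partial>lborel) = J"
    by (rule piece[where c = "-1" and x = "pi / 2"]) auto
  also have "(\<integral>\<^sup>+k. H k * indicator {pi / 2..pi} k \<partial>lborel) = J"
    by (rule piece[where c = "1" and x = "pi / 2"]) (auto simp: H1)
  also have "(\<integral>\<^sup>+k. H k * indicator {pi..3 * pi / 2} k \<partial>lborel) = J"
    by (rule piece[where c = "-1" and x = "3 * pi / 2"]) (auto simp: H2)
  also have "(\<integral>\<^sup>+k. H k * indicator {3 * pi / 2..2 * pi} k \<partial>lborel) = J"
    by (rule piece[where c = "1" and x = "3 * pi / 2"]) (auto simp: H3)
  also have "J + (J + (J + J)) = 4 * J"
  proof -
    have "(4::ennreal) * J = (1 + (1 + (1 + 1))) * J" by simp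
    then show ?thesis by (simp only: distrib_right mult_1_left)
  qed
  finally show ?thesis by (simp add: J_def)
qed

text \<open>\<open>V t\<close> is the speed of the edge state at momentum pi / 2 - t, so the change
  of variables turns the Konno density into a constant. At t = pi / 2 the speed is p, where the
  density is cut off; hence the open interval.\<close>

lemma konno_substitution:
  fixes p :: real
  assumes p: "0 < p" "p < 1"
  defines "V \<equiv> \<lambda>t. p * sin t / sqrt (1 - (p * cos t)\<^sup>2)"
    and "V' \<equiv> \<lambda>t. p * cos t * (1 - p\<^sup>2) / ((1 - (p * cos t)\<^sup>2) * sqrt (1 - (p * cos t)\<^sup>2))"
  shows "(V has_real_derivative V' t) (at t)"
    and "t \<in> {0<..<pi / 2} \<Longrightarrow> konno_density p (V t) * V' t = 1 / pi"
proof -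
  define D where "D = 1 - (p * cos t)\<^sup>2"
  have p2: "p\<^sup>2 < 1" using p by (simp add: power_less_one_iff)
  have "(cos t)\<^sup>2 \<le> 1" by (simp add: abs_square_le_1)
  then have "p\<^sup>2 * (cos t)\<^sup>2 \<le> p\<^sup>2 * 1" by (intro mult_left_mono) auto
  then have D: "D > 0" using p2 by (simp add: D_def power_mult_distrib)
  have sc: "(sin t)\<^sup>2 = 1 - (cos t)\<^sup>2" by (rule sin_squared_eq)
  have Dsin: "D = 1 - p\<^sup>2 + p\<^sup>2 * (sin t)\<^sup>2" by (simp add: D_def sc algebra_simps power_mult_distrib)
  have sq: "sqrt D * sqrt D = D" using D by simp
  show "(V has_real_derivative V' t) (at t)"
  proof -
    have "(V has_real_derivative
      (p * cos t * sqrt D - p * sin t * ((2 * (p * cos t) * (p * sin t)) * (inverse (sqrt D) / 2))) / (sqrt D * sqrt D)) (at t)"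
      unfolding V_def D_def
      by (rule derivative_eq_intros refl | use D in \<open>simp add: D_def\<close>)+
    moreover have "(p * cos t * sqrt D - p * sin t * ((2 * (p * cos t) * (p * sin t)) * (inverse (sqrt D) / 2))) / (sqrt D * sqrt D)
      = V' t"
    proof -
      have "(p * cos t * sqrt D - p * sin t * ((2 * (p * cos t) * (p * sin t)) * (inverse (sqrt D) / 2))) =
        p * cos t * (D - p\<^sup>2 * (sin t)\<^sup>2) / sqrt D"
        using D sq by (simp add: field_simps power2_eq_square)
      also have "D - p\<^sup>2 * (sin t)\<^sup>2 = 1 - p\<^sup>2" by (simp add: Dsin)
      finally show ?thesis unfolding V'_def D_def[symmetric] sq by (simp add: field_simps)
    qed
    ultimately show ?thesis by simp
  qed
  show "konno_density p (V t) * V' t = 1 / pi" if t: "t \<in> {0<..<pi / 2}"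
  proof -
    have c: "cos t > 0" and st: "sin t > 0" using t by (auto intro!: cos_gt_zero_pi sin_gt_zero)
    have V2: "(V t)\<^sup>2 = p\<^sup>2 * (sin t)\<^sup>2 / D"
      unfolding V_def D_def[symmetric] using D by (simp add: power_divide power_mult_distrib)
    have 1: "1 - (V t)\<^sup>2 = (1 - p\<^sup>2) / D"
      unfolding V2 using D by (simp add: field_simps Dsin)
    have "p\<^sup>2 - (V t)\<^sup>2 = p\<^sup>2 * (D - (sin t)\<^sup>2) / D"
      unfolding V2 using D by (simp add: field_simps)
    also have "D - (sin t)\<^sup>2 = (1 - p\<^sup>2) * (cos t)\<^sup>2"
      unfolding Dsin sc by (simp add: algebra_simps)
    finally have 2: "p\<^sup>2 - (V t)\<^sup>2 = p\<^sup>2 * ((1 - p\<^sup>2) * (cos t)\<^sup>2) / D" .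
    then have s2: "sqrt (p\<^sup>2 - (V t)\<^sup>2) = p * sqrt (1 - p\<^sup>2) * cos t / sqrt D"
      using p c by (simp add: real_sqrt_mult real_sqrt_divide)
    have "p\<^sup>2 - (V t)\<^sup>2 > 0" unfolding 2 using p p2 c D by simp
    then have "\<bar>V t\<bar> < p" using p power2_less_imp_less[of "\<bar>V t\<bar>" p] by simp
    then have ind: "indicator {-p<..<p} (V t) = (1::real)" by (auto simp: abs_less_iff)
    have q: "sqrt (1 - p\<^sup>2) > 0" using p2 by simp
    show ?thesis unfolding konno_density_def ind s2 1 V'_def D_def[symmetric]
      using p p2 c D q by (simp add: field_simps)
  qed
qed

lemma konno_even: "konno_density p (- y) = konno_density p y"
  by (auto simp: konno_density_def indicator_def)

lemma limit_density_measurable [measurable]: "limit_density u v \<in> borel_measurable borel"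
  unfolding limit_density_def[abs_def] konno_density_def by measurable

lemma konno_nonneg: "0 < p \<Longrightarrow> p < 1 \<Longrightarrow> konno_density p y \<ge> 0"
proof -
  assume p: "0 < p" "p < 1"
  show ?thesis
  proof (cases "y \<in> {-p<..<p}")
    case True
    then have "\<bar>y\<bar> < p" by auto
    then have "y\<^sup>2 < p\<^sup>2" using power_strict_mono[of "\<bar>y\<bar>" p 2] by simp
    moreover have "p\<^sup>2 < 1" using p by (simp add: power_less_one_iff)
    ultimately show ?thesis unfolding konno_density_def by (intro mult_nonneg_nonneg divide_nonneg_nonneg) auto
  qed (simp add: konno_density_def)
qed

context boundary_walk
begin

text \<open>At speed y the squared weight is s^2 y^2 / r^2, and the uniform law of k makes the speed
  follow the Konno density. All velocities have the sign of s r, so both halves of the symmetric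
  Konno law fall on one side; this is the factor 2.\<close>

lemma edge_mean_interval_density:
  assumes r0: "0 < \<bar>r\<bar>" and r1: "\<bar>r\<bar> < 1"
  shows "set_integrable lborel {a..b} (limit_density s r)"
    and "(LINT y:{a..b}|lborel. limit_density s r y) = edge_mean (indicator {a..b})"
proof -
  define p where "p = \<bar>r\<bar>"
  define \<sigma> where "\<sigma> = sgn (s * r)"
  have p: "0 < p" "p < 1" using r0 r1 by (auto simp: p_def)
  have \<sigma>: "\<sigma> = 1 \<or> \<sigma> = -1" using s0 r0 by (auto simp: \<sigma>_def sgn_if)
  have \<sigma>p: "sgn s * r = \<sigma> * p" by (simp add: \<sigma>_def p_def sgn_mult mult.assoc sgn_mult_abs)
  have rp: "r\<^sup>2 = p\<^sup>2" by (simp add: p_def)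
  define V where "V = (\<lambda>t. p * sin t / sqrt (1 - (p * cos t)\<^sup>2))"
  define V' where "V' = (\<lambda>t. p * cos t * (1 - p\<^sup>2) / ((1 - (p * cos t)\<^sup>2) * sqrt (1 - (p * cos t)\<^sup>2)))"
  have V: "(V has_real_derivative V' t) (at t)"
    "t \<in> {0<..<pi / 2} \<Longrightarrow> konno_density p (V t) * V' t = 1 / pi" for t
    unfolding V_def V'_def using konno_substitution[OF p, of t] by blast+
  have p2: "p\<^sup>2 < 1" using p by (simp add: power_less_one_iff)
  have Dpos: "1 - (p * cos t)\<^sup>2 > 0" for t
  proof -
    have "(cos t)\<^sup>2 \<le> 1" by (simp add: abs_square_le_1)
    then have "p\<^sup>2 * (cos t)\<^sup>2 \<le> p\<^sup>2 * 1" by (intro mult_left_mono) auto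
    then show ?thesis using p2 by (simp add: power_mult_distrib)
  qed
  define H where "H k = (edge_weight k)\<^sup>2 * indicator {a..b} (edge_velocity k)" for k
  have [measurable]: "H \<in> borel_measurable borel" unfolding H_def[abs_def] by measurable
  have H0: "H k \<ge> 0" for k by (simp add: H_def)
  have H1: "H k \<le> 1" for k
    using edge_weight_bound[of k] by (auto simp: H_def indicator_def power_le_one)
  \<comment> \<open>A function of the speed y; the factor \<open>\<sigma>\<close> turns it back into
    the velocity, so both signs of s r are treated at once.\<close>
  define f where "f y = 2 * s\<^sup>2 / p\<^sup>2 * y\<^sup>2 * konno_density p y * indicator {a..b} (\<sigma> * y)" for y
  have f0: "f y \<ge> 0" for y unfolding f_def using konno_nonneg[OF p] by simp
  have [measurable]: "f \<in> borel_measurable borel"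
    unfolding f_def[abs_def] konno_density_def by measurable

  have Hq: "f (V t) * V' t = 2 / pi * H (pi / 2 - t)" if t: "t \<in> {0<..<pi / 2}" for t
  proof -
    have st: "sin t > 0" using t by (intro sin_gt_zero) auto
    have V2: "(V t)\<^sup>2 = p\<^sup>2 * (sin t)\<^sup>2 / (1 - (p * cos t)\<^sup>2)"
      unfolding V_def using Dpos[of t] by (simp add: power_divide power_mult_distrib)
    have rc: "(r * cos t)\<^sup>2 = (p * cos t)\<^sup>2" by (simp add: power_mult_distrib rp)
    have ew: "(edge_weight (pi / 2 - t))\<^sup>2 = s\<^sup>2 / p\<^sup>2 * (V t)\<^sup>2"
    proof -
      have "edge_weight (pi / 2 - t) = \<bar>s * sin t\<bar> / sqrt (1 - (p * cos t)\<^sup>2)"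
        by (simp add: edge_weight_def sin_diff cos_diff rc)
      then show ?thesis
        unfolding V2 using Dpos[of t] p by (simp add: power_divide power_mult_distrib)
    qed
    have ev: "edge_velocity (pi / 2 - t) = \<sigma> * V t"
      unfolding edge_velocity_def \<sigma>p V_def using st by (simp add: sin_diff cos_diff rc)
    have "f (V t) * V' t = 2 * (s\<^sup>2 / p\<^sup>2 * (V t)\<^sup>2) * indicator {a..b} (\<sigma> * V t) * (konno_density p (V t) * V' t)"
      by (simp add: f_def mult_ac)
    also have "\<dots> = 2 / pi * H (pi / 2 - t)"
      unfolding V(2)[OF t] H_def ew ev by (simp add: ac_simps)
    finally show ?thesis .
  qed

  have "(\<integral>\<^sup>+y. f y * indicator {V 0..V (pi / 2)} y \<partial>lborel) = (\<integral>\<^sup>+t. f (V t) * V' t * indicator {0..pi / 2} t \<partial>lborel)"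
  proof (rule nn_integral_substitution)
    show "set_borel_measurable borel {V 0..V (pi / 2)} f" unfolding set_borel_measurable_def by measurable
    show "(V has_real_derivative V' t) (at t)" for t by (rule V(1))
    show "continuous_on {0..pi / 2} V'" unfolding V'_def
      by (intro continuous_intros) (use Dpos in \<open>auto simp: less_imp_neq[symmetric]\<close>)
    show "V' t \<ge> 0" if "t \<in> {0..pi / 2}" for t
      unfolding V'_def using that p p2 Dpos[of t] by (auto intro!: divide_nonneg_pos mult_nonneg_nonneg cos_ge_zero)
  qed simp
  also have "\<dots> = (\<integral>\<^sup>+t. ennreal (2 / pi) * (ennreal (H (pi / 2 - t)) * indicator {0..pi / 2} t) \<partial>lborel)"
  proof (rule nn_integral_cong_AE)
    have "AE t in lborel. t \<noteq> 0 \<and> t \<noteq> pi / 2"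
      using AE_lborel_singleton[of 0] AE_lborel_singleton[of "pi / 2"] by eventually_elim auto
    then show "AE t in lborel. ennreal (f (V t) * V' t * indicator {0..pi / 2} t) =
       ennreal (2 / pi) * (ennreal (H (pi / 2 - t)) * indicator {0..pi / 2} t)"
    proof eventually_elim
      case (elim t)
      have "ennreal (2 / pi * H (pi / 2 - t)) = ennreal (2 / pi) * ennreal (H (pi / 2 - t))"
        by (rule ennreal_mult) (simp_all add: H0)
      then show ?case using elim Hq[of t] by (cases "t \<in> {0..pi / 2}") auto
    qed
  qed
  also have "\<dots> = ennreal (2 / pi) * (\<integral>\<^sup>+t. ennreal (H (pi / 2 - t)) * indicator {0..pi / 2} t \<partial>lborel)"
    by (rule nn_integral_cmult) measurable
  \<comment> \<open>One quarter counts four times: 2 / pi = 4 / (2 pi), and 1 / (2 pi) is the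
    normalisation of \<open>circle_measure\<close>.\<close>
  also have "\<dots> = ennreal (1 / (2 * pi)) * (\<integral>\<^sup>+k. ennreal (H k) * indicator {0..2 * pi} k \<partial>lborel)"
  proof -
    have "(\<integral>\<^sup>+k. ennreal (H k) * indicator {0..2 * pi} k \<partial>lborel) =
      4 * (\<integral>\<^sup>+t. ennreal (H (pi / 2 - t)) * indicator {0..pi / 2} t \<partial>lborel)"
    proof (rule nn_integral_quarter)
      show "ennreal (H (- k)) = ennreal (H k)" for k
        by (simp add: H_def edge_weight_def edge_velocity_def)
      show "ennreal (H (k + pi)) = ennreal (H k)" for k
        by (simp add: H_def edge_weight_def edge_velocity_def abs_mult)
    qed measurable
    moreover have "ennreal (1 / (2 * pi)) * 4 = ennreal (2 / pi)"
      using ennreal_mult[of "1 / (2 * pi)" 4] by simp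
    ultimately show ?thesis by (simp add: mult.assoc[symmetric])
  qed
  also have "(\<integral>\<^sup>+k. ennreal (H k) * indicator {0..2 * pi} k \<partial>lborel) = ennreal (LINT k:{0..2 * pi}|lborel. H k)"
  proof -
    have "integrable lborel (\<lambda>k. indicator {0..2 * pi} k *\<^sub>R H k)"
      by (rule Bochner_Integration.integrable_bound[where f = "\<lambda>k. indicator {0..2 * pi} k :: real"])
         (use H0 H1 in \<open>auto simp: emeasure_lborel_Icc_eq intro!: integrable_real_indicator split: split_indicator\<close>)
    from nn_integral_eq_integral[OF this] H0
    have "(\<integral>\<^sup>+k. ennreal (indicator {0..2 * pi} k *\<^sub>R H k) \<partial>lborel) = ennreal (LINT k:{0..2 * pi}|lborel. H k)"
      by (simp add: set_lebesgue_integral_def)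
    moreover have "ennreal (indicator {0..2 * pi} k *\<^sub>R H k) = ennreal (H k) * indicator {0..2 * pi} k" for k
      by (auto split: split_indicator)
    ultimately show ?thesis by simp
  qed
  also have "ennreal (1 / (2 * pi)) * ennreal (LINT k:{0..2 * pi}|lborel. H k) = ennreal (edge_mean (indicator {a..b}))"
  proof -
    have "edge_mean (indicator {a..b}) = 1 / (2 * pi) * (LINT k:{0..2 * pi}|lborel. H k)"
      unfolding edge_mean_def H_def[symmetric] by (subst integral_circle_measure) auto
    then show ?thesis by (simp add: ennreal_mult'[symmetric])
  qed
  finally have main: "(\<integral>\<^sup>+y. f y * indicator {V 0..V (pi / 2)} y \<partial>lborel) = ennreal (edge_mean (indicator {a..b}))" .
  have V0: "V 0 = 0" "V (pi / 2) = p" by (simp_all add: V_def)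
  have dens: "ennreal (indicator {a..b} (\<sigma> * y) *\<^sub>R limit_density s r (\<sigma> * y)) = ennreal (f y * indicator {0..p} y)" for y
  proof -
    have eq: "limit_density s r (\<sigma> * y) = 2 * s\<^sup>2 / p\<^sup>2 * y\<^sup>2 * konno_density p y * indicator {0..} y"
    proof (cases "s * r > 0")
      case True
      then show ?thesis by (simp add: \<sigma>_def limit_density_def p_def)
    next
      case False
      then have "\<sigma> = -1" using s0 r0 by (auto simp: \<sigma>_def sgn_if)
      moreover have "indicator {..0} (- y) = (indicator {0..} y :: real)" by (auto simp: indicator_def)
      ultimately show ?thesis using False by (simp add: limit_density_def p_def konno_even)
    qed
    have "konno_density p y = 0" if "y > p" using that by (simp add: konno_density_def)
    then show ?thesis unfolding eq f_def by (auto split: split_indicator)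
  qed
  have "(\<integral>\<^sup>+y. ennreal (indicator {a..b} y *\<^sub>R limit_density s r y) \<partial>lborel) =
     \<bar>\<sigma>\<bar> * (\<integral>\<^sup>+y. ennreal (indicator {a..b} (0 + \<sigma> * y) *\<^sub>R limit_density s r (0 + \<sigma> * y)) \<partial>lborel)"
    by (rule nn_integral_real_affine) (use \<sigma> in auto)
  also have "\<dots> = (\<integral>\<^sup>+y. f y * indicator {V 0..V (pi / 2)} y \<partial>lborel)"
    unfolding V0 add_0_left dens using \<sigma> by auto
  also note main
  finally have nn: "(\<integral>\<^sup>+y. ennreal (indicator {a..b} y *\<^sub>R limit_density s r y) \<partial>lborel) = ennreal (edge_mean (indicator {a..b}))" .
  have "limit_density s r y \<ge> 0" for y
    unfolding limit_density_def using konno_nonneg[of "\<bar>r\<bar>" y] r0 r1 by simp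
  moreover have "edge_mean (indicator {a..b}) \<ge> 0"
    unfolding edge_mean_def by (intro integral_nonneg_AE) auto
  ultimately have "integrable lborel (\<lambda>y. indicator {a..b} y *\<^sub>R limit_density s r y) \<and>
    integral\<^sup>L lborel (\<lambda>y. indicator {a..b} y *\<^sub>R limit_density s r y) = edge_mean (indicator {a..b})"
    using nn by (subst nn_integral_eq_integrable[symmetric]) auto
  then show "set_integrable lborel {a..b} (limit_density s r)"
    and "(LINT y:{a..b}|lborel. limit_density s r y) = edge_mean (indicator {a..b})"
    by (auto simp: set_integrable_def set_lebesgue_integral_def)
qed


section \<open>Window sums of the walk as means of indicators\<close>

abbreviation \<nu> :: "nat \<Rightarrow> int \<Rightarrow> real" where
  "\<nu> \<equiv> boundary_prob \<alpha> \<beta>"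

lemma nu_support: "int n < \<bar>j\<bar> \<Longrightarrow> \<nu> n j = 0"
  by (simp add: boundary_prob_amp amp_support)

lemma nu_nonneg: "\<nu> n j \<ge> 0"
  by (simp add: boundary_prob_amp)

lemma walk_mean_indicator_cong:
  assumes "\<And>j. \<bar>j\<bar> \<le> int n \<Longrightarrow> f (of_int j / real n) = g (of_int j / real n)"
  shows "walk_mean n f = walk_mean n g"
  unfolding walk_mean_def by (intro sum.cong refl) (auto simp: assms abs_le_iff)

text \<open>Sites beyond distance n carry no mass. Finiteness of the window matters because a sum
  over an infinite set is 0 by convention.\<close>

lemma sum_eq_walk_mean:
  assumes "finite {j. P j}" and "\<And>j. P j \<longleftrightarrow> real_of_int j / real n \<in> S"
  shows "(\<Sum>j | P j. \<nu> n j) = walk_mean n (indicator S)"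
proof -
  have "(\<Sum>j | P j. \<nu> n j) = (\<Sum>j\<in>{j. P j} \<inter> {- int n..int n}. \<nu> n j)"
    using assms(1) by (intro sum.mono_neutral_right) (auto intro!: nu_support)
  also have "\<dots> = (\<Sum>j\<in>{- int n..int n} \<inter> {j. P j}. \<nu> n j)" by (simp only: Int_commute)
  also have "\<dots> = (\<Sum>j\<in>{- int n..int n}. if j \<in> {j. P j} then \<nu> n j else 0)"
    by (rule sum.inter_restrict) simp
  also have "\<dots> = walk_mean n (indicator S)"
    unfolding walk_mean_def by (intro sum.cong refl) (auto simp: assms(2) boundary_prob_amp indicator_def)
  finally show ?thesis .
qed

lemma infsum_eq_walk_mean:
  "(\<Sum>\<^sub>\<infinity>j\<in>A. \<nu> n j * f (real_of_int j / real n)) =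
     (\<Sum>j\<in>{- int n..int n}. indicator A j * (\<nu> n j * f (real_of_int j / real n)))"
proof -
  have "(\<Sum>\<^sub>\<infinity>j\<in>A. \<nu> n j * f (real_of_int j / real n)) =
    (\<Sum>\<^sub>\<infinity>j\<in>{- int n..int n}. indicator A j * (\<nu> n j * f (real_of_int j / real n)))"
    by (rule infsum_cong_neutral) (auto simp: nu_support indicator_def)
  then show ?thesis by simp
qed

lemma infsum_UNIV_eq_walk_mean: "(\<Sum>\<^sub>\<infinity>j. \<nu> n j * f (real_of_int j / real n)) = walk_mean n f"
  unfolding infsum_eq_walk_mean walk_mean_def by (simp add: boundary_prob_amp)

lemma infsum_le_eq_walk_mean:
  "(\<Sum>\<^sub>\<infinity>j\<in>{j. real_of_int j / real n \<le> y}. \<nu> n j) = walk_mean n (indicator {..y})"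
proof -
  have "(\<Sum>\<^sub>\<infinity>j\<in>{j. real_of_int j / real n \<le> y}. \<nu> n j) =
     (\<Sum>j\<in>{- int n..int n}. indicator {j. real_of_int j / real n \<le> y} j * \<nu> n j)"
    using infsum_eq_walk_mean[where f = "\<lambda>_. 1"] by simp
  then show ?thesis unfolding walk_mean_def
    by (auto simp: boundary_prob_amp indicator_def intro!: sum.cong)
qed

lemma open_window_sum:
  assumes "n > 0"
  shows "(\<Sum>j | real_of_int \<bar>j\<bar> < real n * y. \<nu> n j) = walk_mean n (indicator {- y<..<y})"
proof (rule sum_eq_walk_mean)
  show "finite {j. real_of_int \<bar>j\<bar> < real n * y}"
    by (rule finite_subset[of _ "{- \<lceil>real n * y\<rceil>..\<lceil>real n * y\<rceil>}"]) (auto simp: abs_less_iff, linarith+)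
  show "real_of_int \<bar>j\<bar> < real n * y \<longleftrightarrow> real_of_int j / real n \<in> {- y<..<y}" for j
    using assms by (auto simp: abs_less_iff field_simps)
qed

text \<open>For n = 0 every quotient is 0, and the window may consist of all integers; hence the
  restriction to positive n.\<close>

lemma closed_window_sum:
  assumes "n > 0"
  shows "(\<Sum>j | a \<le> real_of_int j / real n \<and> real_of_int j / real n \<le> b. \<nu> n j) =
    walk_mean n (indicator {a..b})"
proof (rule sum_eq_walk_mean)
  show "finite {j. a \<le> real_of_int j / real n \<and> real_of_int j / real n \<le> b}"
  proof (rule finite_subset)
    show "{j. a \<le> real_of_int j / real n \<and> real_of_int j / real n \<le> b} \<subseteq> {\<lfloor>a * real n\<rfloor>..\<lceil>b * real n\<rceil>}"
    proof safe
      fix j assume "a \<le> real_of_int j / real n" "real_of_int j / real n \<le> b"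
      then have "a * real n \<le> real_of_int j" "real_of_int j \<le> b * real n"
        using assms by (simp_all add: field_simps)
      then show "j \<in> {\<lfloor>a * real n\<rfloor>..\<lceil>b * real n\<rceil>}" unfolding atLeastAtMost_iff by linarith
    qed
  qed simp
qed auto

section \<open>The case 0 < |r| < 1\<close>

lemma edge_mean_indicator_integrable:
  assumes [measurable]: "S \<in> sets borel"
  shows "integrable circle_measure (\<lambda>k. (edge_weight k)\<^sup>2 * indicator S (edge_velocity k))"
  by (rule edge_mean_integrable[where B = 1]) (auto simp: indicator_def)

lemma edge_mean_indicator_mono:
  "A \<subseteq> B \<Longrightarrow> A \<in> sets borel \<Longrightarrow> B \<in> sets borel \<Longrightarrow> edge_mean (indicator A) \<le> edge_mean (indicator B)"
  by (rule edge_mean_mono) (auto intro!: edge_mean_indicator_integrable split: split_indicator)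

lemma edge_mean_indicator_bounds:
  assumes "S \<in> sets borel"
  shows "edge_mean (indicator S) \<in> {0..1}"
proof -
  have "edge_mean (indicator S) \<le> edge_mean (\<lambda>_. 1)"
    by (rule edge_mean_mono)
       (use assms edge_mean_indicator_integrable edge_mean_integrable_continuous[of "\<lambda>_. 1"] in \<open>auto simp: indicator_def\<close>)
  moreover have "edge_mean (indicator S) \<ge> 0"
    unfolding edge_mean_def by (intro integral_nonneg_AE) auto
  ultimately show ?thesis using edge_mean_1 by simp
qed

text \<open>A prescribed velocity determines the square of cos k, hence confines k to two level sets
  of cos.\<close>

lemma AE_edge_velocity_neq:
  assumes r0: "0 < \<bar>r\<bar>" and r1: "\<bar>r\<bar> < 1"
  shows "AE k in lborel. edge_velocity k \<noteq> c"
proof -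
  define t where "t = sqrt (c\<^sup>2 * (1 - r\<^sup>2) / (r\<^sup>2 * (1 - c\<^sup>2)))"
  have r2: "0 < r\<^sup>2" "r\<^sup>2 < 1" using r0 r1 by (auto simp: abs_square_less_1)
  have "AE k in lborel. cos k \<noteq> t \<and> cos k \<noteq> - t \<and> cos k \<noteq> 0"
    using AE_cos_neq[of t] AE_cos_neq[of "- t"] AE_cos_neq[of 0] by eventually_elim simp
  then show ?thesis
  proof eventually_elim
    case (elim k)
    show ?case
    proof
      assume c: "edge_velocity k = c"
      define D where "D = 1 - (r * sin k)\<^sup>2"
      have D: "D > 0" using r_sin_less[of k] elim by (simp add: D_def)
      have "c\<^sup>2 = r\<^sup>2 * (cos k)\<^sup>2 / D"
        unfolding c[symmetric] edge_velocity_def D_def[symmetric]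
        using D s0 by (simp add: power_divide power_mult_distrib sgn_if)
      then have "c\<^sup>2 * D = r\<^sup>2 * (cos k)\<^sup>2" using D by (simp add: field_simps)
      moreover have "D = 1 - r\<^sup>2 + r\<^sup>2 * (cos k)\<^sup>2"
        by (simp add: D_def power_mult_distrib sin_squared_eq algebra_simps)
      ultimately have e: "(cos k)\<^sup>2 * (r\<^sup>2 * (1 - c\<^sup>2)) = c\<^sup>2 * (1 - r\<^sup>2)"
        by (simp add: algebra_simps)
      \<comment> \<open>A velocity of modulus 1 would force 1 - r^2 = 0.\<close>
      have "1 - c\<^sup>2 \<noteq> 0"
      proof
        assume "1 - c\<^sup>2 = 0"
        then have "c\<^sup>2 = 1" by simp
        with e r2 show False by simp
      qed
      then have "(cos k)\<^sup>2 = c\<^sup>2 * (1 - r\<^sup>2) / (r\<^sup>2 * (1 - c\<^sup>2))"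
        using e r2 by (simp add: eq_divide_eq)
      then have "\<bar>cos k\<bar> = t" unfolding t_def real_sqrt_abs[symmetric] by (simp only:)
      then show False using elim by (auto simp: abs_if split: if_splits)
    qed
  qed
qed

text \<open>Everything rests on the velocity having no atoms: windows converge whatever their
  endpoints, the limit mass F y of [-y, y] vanishes at y = 0, which excludes multiples of the
  Heaviside function, and F is continuous.\<close>

lemma linear_case:
  assumes r0: "0 < \<bar>r\<bar>" and r1: "\<bar>r\<bar> < 1"
  shows "continuously_linear_spreading \<nu>"
    and "set_integrable lborel {a..b} (limit_density s r)"
    and "(\<lambda>n. \<Sum>j | a \<le> real_of_int j / real n \<and> real_of_int j / real n \<le> b. \<nu> n j)
             \<longlonglongrightarrow> (LINT y:{a..b}|lborel. limit_density s r y)"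
proof -
  note AEv = AE_edge_velocity_neq[OF r0 r1]
  have AE2: "AE k in lborel. edge_velocity k \<noteq> a \<and> edge_velocity k \<noteq> b" for a b
    using AEv[of a] AEv[of b] by eventually_elim simp
  show "set_integrable lborel {a..b} (limit_density s r)"
    by (rule edge_mean_interval_density[OF r0 r1])
  show "(\<lambda>n. \<Sum>j | a \<le> real_of_int j / real n \<and> real_of_int j / real n \<le> b. \<nu> n j)
             \<longlonglongrightarrow> (LINT y:{a..b}|lborel. limit_density s r y)"
  proof (rule Lim_transform_eventually)
    show "(\<lambda>n. walk_mean n (indicator {a..b})) \<longlonglongrightarrow> (LINT y:{a..b}|lborel. limit_density s r y)"
      unfolding edge_mean_interval_density(2)[OF r0 r1]
      by (rule walk_mean_interval[OF AE2]) auto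
    show "\<forall>\<^sub>F n in sequentially. walk_mean n (indicator {a..b}) =
      (\<Sum>j | a \<le> real_of_int j / real n \<and> real_of_int j / real n \<le> b. \<nu> n j)"
      using eventually_gt_at_top[of 0] by eventually_elim (simp only: closed_window_sum)
  qed
  define F where "F y = edge_mean (indicator {- y..y})" for y :: real
  have F0: "F 0 = 0"
  proof -
    have "AE k in circle_measure. (edge_weight k)\<^sup>2 * indicator {- 0..0} (edge_velocity k) = 0"
      by (rule AE_circle_measure) (use AEv[of 0] in \<open>eventually_elim, simp\<close>)
    then show ?thesis unfolding F_def edge_mean_def by (rule integral_eq_zero_AE)
  qed
  \<comment> \<open>All velocities lie in [-1,1], so F 1 is the full mass; it is positive because
    the weight vanishes only where cos k = 0.\<close>
  have F1: "F 1 \<noteq> 0"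
  proof
    assume "F 1 = 0"
    moreover have "edge_velocity k \<in> {-1..1}" for k
      using edge_velocity_bound[of k] by (simp add: abs_le_iff)
    ultimately have "integral\<^sup>L circle_measure (\<lambda>k. (edge_weight k)\<^sup>2) = 0"
      by (simp add: F_def edge_mean_def)
    moreover have "integrable circle_measure (\<lambda>k. (edge_weight k)\<^sup>2)"
      using edge_mean_integrable_continuous[of "\<lambda>_. 1"] by simp
    ultimately have "AE k in circle_measure. (edge_weight k)\<^sup>2 = 0"
      by (subst (asm) integral_nonneg_eq_0_iff_AE) auto
    then have "AE k in circle_measure. False"
      using AE_circle_measure[OF AE_cos_neq[of 0]]
    proof eventually_elim
      case (elim k)
      then show False using r_sin_less[of k] s0 by (simp add: edge_weight_def)
    qed
    \<comment> \<open>If the empty property held almost everywhere, the constant 1 would integrate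
      to 0, against the total mass 1.\<close>
    then have "AE k in circle_measure. (1 :: complex) = 0" by eventually_elim simp
    then have "integral\<^sup>L circle_measure (\<lambda>_. 1 :: complex) = 0" by (rule integral_eq_zero_AE)
    then show False using integral_circle_cis[of 0] by simp
  qed
  have "spreading_limit \<nu> F"
    unfolding spreading_limit_def
  proof (intro conjI allI impI)
    show "F \<in> {0..} \<rightarrow> {0..1}" unfolding F_def by (intro Pi_I edge_mean_indicator_bounds) auto
    show "mono_on {0..} F"
      unfolding F_def by (intro mono_onI edge_mean_indicator_mono) auto
    show "\<exists>y\<ge>0. F y \<noteq> 0" using F1 by (intro exI[of _ 1]) auto
    show "\<not> (\<exists>c\<^sub>0. c\<^sub>0 \<noteq> 0 \<and> (\<forall>y\<ge>0. F y = c\<^sub>0 * heaviside y))"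
      using F0 by (auto simp: heaviside_def)
    fix y :: real assume "y \<ge> 0"
    show "(\<lambda>n. \<Sum>j | real_of_int \<bar>j\<bar> < real n * y. \<nu> n j) \<longlonglongrightarrow> F y"
    proof (rule Lim_transform_eventually)
      show "(\<lambda>n. walk_mean n (indicator {- y<..<y})) \<longlonglongrightarrow> F y"
        unfolding F_def by (rule walk_mean_interval[OF AE2]) auto
      show "\<forall>\<^sub>F n in sequentially. walk_mean n (indicator {- y<..<y}) = (\<Sum>j | real_of_int \<bar>j\<bar> < real n * y. \<nu> n j)"
        using eventually_gt_at_top[of 0] by eventually_elim (simp only: open_window_sum)
    qed
  qed
  moreover have "continuous_on {0..} F"
  proof (rule continuous_on_sequentiallyI)
    fix u :: "nat \<Rightarrow> real" and y assume u: "u \<longlonglongrightarrow> y"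
    show "(\<lambda>n. F (u n)) \<longlonglongrightarrow> F y"
      unfolding F_def edge_mean_def
    proof (rule circle_bounded_convergence[where B = 1])
      \<comment> \<open>For fixed k the indicator is eventually constant along \<open>u\<close>,
        unless the velocity is exactly y or - y.\<close>
      have "AE k in lborel. \<bar>edge_velocity k\<bar> \<noteq> y"
        using AEv[of y] AEv[of "- y"] by eventually_elim auto
      then show "AE k in lborel. (\<lambda>n. (edge_weight k)\<^sup>2 * indicator {- u n..u n} (edge_velocity k)) \<longlonglongrightarrow>
         (edge_weight k)\<^sup>2 * indicator {- y..y} (edge_velocity k)"
      proof eventually_elim
        case (elim k)
        have "\<forall>\<^sub>F n in sequentially. indicator {- u n..u n} (edge_velocity k) = (indicator {- y..y} (edge_velocity k) :: real)"
        proof (cases "\<bar>edge_velocity k\<bar> < y")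
          case True
          from order_tendstoD(1)[OF u this] show ?thesis
            by eventually_elim (use True in \<open>auto simp: indicator_def abs_less_iff\<close>)
        next
          case False
          then have "y < \<bar>edge_velocity k\<bar>" using elim by simp
          from order_tendstoD(2)[OF u this] show ?thesis
            by eventually_elim (use \<open>y < \<bar>edge_velocity k\<bar>\<close> in \<open>auto simp: indicator_def\<close>)
        qed
        then show ?case by (intro tendsto_intros tendsto_eventually)
      qed
      show "norm ((edge_weight k)\<^sup>2 * indicator {- u n..u n} (edge_velocity k)) \<le> 1" for n k
        using edge_weight_bound[of k] by (auto simp: indicator_def power_le_one)
    qed measurable
  qed
  ultimately show "continuously_linear_spreading \<nu>"
    unfolding continuously_linear_spreading_def by auto
qed

end

section \<open>The ballistic and the localized case\<close>

text \<open>An antiderivative of cos k cis (- k j) is used on the three intervals of constant sign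
  of cos. For even j the denominator 1 - j^2 is non-zero and the boundary values of cis at odd
  multiples of pi / 2 are real.\<close>

lemma integral_abs_cos_cis:
  fixes j :: int
  assumes "even j"
  shows "(norm (integral\<^sup>L circle_measure (\<lambda>k. of_real \<bar>cos k\<bar> * cis (- k * of_int j))))\<^sup>2 =
    4 / (pi\<^sup>2 * ((real_of_int j)\<^sup>2 - 1)\<^sup>2)"
proof -
  define c where "c = 1 - (complex_of_int j)\<^sup>2"
  have "j\<^sup>2 \<noteq> 1" using assms by (metis even_power odd_one pos2)
  then have j1: "(real_of_int j)\<^sup>2 \<noteq> 1" by (metis of_int_eq_1_iff of_int_power)
  have c: "c = of_real (1 - (real_of_int j)\<^sup>2)" by (simp add: c_def)
  have c0: "c \<noteq> 0" unfolding c of_real_eq_0_iff using j1 by simp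
  \<comment> \<open>Integrating cos k cis (- k j) by parts twice reproduces the integral with factor
    j^2; solving for it produces \<open>c\<close>.\<close>
  define F where "F k = cis (- k * of_int j) * (of_real (sin k) - \<i> * of_int j * of_real (cos k)) / c" for k :: real
  have F: "(F has_vector_derivative (of_real (cos k) * cis (- k * of_int j))) (at k within A)" for k A
  proof -
    have "((\<lambda>k. cis (- k * of_int j)) has_vector_derivative (- \<i> * of_int j * cis (- k * of_int j))) (at k within A)"
      unfolding cis_conv_exp
      by (auto intro!: derivative_eq_intros has_vector_derivative_real_field)
    moreover have "((\<lambda>k. of_real (sin k) - \<i> * of_int j * of_real (cos k)) has_vector_derivative
        (of_real (cos k) + \<i> * of_int j * of_real (sin k))) (at k within A)"
      by (auto intro!: derivative_eq_intros has_vector_derivative_of_real)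
    ultimately have "(F has_vector_derivative
      (cis (- k * of_int j) * (of_real (cos k) + \<i> * of_int j * of_real (sin k)) +
       (- \<i> * of_int j * cis (- k * of_int j)) * (of_real (sin k) - \<i> * of_int j * of_real (cos k))) / c) (at k within A)"
      unfolding F_def by (intro has_vector_derivative_divide has_vector_derivative_mult)
    moreover have "(cis (- k * of_int j) * (of_real (cos k) + \<i> * of_int j * of_real (sin k)) +
       (- \<i> * of_int j * cis (- k * of_int j)) * (of_real (sin k) - \<i> * of_int j * of_real (cos k))) =
       c * (of_real (cos k) * cis (- k * of_int j))"
      unfolding c_def by (simp add: algebra_simps power2_eq_square)
    ultimately show ?thesis using c0 by simp
  qed
  define f where "f k = of_real \<bar>cos k\<bar> * cis (- k * of_int j)" for k :: real
  have p1: "(f has_integral (F (pi / 2) - F 0)) {0..pi / 2}"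
  proof (rule has_integral_eq[OF _ fundamental_theorem_of_calculus])
    show "of_real (cos k) * cis (- k * of_int j) = f k" if "k \<in> {0..pi / 2}" for k
      using that by (simp add: f_def cos_ge_zero)
  qed (rule F | simp)+
  have p2: "(f has_integral - (F (3 * pi / 2) - F (pi / 2))) {pi / 2..3 * pi / 2}"
  proof (rule has_integral_eq[OF _ has_integral_neg[OF fundamental_theorem_of_calculus]])
    show "- (of_real (cos k) * cis (- k * of_int j)) = f k" if "k \<in> {pi / 2..3 * pi / 2}" for k
    proof -
      have "cos (k - pi) \<ge> 0" using that by (intro cos_ge_zero) auto
      then have "cos k \<le> 0" by (simp add: cos_diff)
      then show ?thesis by (simp add: f_def)
    qed
  qed (rule F | simp)+
  have p3: "(f has_integral (F (2 * pi) - F (3 * pi / 2))) {3 * pi / 2..2 * pi}"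
  proof (rule has_integral_eq[OF _ fundamental_theorem_of_calculus])
    show "of_real (cos k) * cis (- k * of_int j) = f k" if "k \<in> {3 * pi / 2..2 * pi}" for k
    proof -
      have "cos (k - 2 * pi) \<ge> 0" using that by (intro cos_ge_zero) auto
      then show ?thesis by (simp add: f_def cos_diff)
    qed
  qed (rule F | simp)+
  have "(f has_integral ((F (pi / 2) - F 0) + - (F (3 * pi / 2) - F (pi / 2)) + (F (2 * pi) - F (3 * pi / 2)))) {0..2 * pi}"
    by (rule has_integral_combine[OF _ _ has_integral_combine[OF _ _ p1 p2] p3]) auto
  moreover have "(F (pi / 2) - F 0) + - (F (3 * pi / 2) - F (pi / 2)) + (F (2 * pi) - F (3 * pi / 2)) =
     of_real (4 * (-1) ^ nat \<bar>j div 2\<bar>) / c"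
  proof -
    obtain m where m: "j = 2 * m" using assms by blast
    have sm: "sin (pi * of_int m) = 0" "cos (pi * of_int m) = (-1) ^ nat \<bar>m\<bar>" for m :: int
    proof -
      show "sin (pi * of_int m) = 0" by (simp add: sin_zero_iff_int2 mult.commute)
      have "cos (pi * of_int m) = cos (pi * real (nat \<bar>m\<bar>))"
        by (cases "m \<ge> 0") auto
      then show "cos (pi * of_int m) = (-1) ^ nat \<bar>m\<bar>" by (simp only: cos_npi2)
    qed
    have e1: "cis (- (pi / 2) * of_int j) = of_real ((-1) ^ nat \<bar>m\<bar>)"
      using sm[of m] by (simp add: m complex_eq_iff)
    have e3: "cis (- (3 * pi / 2) * of_int j) = of_real ((-1) ^ nat \<bar>m\<bar>)"
    proof -
      have "cis (- (3 * pi / 2) * of_int j) = cis (- (pi / 2) * of_int j) ^ 3"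
        unfolding Complex.DeMoivre by (rule arg_cong[of _ _ cis]) simp
      also have "\<dots> = of_real ((-1) ^ nat \<bar>m\<bar>)"
        unfolding e1 by (simp add: power3_eq_cube flip: power_add)
      finally show ?thesis .
    qed
    have F2pi: "F (2 * pi) = F 0"
    proof -
      have "cis (- (2 * pi) * of_int j) = 1" using cis_multiple_2pi[of "- of_int j"] by simp
      then show ?thesis by (simp add: F_def)
    qed
    have s3: "sin (3 * pi / 2) = -1" "cos (3 * pi / 2) = 0"
      using sin_3over2_pi cos_3over2_pi by (simp_all add: field_simps)
    have "F (pi / 2) = of_real ((-1) ^ nat \<bar>m\<bar>) / c" using e1 by (simp add: F_def)
    moreover have "F (3 * pi / 2) = - of_real ((-1) ^ nat \<bar>m\<bar>) / c" using e3 by (simp add: F_def s3)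
    ultimately show ?thesis using F2pi by (simp add: m)
  qed
  ultimately have "integral {0..2 * pi} f = of_real (4 * (-1) ^ nat \<bar>j div 2\<bar>) / c"
    by (simp add: integral_unique)
  moreover have cont: "continuous_on A f" for A
    unfolding f_def by (intro continuous_intros)
  then have "(LINT k:{0..2 * pi}|lborel. f k) = integral {0..2 * pi} f"
    by (intro set_borel_integral_eq_integral borel_integrable_atLeastAtMost')
  moreover have "f \<in> borel_measurable borel" by (intro borel_measurable_continuous_onI cont)
  ultimately have "integral\<^sup>L circle_measure f = (1 / (2 * pi)) *\<^sub>R (of_real (4 * (-1) ^ nat \<bar>j div 2\<bar>) / c)"
    by (subst integral_circle_measure) auto
  then have "norm (integral\<^sup>L circle_measure f) =
      \<bar>1 / (2 * pi)\<bar> * (\<bar>4 * (-1) ^ nat \<bar>j div 2\<bar>\<bar> / \<bar>1 - (real_of_int j)\<^sup>2\<bar>)"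
    by (simp only: c norm_scaleR norm_divide norm_of_real)
  also have "\<dots> = 2 / (pi * \<bar>1 - (real_of_int j)\<^sup>2\<bar>)" by (simp add: abs_mult power_abs)
  finally have "norm (integral\<^sup>L circle_measure f) = 2 / (pi * \<bar>1 - (real_of_int j)\<^sup>2\<bar>)" .
  then show ?thesis
    unfolding f_def by (simp add: power_divide power_mult_distrib power2_commute[of 1])
qed

lemma integral_circle_cong:
  fixes f g :: "real \<Rightarrow> 'a :: {banach, second_countable_topology}"
  assumes "f \<in> borel_measurable borel" "g \<in> borel_measurable borel"
    and "\<And>k. cos k \<noteq> 0 \<Longrightarrow> f k = g k"
  shows "integral\<^sup>L circle_measure f = integral\<^sup>L circle_measure g"
proof (rule integral_cong_AE)
  show "AE k in circle_measure. f k = g k"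
    by (rule AE_circle_measure) (use AE_cos_neq[of 0] assms(3) in \<open>auto elim!: eventually_mono\<close>)
qed (use assms in simp_all)

context boundary_walk
begin

text \<open>Each double step changes j by exactly one.\<close>

lemma amp_parity:
  assumes "odd (int n + j)"
  shows "amp n j = 0"
proof -
  have "walk \<alpha> \<beta> n ((x, j), D0) = 0 \<and> walk \<alpha> \<beta> n ((x, j), D1) = 0" for x
    using assms
  proof (induction n arbitrary: x j)
    case 0
    then show ?case by (simp only: walk_0) auto
  next
    case (Suc n)
    then have "odd (int n + (j + 1))" "odd (int n + (j - 1))" by auto
    from Suc.IH[OF this(1)] Suc.IH[OF this(2)] show ?case by (simp only: walk_Suc) simp
  qed
  then show ?thesis by (simp add: amp_def self_loop_def)
qed

text \<open>Probabilities see only the modulus of the edge coefficient, so its sign may alternate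
  with n. The sequence \<open>m\<close> covers all, even or odd times, and the site may depend on
  the time.\<close>

lemma norm_amp_limit:
  assumes "\<And>n. norm (integral\<^sup>L circle_measure (\<lambda>k. edge_part (m n) k * cis (- k * of_int (J (m n))))) = L"
    and "filterlim m at_top sequentially"
  shows "(\<lambda>n. \<nu> (m n) (J (m n))) \<longlonglongrightarrow> L\<^sup>2"
proof -
  have "(\<lambda>n. amp (m n) (J (m n)) - integral\<^sup>L circle_measure (\<lambda>k. edge_part (m n) k * cis (- k * of_int (J (m n))))) \<longlonglongrightarrow> 0"
    by (rule filterlim_compose[OF amp_edge_limit assms(2)])
  then have "(\<lambda>n. norm (amp (m n) (J (m n))) - L) \<longlonglongrightarrow> 0"
  proof (rule Lim_null_comparison[OF _ tendsto_norm_zero, rotated])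
    show "\<forall>\<^sub>F n in sequentially. norm (norm (amp (m n) (J (m n))) - L) \<le>
      norm (amp (m n) (J (m n)) - integral\<^sup>L circle_measure (\<lambda>k. edge_part (m n) k * cis (- k * of_int (J (m n)))))"
    proof (intro always_eventually allI)
      fix n
      show "norm (norm (amp (m n) (J (m n))) - L) \<le>
        norm (amp (m n) (J (m n)) - integral\<^sup>L circle_measure (\<lambda>k. edge_part (m n) k * cis (- k * of_int (J (m n)))))"
        using norm_triangle_ineq3[of "amp (m n) (J (m n))"
          "integral\<^sup>L circle_measure (\<lambda>k. edge_part (m n) k * cis (- k * of_int (J (m n))))"]
        unfolding assms(1) real_norm_def .
    qed
  qed
  then have "(\<lambda>n. norm (amp (m n) (J (m n)))) \<longlonglongrightarrow> L"
    by (simp add: LIM_zero_iff)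
  then show ?thesis unfolding boundary_prob_amp by (intro tendsto_intros)
qed

section \<open>The ballistic case: a phase linear in k\<close>

context
  assumes r1: "\<bar>r\<bar> = 1"
begin

lemma rs_sgn: "sgn (r * s) = 1 \<or> sgn (r * s) = -1"
  using r1 s0 by (auto simp: sgn_if)

lemma floor_sgn:
  "sgn (r * s) = 1 \<and> \<lfloor>sgn (r * s)\<rfloor> = 1 \<or> sgn (r * s) = -1 \<and> \<lfloor>sgn (r * s)\<rfloor> = -1"
proof -
  have "\<lfloor>-1 :: real\<rfloor> = -1" by (rule floor_unique) auto
  then show ?thesis using rs_sgn by (metis floor_one)
qed

lemma r_ballistic: "r = sgn (r * s) * sgn s" "sgn s * r = sgn (r * s)"
  using r1 s0 by (auto simp: sgn_if abs_if zero_less_mult_iff split: if_splits)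

lemma ballistic_sqrt: "sqrt (1 - (r * sin k)\<^sup>2) = \<bar>cos k\<bar>"
proof -
  have "r\<^sup>2 = 1" using r1 by (simp add: power2_eq_1_iff abs_if split: if_splits)
  then have "1 - (r * sin k)\<^sup>2 = (cos k)\<^sup>2" by (simp add: power_mult_distrib cos_squared_eq)
  then show ?thesis by simp
qed

text \<open>With r^2 = 1 the root sqrt (1 - r^2 sin^2 k) is |cos k|; it cancels from weight and
  velocity, and the phase becomes a plane wave.\<close>

lemma ballistic_edge:
  assumes "cos k \<noteq> 0"
  shows "edge_weight k = \<bar>s\<bar>" "edge_velocity k = sgn (r * s)"
    "edge_phase k = - of_real (sgn s) * cis (sgn (r * s) * k)"
proof -
  show "edge_weight k = \<bar>s\<bar>" "edge_velocity k = sgn (r * s)"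
    using assms by (simp_all add: edge_weight_def edge_velocity_def ballistic_sqrt abs_mult r_ballistic(2))
  show "edge_phase k = - of_real (sgn s) * cis (sgn (r * s) * k)"
  proof -
    have "edge_phase k = - of_real (sgn s) * Complex (cos k) (sgn s * r * sin k)"
      unfolding edge_phase_def ballistic_sqrt using assms s0
      by (auto simp: complex_eq_iff sgn_if abs_if mult_less_0_iff)
    also have "Complex (cos k) (sgn s * r * sin k) = cis (sgn (r * s) * k)"
      unfolding r_ballistic(2) using rs_sgn by (auto simp: complex_eq_iff)
    finally show ?thesis .
  qed
qed

lemma ballistic_edge_mean:
  assumes [measurable]: "f \<in> borel_measurable borel"
  shows "edge_mean f = s\<^sup>2 * f (sgn (r * s))"
proof -
  have "edge_mean f = integral\<^sup>L circle_measure (\<lambda>k. s\<^sup>2 * f (sgn (r * s)))"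
    unfolding edge_mean_def by (rule integral_circle_cong) (measurable, simp add: ballistic_edge)
  also have "\<dots> = s\<^sup>2 * f (sgn (r * s))"
    by (subst integral_circle_measure) (simp_all add: set_lebesgue_integral_def)
  finally show ?thesis .
qed

text \<open>Up to sign and the factor |s|, the edge part is the character of the single site sgn (r
  s) n, so orthogonality of characters decides.\<close>

lemma ballistic_local:
  "(\<lambda>n. \<nu> n (\<lfloor>sgn (r * s)\<rfloor> * (int n - j))) \<longlonglongrightarrow> (if j = 0 then s\<^sup>2 else 0)"
proof -
  define i where "i = \<lfloor>sgn (r * s)\<rfloor>"
  have i: "sgn (r * s) = of_int i" "i = 1 \<or> i = -1" using floor_sgn by (auto simp: i_def)
  define J where "J n = i * (int n - j)" for n
  have "(\<lambda>n. \<nu> n (J n)) \<longlonglongrightarrow> (if j = 0 then \<bar>s\<bar> else 0)\<^sup>2"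
  proof (rule norm_amp_limit[where m = "\<lambda>n. n", OF _ filterlim_ident])
    fix n
    have "integral\<^sup>L circle_measure (\<lambda>k. edge_part n k * cis (- k * of_int (J n))) =
       integral\<^sup>L circle_measure (\<lambda>k. of_real \<bar>s\<bar> * (- of_real (sgn s)) ^ n * cis (k * of_int (i * j)))"
    proof (rule integral_circle_cong)
      fix k :: real assume k: "cos k \<noteq> 0"
      have "cis (real_of_int i * k) ^ n * cis (- k * of_int (J n)) = cis (k * of_int (i * j))"
        unfolding Complex.DeMoivre cis_mult by (rule arg_cong[of _ _ cis]) (simp add: J_def algebra_simps)
      then show "edge_part n k * cis (- k * of_int (J n)) = of_real \<bar>s\<bar> * (- of_real (sgn s)) ^ n * cis (k * of_int (i * j))"
        unfolding edge_part_def ballistic_edge[OF k] i(1) power_mult_distrib by (simp only: mult.assoc)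
    qed measurable
    also have "\<dots> = of_real \<bar>s\<bar> * (- of_real (sgn s)) ^ n * (if j = 0 then 1 else 0)"
      unfolding integral_mult_right_zero integral_circle_cis using i(2) by auto
    also have "norm \<dots> = (if j = 0 then \<bar>s\<bar> else 0)"
      using s0 by (simp add: norm_mult norm_power abs_sgn_eq)
    finally show "norm (integral\<^sup>L circle_measure (\<lambda>k. edge_part n k * cis (- k * of_int (J n)))) = (if j = 0 then \<bar>s\<bar> else 0)" .
  qed
  then show ?thesis by (auto simp: J_def i_def split: if_splits)
qed

lemma ballistic_total: "(\<lambda>n. walk_mean n (\<lambda>_. 1)) \<longlonglongrightarrow> s\<^sup>2"
  using walk_mean_continuous[of "\<lambda>_. 1"] by (simp add: ballistic_edge_mean)

lemma ballistic_window:
  assumes "a \<noteq> sgn (r * s)" "b \<noteq> sgn (r * s)" "{a<..<b} \<subseteq> S" "S \<subseteq> {a..b}"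
  shows "(\<lambda>n. walk_mean n (indicator S)) \<longlonglongrightarrow> s\<^sup>2 * indicator {a..b} (sgn (r * s))"
proof -
  have "AE k in lborel. edge_velocity k \<noteq> a \<and> edge_velocity k \<noteq> b"
    using AE_cos_neq[of 0] by eventually_elim (use assms in \<open>auto simp: ballistic_edge\<close>)
  from walk_mean_interval[OF this assms(3,4)] show ?thesis by (simp add: ballistic_edge_mean)
qed

text \<open>Away from the jump this is weak convergence. At the jump the mass sits on the endpoint
  and weak convergence does not decide: for sign 1 the window contains every site that carries mass,
  for sign -1 only the site - n, whose mass is known from \<open>ballistic_local\<close>.\<close>

lemma ballistic_cdf:
  "(\<lambda>n. \<Sum>\<^sub>\<infinity>j\<in>{j. real_of_int j / real n \<le> y}. \<nu> n j) \<longlonglongrightarrow> s\<^sup>2 * heaviside (y - sgn (r * s))"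
  unfolding infsum_le_eq_walk_mean
proof (cases "y = sgn (r * s)")
  case False
  \<comment> \<open>-2 stands for minus infinity: all j / n are at least -1, and -2 is not the
    position of the atom.\<close>
  have "(\<lambda>n. walk_mean n (indicator {-2..y})) \<longlonglongrightarrow> s\<^sup>2 * indicator {-2..y} (sgn (r * s))"
    by (rule ballistic_window) (use False rs_sgn in auto)
  moreover have "indicator {-2..y} (sgn (r * s)) = heaviside (y - sgn (r * s))"
    using rs_sgn by (auto simp: heaviside_def indicator_def)
  moreover have "walk_mean n (indicator {-2..y}) = walk_mean n (indicator {..y})" for n
  proof (rule walk_mean_indicator_cong)
    fix j assume "\<bar>j\<bar> \<le> int n"
    then have "real_of_int j / real n \<ge> -2" by (cases "n = 0") (auto simp: field_simps)
    then show "indicator {-2..y} (real_of_int j / real n) = (indicator {..y} (real_of_int j / real n) :: real)"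
      by (auto simp: indicator_def)
  qed
  ultimately show "(\<lambda>n. walk_mean n (indicator {..y})) \<longlonglongrightarrow> s\<^sup>2 * heaviside (y - sgn (r * s))" by simp
next
  case y: True
  have "(\<lambda>n. walk_mean n (indicator {..y})) \<longlonglongrightarrow> s\<^sup>2"
    using rs_sgn
  proof
    assume "sgn (r * s) = 1"
    then have y1: "y = 1" using y by simp
    have "walk_mean n (indicator {..y}) = walk_mean n (\<lambda>_. 1)" for n
    proof (rule walk_mean_indicator_cong)
      fix j assume "\<bar>j\<bar> \<le> int n"
      then have "real_of_int j / real n \<le> y" unfolding y1 by (cases "n = 0") (auto simp: field_simps)
      then show "indicator {..y} (real_of_int j / real n) = (1 :: real)" by simp
    qed
    then show ?thesis using ballistic_total by simp
  next
    assume sg: "sgn (r * s) = -1"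
    then have y1: "y = -1" using y by simp
    have "\<forall>\<^sub>F n in sequentially. \<nu> n (- int n) = walk_mean n (indicator {..y})"
      using eventually_gt_at_top[of 0]
    proof eventually_elim
      case (elim n)
      have "walk_mean n (indicator {..y}) = (\<Sum>j\<in>{- int n..int n}. if j = - int n then \<nu> n j else 0)"
        unfolding walk_mean_def
        by (intro sum.cong refl) (use elim in \<open>auto simp: y1 boundary_prob_amp indicator_def field_simps\<close>)
      then show ?case by simp
    qed
    moreover have "(\<lambda>n. \<nu> n (- int n)) \<longlonglongrightarrow> s\<^sup>2"
      using ballistic_local[of 0] floor_sgn sg by auto
    ultimately show ?thesis by (rule Lim_transform_eventually[rotated])
  qed
  then show "(\<lambda>n. walk_mean n (indicator {..y})) \<longlonglongrightarrow> s\<^sup>2 * heaviside (y - sgn (r * s))"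
    by (simp add: y heaviside_def)
qed

lemma ballistic_weak:
  assumes f: "continuous_on UNIV f"
  shows "(\<lambda>n. \<Sum>\<^sub>\<infinity>j. \<nu> n j * f (real_of_int j / real n)) \<longlonglongrightarrow> s\<^sup>2 * f (sgn (r * s))"
  unfolding infsum_UNIV_eq_walk_mean
  using walk_mean_continuous[OF f] ballistic_edge_mean[OF borel_measurable_continuous_onI[OF f]] by simp

text \<open>At y = 1 the open window omits the extreme site, which carries all of the limiting mass;
  hence F is still 0 there.\<close>

lemma ballistic_case: "ballistic_spreading \<nu>"
proof -
  define F where "F y = (if y > 1 then s\<^sup>2 else 0)" for y :: real
  have "spreading_limit \<nu> F"
    unfolding spreading_limit_def
  proof (intro conjI allI impI)
    have "s\<^sup>2 \<le> 1" using rs_le_1 by (simp add: abs_square_le_1)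
    then show "F \<in> {0..} \<rightarrow> {0..1}" by (auto simp: F_def)
    show "mono_on {0..} F" by (auto simp: F_def intro!: mono_onI)
    show "\<exists>y\<ge>0. F y \<noteq> 0" using s0 by (intro exI[of _ 2]) (auto simp: F_def)
    show "\<not> (\<exists>c\<^sub>0. c\<^sub>0 \<noteq> 0 \<and> (\<forall>y\<ge>0. F y = c\<^sub>0 * heaviside y))"
    proof
      assume "\<exists>c\<^sub>0. c\<^sub>0 \<noteq> 0 \<and> (\<forall>y\<ge>0. F y = c\<^sub>0 * heaviside y)"
      then obtain c where "c \<noteq> 0" "F 0 = c * heaviside 0" by auto
      then show False by (simp add: F_def heaviside_def)
    qed
    fix y :: real assume y: "y \<ge> 0"
    have "(\<lambda>n. walk_mean n (indicator {- y<..<y})) \<longlonglongrightarrow> F y"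
    proof (cases "y = 1")
      case False
      have "(\<lambda>n. walk_mean n (indicator {- y<..<y})) \<longlonglongrightarrow> s\<^sup>2 * indicator {- y..y} (sgn (r * s))"
        by (rule ballistic_window) (use False y rs_sgn in auto)
      moreover have "s\<^sup>2 * indicator {- y..y} (sgn (r * s)) = F y"
        using False y rs_sgn by (auto simp: F_def indicator_def)
      ultimately show ?thesis by simp
    next
      case True
      define i where "i = \<lfloor>sgn (r * s)\<rfloor>"
      have i: "i = 1 \<or> i = -1" using floor_sgn by (auto simp: i_def)
      \<comment> \<open>Removing the extreme site from the total leaves a bound that tends to s^2 -
        s^2 = 0.\<close>
      have le: "walk_mean n (indicator {- 1<..<1}) \<le> walk_mean n (\<lambda>_. 1) - \<nu> n (i * int n)" if n: "n > 0" for n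
      proof -
        have mem: "i * int n \<in> {- int n..int n}" using i by auto
        have "walk_mean n (indicator {- 1<..<1}) =
          (\<Sum>j\<in>{- int n..int n} - {i * int n}. (cmod (amp n j))\<^sup>2 * indicator {- 1<..<1} (real_of_int j / real n))"
          unfolding walk_mean_def by (rule sum.mono_neutral_right) (use n i in auto)
        also have "\<dots> \<le> (\<Sum>j\<in>{- int n..int n} - {i * int n}. (cmod (amp n j))\<^sup>2 * 1)"
          by (intro sum_mono mult_left_mono) (auto simp: indicator_def)
        also have "\<dots> = walk_mean n (\<lambda>_. 1) - \<nu> n (i * int n)"
          unfolding walk_mean_def using mem by (subst sum_diff1) (auto simp: boundary_prob_amp)
        finally show ?thesis .
      qed
      have "(\<lambda>n. walk_mean n (indicator {- 1<..<1})) \<longlonglongrightarrow> 0"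
      proof (rule tendsto_sandwich[OF _ _ tendsto_const])
        show "\<forall>\<^sub>F n in sequentially. 0 \<le> walk_mean n (indicator {- 1<..<1})"
          unfolding walk_mean_def by (intro always_eventually allI sum_nonneg) auto
        show "\<forall>\<^sub>F n in sequentially. walk_mean n (indicator {- 1<..<1}) \<le> walk_mean n (\<lambda>_. 1) - \<nu> n (i * int n)"
          using eventually_gt_at_top[of 0] by eventually_elim (rule le)
        have "(\<lambda>n. \<nu> n (i * int n)) \<longlonglongrightarrow> s\<^sup>2" using ballistic_local[of 0] by (simp add: i_def)
        from tendsto_diff[OF ballistic_total this]
        show "(\<lambda>n. walk_mean n (\<lambda>_. 1) - \<nu> n (i * int n)) \<longlonglongrightarrow> 0" by simp
      qed
      then show ?thesis using True by (simp add: F_def)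
    qed
    moreover have "\<forall>\<^sub>F n in sequentially. walk_mean n (indicator {- y<..<y}) = (\<Sum>j | real_of_int \<bar>j\<bar> < real n * y. \<nu> n j)"
      using eventually_gt_at_top[of 0] by eventually_elim (simp only: open_window_sum)
    ultimately show "(\<lambda>n. \<Sum>j | real_of_int \<bar>j\<bar> < real n * y. \<nu> n j) \<longlonglongrightarrow> F y"
      by (rule Lim_transform_eventually)
  qed
  moreover have "\<forall>y\<ge>0. y \<noteq> 1 \<longrightarrow> F y = s\<^sup>2 * heaviside (y - 1)"
    by (auto simp: F_def heaviside_def)
  ultimately show ?thesis unfolding ballistic_spreading_def by blast
qed

end

section \<open>The localized case: a phase equal to 1 or -1\<close>

context
  assumes r_zero: "r = 0"
begin

text \<open>For r = 0 the phase is - sgn (s cos k) wherever the weight is non-zero: even powers are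
  1, odd powers turn |s cos k| into - s cos k.\<close>

lemma localized_edge_part:
  "edge_part (2 * n) k = of_real \<bar>s\<bar> * of_real \<bar>cos k\<bar>"
  "edge_part (2 * n + 1) k = of_real (- s) * of_real (cos k)"
  unfolding edge_part_def edge_weight_def edge_phase_def unfolding r_zero
  using s0 by (auto simp: abs_mult abs_if mult_less_0_iff)

lemma localized_even:
  "(\<lambda>n. \<nu> (2 * n) j) \<longlonglongrightarrow> (if even j then s\<^sup>2 / pi\<^sup>2 * (4 / ((real_of_int j)\<^sup>2 - 1)\<^sup>2) else 0)"
proof (cases "even j")
  case True
  define I where "I = integral\<^sup>L circle_measure (\<lambda>k. of_real \<bar>cos k\<bar> * cis (- k * of_int j))"
  have "(\<lambda>n. \<nu> (2 * n) j) \<longlonglongrightarrow> (\<bar>s\<bar> * norm I)\<^sup>2"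
  proof (rule norm_amp_limit[where J = "\<lambda>_. j"])
    show "filterlim (\<lambda>n::nat. 2 * n) at_top sequentially"
      by (intro filterlim_subseq strict_monoI) auto
    show "norm (integral\<^sup>L circle_measure (\<lambda>k. edge_part (2 * n) k * cis (- k * of_int j))) = \<bar>s\<bar> * norm I" for n
      unfolding localized_edge_part mult.assoc integral_mult_right_zero I_def norm_mult by simp
  qed
  moreover have "(\<bar>s\<bar> * norm I)\<^sup>2 = s\<^sup>2 / pi\<^sup>2 * (4 / ((real_of_int j)\<^sup>2 - 1)\<^sup>2)"
    unfolding power_mult_distrib I_def integral_abs_cos_cis[OF True] by simp
  ultimately show ?thesis using True by simp
next
  case False
  then have "\<nu> (2 * n) j = 0" for n by (simp add: boundary_prob_amp amp_parity)
  then show ?thesis using False by simp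
qed

text \<open>The only non-zero Fourier coefficients of cos are 1 / 2 at 1 and -1.\<close>

lemma localized_odd:
  "(\<lambda>n. \<nu> (2 * n + 1) j) \<longlonglongrightarrow> (if j \<in> {1, -1} then s\<^sup>2 / 4 else 0)"
proof -
  have I: "integral\<^sup>L circle_measure (\<lambda>k. of_real (cos k) * cis (- k * of_int j)) = (if j \<in> {1, -1} then 1 / 2 else 0)"
  proof -
    have "of_real (cos k) * cis (- k * of_int j) = 1 / 2 * cis (k * of_int (1 - j)) + 1 / 2 * cis (k * of_int (- 1 - j))" for k
    proof -
      have "cis (k * of_int (1 - j)) = cis k * cis (- k * of_int j)"
        "cis (k * of_int (- 1 - j)) = cis (- k) * cis (- k * of_int j)"
        unfolding cis_mult by (simp_all add: algebra_simps)
      moreover have "of_real (cos k) = 1 / 2 * cis k + 1 / 2 * cis (- k)" by (simp add: complex_eq_iff)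
      ultimately show ?thesis by (simp only: distrib_right mult.assoc)
    qed
    then have "integral\<^sup>L circle_measure (\<lambda>k. of_real (cos k) * cis (- k * of_int j)) =
      integral\<^sup>L circle_measure (\<lambda>k. 1 / 2 * cis (k * of_int (1 - j)) + 1 / 2 * cis (k * of_int (- 1 - j)))"
      by (simp only:)
    also have "\<dots> = integral\<^sup>L circle_measure (\<lambda>k. 1 / 2 * cis (k * of_int (1 - j))) +
       integral\<^sup>L circle_measure (\<lambda>k. 1 / 2 * cis (k * of_int (- 1 - j)))"
    proof (rule Bochner_Integration.integral_add)
      show "integrable circle_measure (\<lambda>k. 1 / 2 * cis (k * of_int i))" for i
      proof (rule integrable_circle_measure)
        show "norm (1 / 2 * cis (k * of_int i)) \<le> 1" for k by (simp add: norm_mult norm_divide)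
      qed measurable
      then show "integrable circle_measure (\<lambda>k. 1 / 2 * cis (k * of_int i))" for i .
    qed
    also have "\<dots> = (if j \<in> {1, -1} then 1 / 2 else 0)"
      unfolding integral_mult_right_zero integral_circle_cis by auto
    finally show ?thesis .
  qed
  have "(\<lambda>n. \<nu> (2 * n + 1) j) \<longlonglongrightarrow> (\<bar>s\<bar> * (if j \<in> {1, -1} then 1 / 2 else 0))\<^sup>2"
  proof (rule norm_amp_limit[where J = "\<lambda>_. j"])
    show "filterlim (\<lambda>n::nat. 2 * n + 1) at_top sequentially"
      by (intro filterlim_subseq strict_monoI) auto
    show "norm (integral\<^sup>L circle_measure (\<lambda>k. edge_part (2 * n + 1) k * cis (- k * of_int j))) =
        \<bar>s\<bar> * (if j \<in> {1, -1} then 1 / 2 else 0)" for n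
      unfolding localized_edge_part mult.assoc integral_mult_right_zero I norm_mult by (simp add: norm_divide)
  qed
  then show ?thesis by (auto simp: power_mult_distrib power_divide split: if_splits)
qed

text \<open>The origin is the witness. Even times alone keep its time average away from 0, since
  they have the positive limit 4 s^2 / pi^2.\<close>

lemma localized_case: "localization \<nu>"
proof -
  define c where "c = s\<^sup>2 / pi\<^sup>2 * 4"
  have c: "c > 0" using s0 by (simp add: c_def)
  have "(\<lambda>n. \<nu> (2 * n) 0) \<longlonglongrightarrow> c" using localized_even[of 0] by (simp add: c_def)
  from order_tendstoD(1)[OF this, of "c / 2"] c obtain N where "\<forall>n\<ge>N. c / 2 < \<nu> (2 * n) 0"
    by (auto simp: eventually_sequentially)
  then have N: "\<And>n. n \<ge> N \<Longrightarrow> \<nu> (2 * n) 0 \<ge> c / 2" by (auto intro: less_imp_le)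
  have lower: "real (m - N) * (c / 2) \<le> (\<Sum>n<2 * m. \<nu> n 0)" for m
  proof -
    have "real (m - N) * (c / 2) = (\<Sum>n\<in>{N..<m}. c / 2)" by simp
    also have "\<dots> \<le> (\<Sum>n\<in>{N..<m}. \<nu> (2 * n) 0)" by (intro sum_mono N) auto
    also have "\<dots> = (\<Sum>n\<in>(\<lambda>n. 2 * n) ` {N..<m}. \<nu> n 0)"
      by (subst sum.reindex) (auto simp: inj_on_def)
    also have "\<dots> \<le> (\<Sum>n<2 * m. \<nu> n 0)"
      by (intro sum_mono2) (auto simp: nu_nonneg)
    finally show ?thesis .
  qed
  \<comment> \<open>At least m - N \<ge> m / 2 even times below T have mass c / 2 or more, and T
    \<le> 3 m; the quotient of (m / 2) (c / 2) by 3 m is c / 12. The bound 4 N + 4 on T guarantees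
    both inequalities.\<close>
  have "\<forall>\<^sub>F T in sequentially. ereal (c / 12) \<le> ereal (1 / real T * (\<Sum>n<T. \<nu> n 0))"
    using eventually_ge_at_top[of "4 * N + 4"]
  proof eventually_elim
    case (elim T)
    define m where "m = T div 2"
    have m: "2 * m \<le> T" "T \<le> 3 * m" "2 * N \<le> m" using elim by (auto simp: m_def)
    have "real T * (c / 12) \<le> real (3 * m) * (c / 12)" using m c by (intro mult_right_mono) auto
    also have "\<dots> = (real m / 2) * (c / 2)" by simp
    also have "\<dots> \<le> real (m - N) * (c / 2)" using m c by (intro mult_right_mono) auto
    also have "\<dots> \<le> (\<Sum>n<2 * m. \<nu> n 0)" by (rule lower)
    also have "\<dots> \<le> (\<Sum>n<T. \<nu> n 0)" using m by (intro sum_mono2) (auto simp: nu_nonneg)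
    finally show ?case using elim by (simp add: field_simps)
  qed
  then have "ereal (c / 12) \<le> limsup (\<lambda>T. ereal (1 / real T * (\<Sum>n<T. \<nu> n 0)))"
    by (intro le_Limsup) auto
  moreover have "0 < ereal (c / 12)" using c by simp
  ultimately show ?thesis unfolding localization_def by (intro exI[of _ 0]) (rule less_le_trans)
qed

end

end

theorem theorem3:
  fixes \<alpha> \<beta> s r :: real and \<nu> :: "nat \<Rightarrow> int \<Rightarrow> real"
  assumes "0 \<le> \<alpha>" "\<alpha> < 2 * pi" "0 \<le> \<beta>" "\<beta> < 2 * pi"
    and "s = sin (\<alpha> + \<beta>)" "s \<noteq> 0" "r = sin (\<alpha> - \<beta>)"
    and "\<nu> = boundary_prob \<alpha> \<beta>"
  shows
    "(0 < \<bar>r\<bar> \<and> \<bar>r\<bar> < 1 \<longrightarrow>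
        continuously_linear_spreading \<nu> \<and>
        (\<forall>a b. a < b \<longrightarrow>
           set_integrable lborel {a..b} (limit_density s r) \<and>
           (\<lambda>n. \<Sum>j | a \<le> real_of_int j / real n \<and> real_of_int j / real n \<le> b. \<nu> n j)
             \<longlonglongrightarrow> (LINT y:{a..b}|lborel. limit_density s r y))) \<and>
     (\<bar>r\<bar> = 1 \<longrightarrow>
        ballistic_spreading \<nu> \<and>
        (\<forall>y. (\<lambda>n. \<Sum>\<^sub>\<infinity>j\<in>{j. real_of_int j / real n \<le> y}. \<nu> n j)
               \<longlonglongrightarrow> s\<^sup>2 * heaviside (y - sgn (r * s))) \<and>
        (\<forall>f :: real \<Rightarrow> real. continuous_on UNIV f \<and> bounded (range f) \<longrightarrow>
           (\<lambda>n. \<Sum>\<^sub>\<infinity>j. \<nu> n j * f (real_of_int j / real n)) \<longlonglongrightarrow> s\<^sup>2 * f (sgn (r * s))) \<and>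
        (\<forall>j. (\<lambda>n. \<nu> n (\<lfloor>sgn (r * s)\<rfloor> * (int n - j))) \<longlonglongrightarrow> (if j = 0 then s\<^sup>2 else 0))) \<and>
     (\<bar>r\<bar> = 0 \<longrightarrow>
        localization \<nu> \<and>
        (\<forall>j. (\<lambda>n. \<nu> (2 * n) j) \<longlonglongrightarrow>
               (if even j then s\<^sup>2 / pi\<^sup>2 * (4 / ((real_of_int j)\<^sup>2 - 1)\<^sup>2) else 0)) \<and>
        (\<forall>j. (\<lambda>n. \<nu> (2 * n + 1) j) \<longlonglongrightarrow> (if j \<in> {1, -1} then s\<^sup>2 / 4 else 0)))"
proof -
  have rs: "boundary_walk \<alpha> \<beta> s r" using assms by unfold_locales
  note \<nu> = \<open>\<nu> = boundary_prob \<alpha> \<beta>\<close>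
  show ?thesis
    unfolding \<nu>
    using boundary_walk.linear_case[OF rs] boundary_walk.ballistic_case[OF rs]
      boundary_walk.ballistic_cdf[OF rs] boundary_walk.ballistic_weak[OF rs]
      boundary_walk.ballistic_local[OF rs] boundary_walk.localized_case[OF rs]
      boundary_walk.localized_even[OF rs] boundary_walk.localized_odd[OF rs]
    by auto
qed

end
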